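(* Let $n\ge1$ and let $\mathscr N(n+2)$ be the set of nilpotent singular quadratic Lie algebra structures on $\mathbb C^{n+2}$. Let $\widehat{\mathscr N}^{\mathrm i}(n+2)$ and $\widehat{\mathscr N}(n+2)$ be the sets of i-isomorphism classes, respectively isomorphism classes, of elements of $\mathscr N(n+2)$. (1) Let $\mathfrak g,\mathfrak g'\in\mathscr N(n+2)$. Then $\mathfrak g$ and $\mathfrak g'$ are i-isomorphic if and only if they are isomorphic as Lie algebras. Thus $\widehat{\mathscr N}^{\mathrm i}(n+2)=\widehat{\mathscr N}(n+2)$. (2) Let $\widetilde{\mathcal N}(n)$ be the set of $\mathrm O(n)$-adjoint orbits of non-zero nilpotent elements of $\mathfrak o(n)$. Then the map $\overline C\mapsto\mathfrak g_{\overline C}$ induces a bijection from $\widetilde{\mathcal N}(n)$ onto $\widehat{\mathscr N}^{\mathrm i}(n+2)=\widehat{\mathscr N}(n+2)$. (3) The set $\widehat{\mathscr N}(n+2)$ is finite.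
   Context: All vector spaces are finite-dimensional over $\mathbb C$. $\mathbb C^n$ carries its canonical non-degenerate symmetric bilinear form $B$: for $n=2p$ with canonical basis $\{E_i,F_i\}_{1\le i\le p}$, $B(E_i,F_j)=\delta_{ij}$, $B(E_i,E_j)=B(F_i,F_j)=0$; for $n=2p+1$ with an additional basis vector $G$, orthogonal to all $E_i,F_i$, $B(G,G)=1$. $\mathrm O(n)$ is its isometry group, $\mathfrak o(n)$ the Lie algebra of $B$-skew-symmetric maps, and the adjoint action is $U\cdot C=UCU^{-1}$. A quadratic Lie algebra $(\mathfrak g,B)$ is a Lie algebra with a non-degenerate symmetric invariant bilinear form ($B([X,Y],Z)=B(X,[Y,Z])$). An i-isomorphism is a Lie algebra isomorphism that is an isometry. Let $I(X,Y,Z)=B([X,Y],Z)$ and $\mathrm{dup}(\mathfrak g)=\dim\{\alpha\in\mathfrak g^*\mid\alpha\wedge I=0\}$; a non-Abelian quadratic Lie algebra is singular if $\mathrm{dup}(\mathfrak g)\ge1$. A quadratic Lie algebra structure on $\mathbb C^{n+2}$ is a Lie bracket for which the canonical form is invariant. For $\overline C\in\mathfrak o(n)$, $\mathfrak g_{\overline C}$ is the double extension of $\mathbb C^n$ by $\overline C$: the orthogonal direct sum $(\mathbb CX_1\oplus\mathbb CY_1)\oplus\mathbb C^n$, with $B(X_1,X_1)=B(Y_1,Y_1)=0$, $B(X_1,Y_1)=1$, with bracket $[X+\lambda X_1+\mu Y_1,\,Y+\lambda'X_1+\mu'Y_1]=\mu\overline C(Y)-\mu'\overline C(X)+B(\overline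 C(X),Y)X_1$ for $X,Y\in\mathbb C^n$; it is viewed as a structure on $\mathbb C^{n+2}$ via any isometry of this quadratic space with $\mathbb C^{n+2}$ (its i-isomorphism class does not depend on the isometry). *)

theory Defs
  imports
    Jordan_Normal_Form.VS_Connect
    "HOL-Library.Function_Algebras"
    "HOL-Library.FuncSet"
begin

section \<open>The canonical quadratic space\<close>

text \<open>The canonical basis of \<open>\<complex>\<^sup>n\<close> is ordered as \<open>E\<^sub>1, F\<^sub>1, E\<^sub>2, F\<^sub>2, \<dots>\<close>, followed by \<open>G\<close> when
  \<open>n\<close> is odd; with indices starting at 0, \<open>E\<^sub>i\<close> is \<open>unit_vec n (2*i-2)\<close> and \<open>F\<^sub>i\<close> is
  \<open>unit_vec n (2*i-1)\<close>.\<close>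

definition canon_form :: "nat \<Rightarrow> complex vec \<Rightarrow> complex vec \<Rightarrow> complex" where
  "canon_form n X Y =
     (\<Sum>i<n div 2. X $ (2*i) * Y $ (2*i+1) + X $ (2*i+1) * Y $ (2*i))
     + (if odd n then X $ (n-1) * Y $ (n-1) else 0)"

definition orth_group :: "nat \<Rightarrow> complex mat set" where
  "orth_group n = {U \<in> carrier_mat n n. invertible_mat U \<and>
     (\<forall>X\<in>carrier_vec n. \<forall>Y\<in>carrier_vec n.
        canon_form n (U *\<^sub>v X) (U *\<^sub>v Y) = canon_form n X Y)}"

definition orth_algebra :: "nat \<Rightarrow> complex mat set" where
  "orth_algebra n = {C \<in> carrier_mat n n.
     \<forall>X\<in>carrier_vec n. \<forall>Y\<in>carrier_vec n.
        canon_form n (C *\<^sub>v X) Y = - canon_form n X (C *\<^sub>v Y)}"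

text \<open>\<open>similar_mat_wit D C U V\<close> says that \<open>D = U * C * V\<close> with \<open>V\<close> the inverse of \<open>U\<close>.\<close>

definition adjoint_orbit :: "nat \<Rightarrow> complex mat \<Rightarrow> complex mat set" where
  "adjoint_orbit n C = {D. \<exists>U\<in>orth_group n. \<exists>V. similar_mat_wit D C U V}"

definition nonzero_nilpotents :: "nat \<Rightarrow> complex mat set" where
  "nonzero_nilpotents n =
     {C \<in> orth_algebra n. C \<noteq> 0\<^sub>m n n \<and> (\<exists>k. C ^\<^sub>m k = 0\<^sub>m n n)}"

definition nilpotent_orbits :: "nat \<Rightarrow> complex mat set set" where
  "nilpotent_orbits n = adjoint_orbit n ` nonzero_nilpotents n"


section \<open>Quadratic Lie algebra structures\<close>

type_synonym bracket = "complex vec \<Rightarrow> complex vec \<Rightarrow> complex vec"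

text \<open>Brackets are extensional, so that distinct elements of \<open>lie_structures m\<close> are distinct
  structures on \<open>\<complex>\<^sup>m\<close>.\<close>

definition lie_structures :: "nat \<Rightarrow> bracket set" where
  "lie_structures m = {br \<in> carrier_vec m \<rightarrow>\<^sub>E (carrier_vec m \<rightarrow>\<^sub>E carrier_vec m).
     (\<forall>X\<in>carrier_vec m. \<forall>Y\<in>carrier_vec m. \<forall>Z\<in>carrier_vec m. \<forall>c.
        br (X + Y) Z = br X Z + br Y Z \<and> br (c \<cdot>\<^sub>v X) Z = c \<cdot>\<^sub>v br X Z \<and>
        br Z (X + Y) = br Z X + br Z Y \<and> br Z (c \<cdot>\<^sub>v X) = c \<cdot>\<^sub>v br Z X) \<and>
     (\<forall>X\<in>carrier_vec m. br X X = 0\<^sub>v m) \<and>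
     (\<forall>X\<in>carrier_vec m. \<forall>Y\<in>carrier_vec m. \<forall>Z\<in>carrier_vec m.
        br X (br Y Z) + br Y (br Z X) + br Z (br X Y) = 0\<^sub>v m)}"

definition quadratic_structures :: "nat \<Rightarrow> bracket set" where
  "quadratic_structures m = {br \<in> lie_structures m.
     \<forall>X\<in>carrier_vec m. \<forall>Y\<in>carrier_vec m. \<forall>Z\<in>carrier_vec m.
        canon_form m (br X Y) Z = canon_form m X (br Y Z)}"

definition abelian :: "nat \<Rightarrow> bracket \<Rightarrow> bool" where
  "abelian m br \<longleftrightarrow> (\<forall>X\<in>carrier_vec m. \<forall>Y\<in>carrier_vec m. br X Y = 0\<^sub>v m)"

primrec lower_central :: "nat \<Rightarrow> bracket \<Rightarrow> nat \<Rightarrow> complex vec set" where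
  "lower_central m br 0 = carrier_vec m"
| "lower_central m br (Suc k) =
     LinearCombinations.module.span class_ring (module_vec TYPE(complex) m)
       {br X Y | X Y. X \<in> carrier_vec m \<and> Y \<in> lower_central m br k}"

definition nilpotent_bracket :: "nat \<Rightarrow> bracket \<Rightarrow> bool" where
  "nilpotent_bracket m br \<longleftrightarrow> (\<exists>k. lower_central m br k = {0\<^sub>v m})"

text \<open>Linear forms on \<open>\<complex>\<^sup>m\<close> are extended by 0 outside \<open>carrier_vec m\<close>; this identifies the dual
  space with a linear subspace of the space of all functions \<open>complex vec \<Rightarrow> complex\<close>.\<close>

definition dual_space :: "nat \<Rightarrow> (complex vec \<Rightarrow> complex) set" where
  "dual_space m = {\<alpha>.
     (\<forall>X\<in>carrier_vec m. \<forall>Y\<in>carrier_vec m. \<alpha> (X + Y) = \<alpha> X + \<alpha> Y) \<and>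
     (\<forall>X\<in>carrier_vec m. \<forall>c. \<alpha> (c \<cdot>\<^sub>v X) = c * \<alpha> X) \<and>
     (\<forall>X. X \<notin> carrier_vec m \<longrightarrow> \<alpha> X = 0)}"

definition assoc_form ::
  "nat \<Rightarrow> bracket \<Rightarrow> complex vec \<Rightarrow> complex vec \<Rightarrow> complex vec \<Rightarrow> complex" where
  "assoc_form m br X Y Z = canon_form m (br X Y) Z"

text \<open>The exterior product of a 1-form and a 3-form, as a sum over the four (1,3)-shuffles.\<close>

definition wedge_1_3 ::
  "('v \<Rightarrow> complex) \<Rightarrow> ('v \<Rightarrow> 'v \<Rightarrow> 'v \<Rightarrow> complex) \<Rightarrow> 'v \<Rightarrow> 'v \<Rightarrow> 'v \<Rightarrow> 'v \<Rightarrow> complex" where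
  "wedge_1_3 \<alpha> J X Y Z W =
     \<alpha> X * J Y Z W - \<alpha> Y * J X Z W + \<alpha> Z * J X Y W - \<alpha> W * J X Y Z"

definition fun_scale :: "complex \<Rightarrow> ('v \<Rightarrow> complex) \<Rightarrow> 'v \<Rightarrow> complex" where
  "fun_scale c f = (\<lambda>x. c * f x)"

definition wedge_annihilator :: "nat \<Rightarrow> bracket \<Rightarrow> (complex vec \<Rightarrow> complex) set" where
  "wedge_annihilator m br = {\<alpha> \<in> dual_space m.
     \<forall>X\<in>carrier_vec m. \<forall>Y\<in>carrier_vec m. \<forall>Z\<in>carrier_vec m. \<forall>W\<in>carrier_vec m.
        wedge_1_3 \<alpha> (assoc_form m br) X Y Z W = 0}"

definition dup :: "nat \<Rightarrow> bracket \<Rightarrow> nat" where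
  "dup m br = vector_space.dim fun_scale (wedge_annihilator m br)"

definition singular :: "nat \<Rightarrow> bracket \<Rightarrow> bool" where
  "singular m br \<longleftrightarrow> \<not> abelian m br \<and> dup m br \<ge> 1"

definition nilpotent_singular :: "nat \<Rightarrow> bracket set" where
  "nilpotent_singular m =
     {br \<in> quadratic_structures m. nilpotent_bracket m br \<and> singular m br}"

lemma vector_space_fun_scale: "vector_space (fun_scale :: complex \<Rightarrow> ('v \<Rightarrow> complex) \<Rightarrow> _)"
  by unfold_locales (auto simp: fun_scale_def fun_eq_iff algebra_simps)

lemma subspace_wedge_annihilator:
  "Modules.module.subspace fun_scale (wedge_annihilator m br)"
proof -
  have module_fun_scale: "Modules.module (fun_scale :: complex \<Rightarrow> (complex vec \<Rightarrow> complex) \<Rightarrow> _)"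
    by (simp add: module_iff_vector_space vector_space_fun_scale)
  have wedge_add: "wedge_1_3 (\<alpha> + \<beta>) J X Y Z W = wedge_1_3 \<alpha> J X Y Z W + wedge_1_3 \<beta> J X Y Z W"
    for \<alpha> \<beta> :: "complex vec \<Rightarrow> complex" and J X Y Z W
    by (simp add: wedge_1_3_def algebra_simps)
  have wedge_scale: "wedge_1_3 (fun_scale c \<alpha>) J X Y Z W = c * wedge_1_3 \<alpha> J X Y Z W"
    for \<alpha> :: "complex vec \<Rightarrow> complex" and J X Y Z W c
    by (simp add: wedge_1_3_def fun_scale_def algebra_simps)
  have wedge_zero: "wedge_1_3 0 J X Y Z W = 0" for J and X Y Z W :: "complex vec"
    by (simp add: wedge_1_3_def)
  have annI: "\<alpha> \<in> wedge_annihilator m br"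
    if "\<alpha> \<in> dual_space m"
      and "\<And>X Y Z W. X \<in> carrier_vec m \<Longrightarrow> Y \<in> carrier_vec m \<Longrightarrow> Z \<in> carrier_vec m \<Longrightarrow>
        W \<in> carrier_vec m \<Longrightarrow> wedge_1_3 \<alpha> (assoc_form m br) X Y Z W = 0" for \<alpha>
    unfolding wedge_annihilator_def using that by blast
  have annD: "wedge_1_3 \<alpha> (assoc_form m br) X Y Z W = 0"
    if "\<alpha> \<in> wedge_annihilator m br" "X \<in> carrier_vec m" "Y \<in> carrier_vec m"
      "Z \<in> carrier_vec m" "W \<in> carrier_vec m" for \<alpha> X Y Z W
    using that unfolding wedge_annihilator_def by blast
  have ann_dual: "\<alpha> \<in> dual_space m" if "\<alpha> \<in> wedge_annihilator m br" for \<alpha>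
    using that unfolding wedge_annihilator_def by blast
  have dual_zero: "0 \<in> dual_space m" by (simp add: dual_space_def)
  have dual_add: "\<alpha> + \<beta> \<in> dual_space m" if "\<alpha> \<in> dual_space m" "\<beta> \<in> dual_space m" for \<alpha> \<beta>
    using that unfolding dual_space_def by (auto simp: add_ac distrib_left)
  have dual_scale: "fun_scale c \<alpha> \<in> dual_space m" if "\<alpha> \<in> dual_space m" for c \<alpha>
    using that unfolding dual_space_def
    by (auto simp: fun_scale_def distrib_left mult.left_commute)
  show ?thesis
  proof (rule Modules.module.subspaceI[OF module_fun_scale])
    show "0 \<in> wedge_annihilator m br"
      by (rule annI) (rule dual_zero, rule wedge_zero)
    show "\<alpha> + \<beta> \<in> wedge_annihilator m br"
      if "\<alpha> \<in> wedge_annihilator m br" "\<beta> \<in> wedge_annihilator m br" for \<alpha> \<beta>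
      by (rule annI) (use that in \<open>simp_all only: ann_dual dual_add wedge_add annD add_0_left\<close>)
    show "fun_scale c \<alpha> \<in> wedge_annihilator m br" if "\<alpha> \<in> wedge_annihilator m br" for c \<alpha>
      by (rule annI) (use that in \<open>simp_all only: ann_dual dual_scale wedge_scale annD mult_zero_right\<close>)
  qed
qed


section \<open>Isomorphisms\<close>

definition lie_hom_mat :: "nat \<Rightarrow> bracket \<Rightarrow> bracket \<Rightarrow> complex mat \<Rightarrow> bool" where
  "lie_hom_mat m br br' A \<longleftrightarrow> A \<in> carrier_mat m m \<and>
     (\<forall>X\<in>carrier_vec m. \<forall>Y\<in>carrier_vec m. A *\<^sub>v br X Y = br' (A *\<^sub>v X) (A *\<^sub>v Y))"

definition isomorphic :: "nat \<Rightarrow> bracket \<Rightarrow> bracket \<Rightarrow> bool" where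
  "isomorphic m br br' \<longleftrightarrow> (\<exists>A. invertible_mat A \<and> lie_hom_mat m br br' A)"

definition i_isomorphic :: "nat \<Rightarrow> bracket \<Rightarrow> bracket \<Rightarrow> bool" where
  "i_isomorphic m br br' \<longleftrightarrow> (\<exists>A\<in>orth_group m. lie_hom_mat m br br' A)"

definition iso_class :: "nat \<Rightarrow> bracket \<Rightarrow> bracket set" where
  "iso_class m br = {br' \<in> nilpotent_singular m. isomorphic m br br'}"

definition i_iso_class :: "nat \<Rightarrow> bracket \<Rightarrow> bracket set" where
  "i_iso_class m br = {br' \<in> nilpotent_singular m. i_isomorphic m br br'}"

definition iso_classes :: "nat \<Rightarrow> bracket set set" where
  "iso_classes m = iso_class m ` nilpotent_singular m"

definition i_iso_classes :: "nat \<Rightarrow> bracket set set" where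
  "i_iso_classes m = i_iso_class m ` nilpotent_singular m"


section \<open>Double extensions\<close>

text \<open>The triple \<open>(l, \<mu>, X)\<close> stands for \<open>X + l X\<^sub>1 + \<mu> Y\<^sub>1\<close>.\<close>

type_synonym dext_vec = "complex \<times> complex \<times> complex vec"

definition dext_carrier :: "nat \<Rightarrow> dext_vec set" where
  "dext_carrier n = UNIV \<times> UNIV \<times> carrier_vec n"

fun dext_add :: "dext_vec \<Rightarrow> dext_vec \<Rightarrow> dext_vec" where
  "dext_add (l, \<mu>, X) (l', \<mu>', Y) = (l + l', \<mu> + \<mu>', X + Y)"

fun dext_scale :: "complex \<Rightarrow> dext_vec \<Rightarrow> dext_vec" where
  "dext_scale c (l, \<mu>, X) = (c * l, c * \<mu>, c \<cdot>\<^sub>v X)"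

fun dext_form :: "nat \<Rightarrow> dext_vec \<Rightarrow> dext_vec \<Rightarrow> complex" where
  "dext_form n (l, \<mu>, X) (l', \<mu>', Y) = l * \<mu>' + \<mu> * l' + canon_form n X Y"

fun dext_bracket :: "nat \<Rightarrow> complex mat \<Rightarrow> dext_vec \<Rightarrow> dext_vec \<Rightarrow> dext_vec" where
  "dext_bracket n C (l, \<mu>, X) (l', \<mu>', Y) =
     (canon_form n (C *\<^sub>v X) Y, 0, \<mu> \<cdot>\<^sub>v (C *\<^sub>v Y) - \<mu>' \<cdot>\<^sub>v (C *\<^sub>v X))"

definition dext_isometry :: "nat \<Rightarrow> (dext_vec \<Rightarrow> complex vec) \<Rightarrow> bool" where
  "dext_isometry n \<phi> \<longleftrightarrow> bij_betw \<phi> (dext_carrier n) (carrier_vec (n + 2)) \<and>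
     (\<forall>u\<in>dext_carrier n. \<forall>v\<in>dext_carrier n.
        \<phi> (dext_add u v) = \<phi> u + \<phi> v \<and>
        canon_form (n + 2) (\<phi> u) (\<phi> v) = dext_form n u v) \<and>
     (\<forall>c. \<forall>u\<in>dext_carrier n. \<phi> (dext_scale c u) = c \<cdot>\<^sub>v \<phi> u)"

text \<open>The bracket of the double extension, transported to \<open>\<complex>\<^sup>n\<^sup>+\<^sup>2\<close> along the isometry \<open>\<phi>\<close>.\<close>

definition double_extension ::
  "nat \<Rightarrow> (dext_vec \<Rightarrow> complex vec) \<Rightarrow> complex mat \<Rightarrow> bracket" where
  "double_extension n \<phi> C = (\<lambda>u\<in>carrier_vec (n + 2). \<lambda>v\<in>carrier_vec (n + 2).
     \<phi> (dext_bracket n C (inv_into (dext_carrier n) \<phi> u) (inv_into (dext_carrier n) \<phi> v)))"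

text \<open>Quantification over all isometries is not vacuous.\<close>

lemma dext_isometry_exists: "\<exists>\<phi>. dext_isometry n \<phi>"
proof
  define \<phi> :: "dext_vec \<Rightarrow> complex vec" where
    "\<phi> = (\<lambda>(l, \<mu>, X). vec (n + 2) (\<lambda>i. if i = 0 then l else if i = 1 then \<mu> else X $ (i - 2)))"
  define \<psi> :: "complex vec \<Rightarrow> dext_vec" where
    "\<psi> = (\<lambda>v. (v $ 0, v $ 1, vec n (\<lambda>i. v $ (i + 2))))"
  have bij: "bij_betw \<phi> (dext_carrier n) (carrier_vec (n + 2))"
  proof (rule bij_betwI[where g = \<psi>])
    show "\<phi> \<in> dext_carrier n \<rightarrow> carrier_vec (n + 2)"
      by (rule Pi_I) (simp add: \<phi>_def split: prod.split)
    show "\<psi> \<in> carrier_vec (n + 2) \<rightarrow> dext_carrier n"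
      by (rule Pi_I) (simp add: \<psi>_def dext_carrier_def)
    show "\<psi> (\<phi> u) = u" if "u \<in> dext_carrier n" for u
    proof -
      obtain l \<mu> X where u: "u = (l, \<mu>, X)" by (cases u)
      have "vec n (\<lambda>i. X $ i) = X"
        using that unfolding u dext_carrier_def by (intro eq_vecI) auto
      moreover have "vec n (\<lambda>i. \<phi> u $ (i + 2)) = vec n (\<lambda>i. X $ i)"
        by (rule eq_vecI) (simp_all add: \<phi>_def u)
      ultimately show ?thesis by (simp add: \<psi>_def \<phi>_def u)
    qed
    show "\<phi> (\<psi> v) = v" if "v \<in> carrier_vec (n + 2)" for v
    proof (rule eq_vecI)
      show "dim_vec (\<phi> (\<psi> v)) = dim_vec v" using that by (simp add: \<phi>_def \<psi>_def)
      fix i assume "i < dim_vec v"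
      then have "i < n + 2" using that by simp
      moreover have "i = (i - 2) + 2" if "i \<noteq> 0" "i \<noteq> 1" using that by simp
      ultimately show "\<phi> (\<psi> v) $ i = v $ i"
        by (auto simp: \<phi>_def \<psi>_def)
    qed
  qed
  have add: "\<phi> (dext_add u v) = \<phi> u + \<phi> v"
    if "u \<in> dext_carrier n" "v \<in> dext_carrier n" for u v
  proof -
    obtain l \<mu> X l' \<mu>' Y where "u = (l, \<mu>, X)" "v = (l', \<mu>', Y)" by (cases u; cases v)
    with that show ?thesis
      by (intro eq_vecI) (auto simp: \<phi>_def dext_carrier_def)
  qed
  have scale: "\<phi> (dext_scale c u) = c \<cdot>\<^sub>v \<phi> u" if "u \<in> dext_carrier n" for c u
  proof -
    obtain l \<mu> X where "u = (l, \<mu>, X)" by (cases u)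
    with that show ?thesis
      by (intro eq_vecI) (auto simp: \<phi>_def dext_carrier_def)
  qed
  have isom: "canon_form (n + 2) (\<phi> u) (\<phi> v) = dext_form n u v"
    if "u \<in> dext_carrier n" "v \<in> dext_carrier n" for u v
  proof -
    obtain l \<mu> X l' \<mu>' Y where uv: "u = (l, \<mu>, X)" "v = (l', \<mu>', Y)" by (cases u; cases v)
    have 0: "\<phi> u $ 0 = l" "\<phi> u $ 1 = \<mu>" "\<phi> v $ 0 = l'" "\<phi> v $ 1 = \<mu>'"
      by (simp_all add: \<phi>_def uv)
    have 1: "\<phi> u $ (j + 2) = X $ j" "\<phi> v $ (j + 2) = Y $ j" if "j < n" for j
      using that by (simp_all add: \<phi>_def uv)
    have "(\<Sum>i<(n + 2) div 2. \<phi> u $ (2*i) * \<phi> v $ (2*i+1) + \<phi> u $ (2*i+1) * \<phi> v $ (2*i))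
        = l * \<mu>' + \<mu> * l'
          + (\<Sum>i<n div 2. \<phi> u $ (2*i+2) * \<phi> v $ ((2*i+1)+2) + \<phi> u $ ((2*i+1)+2) * \<phi> v $ (2*i+2))"
      using 0 by (simp add: sum.lessThan_Suc_shift del: sum.lessThan_Suc)
    also have "(\<Sum>i<n div 2. \<phi> u $ (2*i+2) * \<phi> v $ ((2*i+1)+2) + \<phi> u $ ((2*i+1)+2) * \<phi> v $ (2*i+2))
        = (\<Sum>i<n div 2. X $ (2*i) * Y $ (2*i+1) + X $ (2*i+1) * Y $ (2*i))"
    proof (rule sum.cong[OF refl])
      fix i assume "i \<in> {..<n div 2}"
      then have "2*i < n" "2*i+1 < n" by auto
      then show "\<phi> u $ (2*i+2) * \<phi> v $ ((2*i+1)+2) + \<phi> u $ ((2*i+1)+2) * \<phi> v $ (2*i+2)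
          = X $ (2*i) * Y $ (2*i+1) + X $ (2*i+1) * Y $ (2*i)"
        by (simp only: 1)
    qed
    finally have sum: "(\<Sum>i<(n + 2) div 2. \<phi> u $ (2*i) * \<phi> v $ (2*i+1) + \<phi> u $ (2*i+1) * \<phi> v $ (2*i))
        = l * \<mu>' + \<mu> * l' + (\<Sum>i<n div 2. X $ (2*i) * Y $ (2*i+1) + X $ (2*i+1) * Y $ (2*i))" .
    have last: "\<phi> u $ (n + 2 - 1) = X $ (n - 1)" "\<phi> v $ (n + 2 - 1) = Y $ (n - 1)" if "odd n"
    proof -
      have "0 < n" using that by (rule odd_pos)
      then have "n - 1 < n" "n + 2 - 1 = (n - 1) + 2" by auto
      then show "\<phi> u $ (n + 2 - 1) = X $ (n - 1)" "\<phi> v $ (n + 2 - 1) = Y $ (n - 1)"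
        by (simp_all only: 1)
    qed
    have "dext_form n u v = l * \<mu>' + \<mu> * l' + canon_form n X Y"
      by (simp add: uv)
    moreover have "canon_form (n + 2) (\<phi> u) (\<phi> v) = l * \<mu>' + \<mu> * l' + canon_form n X Y"
      unfolding canon_form_def sum by (cases "odd n") (simp_all add: last[simplified])
    ultimately show ?thesis by simp
  qed
  from bij add scale isom show "dext_isometry n \<phi>"
    unfolding dext_isometry_def by blast
qed

end

theory Submission
  imports Defs "Jordan_Normal_Form.Jordan_Normal_Form_Existence"
begin

text \<open>
  Write \<open>B\<close> for the canonical form and let \<open>x \<noteq> 0\<close> be a vector whose dual form satisfies
  \<open>B(x, -) \<and> I = 0\<close>. For any \<open>y\<close> with \<open>B(x, y) = 1\<close>, inserting \<open>y\<close> into this identity determines the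
  whole bracket from the single skew map \<open>D = ad y\<close> (\<open>wedge_bracket_formula\<close>):

    \<open>[X, Y] = B(x, X) D Y - B(x, Y) D X + B(D X, Y) x\<close>.

  If \<open>x\<close> and \<open>y\<close> are a hyperbolic pair killed by \<open>D\<close>, this is the bracket of the double extension of
  the orthogonal complement of the pair by the restriction of \<open>D\<close>. Nilpotency makes such a choice
  possible. If \<open>x\<close> is anisotropic, the Jacobi identity forces \<open>\<omega> \<and> \<omega> = 0\<close> for \<open>\<omega>(X, Y) = B(D X, Y)\<close>, so
  that \<open>x\<close> can be replaced by a suitable isotropic vector in the image of \<open>D\<close>
  (\<open>isotropic_annihilator_vector\<close>). If \<open>x\<close> is isotropic, it is an eigenvector of every element
  orthogonal to it; nilpotency makes the eigenvalues vanish, and then \<open>x\<close> is central. So each nilpotent singular structure is a double extension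
  (\<open>nilpotent_singular_is_double_extension\<close>).

  Conversely, the orbit of \<open>C\<close> can be read off from the Lie algebra structure alone
  (\<open>isomorphic_double_extensions_same_orbit\<close>). An element \<open>Z\<close> with \<open>Y\<^sub>1\<close>-coordinate \<open>\<mu> \<noteq> 0\<close> acts on
  \<open>\<complex>\<^sup>n\<^sup>+\<^sup>2\<close> like \<open>\<mu> (C \<oplus> 0)\<close>, up to conjugation in \<open>GL(n + 2)\<close>. Given an isomorphism between the double
  extensions by \<open>C\<close> and \<open>C'\<close>, some \<open>Z\<close> has a non-zero \<open>Y\<^sub>1\<close>-coordinate both before and after it, and
  so \<open>C \<oplus> 0\<close> is similar to \<open>\<mu> C' \<oplus> 0\<close> for some \<open>\<mu> \<noteq> 0\<close>. Three facts lead from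
  there to \<open>C\<close> and \<open>C'\<close> themselves:

  \<^item> Similar elements of \<open>o(n + 2)\<close> are conjugate under \<open>O(n + 2)\<close>, because an
    invertible matrix has a square root that is a polynomial in it (\<open>similar_imp_orth_conjugate\<close>).
  \<^item> The summand \<open>0\<close> cancels, because reflections in vectors of the kernel of a skew map commute with
    that map and suffice to move one hyperbolic pair in the kernel to another
    (\<open>same_orbit_if_extensions_conjugate\<close>).
  \<^item> \<open>\<mu> C'\<close> and \<open>C'\<close> have the same orbit, by the first fact and the Jordan normal form
    (\<open>adjoint_orbit_smult\<close>).

  Thus isomorphism, i-isomorphism and equality of orbits coincide, and there are finitely many orbits
  because there are finitely many nilpotent Jordan matrices of a given size.
\<close>

section \<open>The canonical form and its adjoints\<close>

text \<open>The form pairs the basis vector with index \<open>i\<close> with the one whose index is \<open>form_partner n i\<close>. It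
  turns the sum over the pairs \<open>E\<^sub>i, F\<^sub>i\<close> and the exceptional vector \<open>G\<close> into one sum over all indices.\<close>

definition form_partner :: "nat \<Rightarrow> nat \<Rightarrow> nat" where
  "form_partner n i = (if odd i then i - 1 else if i + 1 < n then i + 1 else i)"

lemma form_partner_less: "i < n \<Longrightarrow> form_partner n i < n"
  by (auto simp: form_partner_def)

lemma form_partner_involution: "i < n \<Longrightarrow> form_partner n (form_partner n i) = i"
  by (auto simp: form_partner_def)

lemma canon_form_partner: "canon_form n X Y = (\<Sum>i<n. X $ i * Y $ form_partner n i)"
proof -
  have pairs: "(\<Sum>i<p. X $ (2*i) * Y $ (2*i+1) + X $ (2*i+1) * Y $ (2*i))
      = (\<Sum>i<2*p. X $ i * Y $ form_partner n i)" if "2 * p \<le> n" for p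
    using that by (induction p) (simp_all add: form_partner_def)
  show ?thesis
  proof (cases "odd n")
    case True
    then have n: "n = Suc (2 * (n div 2))" by simp
    have "(\<Sum>i<n. X $ i * Y $ form_partner n i)
        = (\<Sum>i<2 * (n div 2). X $ i * Y $ form_partner n i) + X $ (n - 1) * Y $ form_partner n (n - 1)"
      using n by (metis (no_types, lifting) diff_Suc_1 sum.lessThan_Suc)
    moreover have "form_partner n (n - 1) = n - 1" using True by (auto simp: form_partner_def)
    ultimately show ?thesis
      using True pairs[of "n div 2"] unfolding canon_form_def by simp
  next
    case False
    then have n: "2 * (n div 2) = n" by simp
    show ?thesis using False pairs[of "n div 2"] unfolding canon_form_def n by simp
  qed
qed

lemma canon_form_sym: "canon_form n X Y = canon_form n Y X"
proof -
  have "(\<Sum>i<n div 2. X $ (2*i) * Y $ (2*i+1) + X $ (2*i+1) * Y $ (2*i))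
      = (\<Sum>i<n div 2. Y $ (2*i) * X $ (2*i+1) + Y $ (2*i+1) * X $ (2*i))"
    by (rule sum.cong[OF refl]) (simp only: mult.commute add.commute)
  then show ?thesis unfolding canon_form_def by (simp only: mult.commute)
qed

lemma canon_form_add_left:
  assumes "X \<in> carrier_vec n" "Y \<in> carrier_vec n" "Z \<in> carrier_vec n"
  shows "canon_form n (X + Y) Z = canon_form n X Z + canon_form n Y Z"
  using assms by (simp add: canon_form_partner distrib_right)

lemma canon_form_smult_left:
  assumes "X \<in> carrier_vec n"
  shows "canon_form n (c \<cdot>\<^sub>v X) Y = c * canon_form n X Y"
  using assms by (simp add: canon_form_partner sum_distrib_left mult.assoc)

lemma canon_form_add_right:
  assumes "X \<in> carrier_vec n" "Y \<in> carrier_vec n" "Z \<in> carrier_vec n"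
  shows "canon_form n Z (X + Y) = canon_form n Z X + canon_form n Z Y"
  using canon_form_add_left[OF assms] by (simp add: canon_form_sym)

lemma canon_form_smult_right:
  assumes "X \<in> carrier_vec n"
  shows "canon_form n Y (c \<cdot>\<^sub>v X) = c * canon_form n Y X"
  using canon_form_smult_left[OF assms] by (simp add: canon_form_sym)

lemma canon_form_diff_left:
  assumes "X \<in> carrier_vec n" "Y \<in> carrier_vec n" "Z \<in> carrier_vec n"
  shows "canon_form n (X - Y) Z = canon_form n X Z - canon_form n Y Z"
  using assms by (simp add: canon_form_partner left_diff_distrib sum_subtractf)

lemma canon_form_diff_right:
  assumes "X \<in> carrier_vec n" "Y \<in> carrier_vec n" "Z \<in> carrier_vec n"
  shows "canon_form n Z (X - Y) = canon_form n Z X - canon_form n Z Y"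
  using canon_form_diff_left[OF assms] by (simp add: canon_form_sym)

lemma canon_form_zero_left [simp]: "Y \<in> carrier_vec n \<Longrightarrow> canon_form n (0\<^sub>v n) Y = 0"
  by (simp add: canon_form_partner)

lemma canon_form_zero_right [simp]: "Y \<in> carrier_vec n \<Longrightarrow> canon_form n Y (0\<^sub>v n) = 0"
  by (simp add: canon_form_partner form_partner_less)

lemmas canon_form_bilinear =
  canon_form_add_left canon_form_add_right canon_form_smult_left canon_form_smult_right
  canon_form_diff_left canon_form_diff_right

lemma canon_form_unit:
  assumes "j < n"
  shows "canon_form n X (unit_vec n (form_partner n j)) = X $ j"
proof -
  have "canon_form n X (unit_vec n (form_partner n j)) = (\<Sum>i<n. if i = j then X $ i else 0)"
    unfolding canon_form_partner
  proof (rule sum.cong[OF refl])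
    fix i assume "i \<in> {..<n}"
    then show "X $ i * unit_vec n (form_partner n j) $ form_partner n i = (if i = j then X $ i else 0)"
      using assms form_partner_less form_partner_involution by (metis index_unit_vec(1) lessThan_iff mult.right_neutral mult_zero_right)
  qed
  then show ?thesis using assms by simp
qed

lemma canon_form_eqI:
  assumes "X \<in> carrier_vec n" "Y \<in> carrier_vec n"
    and "\<And>Z. Z \<in> carrier_vec n \<Longrightarrow> canon_form n X Z = canon_form n Y Z"
  shows "X = Y"
proof (rule eq_vecI)
  show "dim_vec X = dim_vec Y" using assms by simp
  fix j assume "j < dim_vec Y"
  then show "X $ j = Y $ j"
    using assms canon_form_unit by (metis carrier_vecD unit_vec_carrier)
qed

lemma canon_form_nondegenerate:
  assumes "X \<in> carrier_vec n" "X \<noteq> 0\<^sub>v n"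
  obtains Z where "Z \<in> carrier_vec n" "canon_form n X Z \<noteq> 0"
  using canon_form_eqI[of X n "0\<^sub>v n"] assms by auto

lemma mat_eq_if_same_action:
  fixes A B :: "'a :: semiring_1 mat"
  assumes "A \<in> carrier_mat k n" "B \<in> carrier_mat k n"
    and "\<And>v. v \<in> carrier_vec n \<Longrightarrow> A *\<^sub>v v = B *\<^sub>v v"
  shows "A = B"
proof (rule eq_matI)
  show "dim_row A = dim_row B" "dim_col A = dim_col B" using assms by auto
  fix i j assume ij: "i < dim_row B" "j < dim_col B"
  have "(A *\<^sub>v unit_vec n j) $ i = (B *\<^sub>v unit_vec n j) $ i" using assms(3) by simp
  then show "A $$ (i, j) = B $$ (i, j)" using assms(1,2) ij by simp
qed

lemma linear_map_mat:
  fixes f :: "'a :: field vec \<Rightarrow> 'a vec"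
  assumes closed: "\<And>v. v \<in> carrier_vec n \<Longrightarrow> f v \<in> carrier_vec k"
    and add: "\<And>v w. v \<in> carrier_vec n \<Longrightarrow> w \<in> carrier_vec n \<Longrightarrow> f (v + w) = f v + f w"
    and scale: "\<And>c v. v \<in> carrier_vec n \<Longrightarrow> f (c \<cdot>\<^sub>v v) = c \<cdot>\<^sub>v f v"
  obtains A where "A \<in> carrier_mat k n" "\<And>v. v \<in> carrier_vec n \<Longrightarrow> A *\<^sub>v v = f v"
proof
  let ?A = "mat k n (\<lambda>(i, j). f (unit_vec n j) $ i)"
  show "?A \<in> carrier_mat k n" by simp
  fix v :: "'a vec" assume v: "v \<in> carrier_vec n"
  \<comment> \<open>truncating \<open>v\<close> to its first \<open>p\<close> entries allows induction on \<open>p\<close>\<close>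
  let ?t = "\<lambda>p. vec n (\<lambda>i. if i < p then v $ i else 0)"
  have "f (?t p) $ i = (\<Sum>j<p. f (unit_vec n j) $ i * v $ j)" if i: "i < k" and "p \<le> n" for i p
    using \<open>p \<le> n\<close>
  proof (induction p)
    case 0
    have "f (0 \<cdot>\<^sub>v 0\<^sub>v n) = 0 \<cdot>\<^sub>v f (0\<^sub>v n)" by (rule scale) simp
    moreover have "?t 0 = 0 \<cdot>\<^sub>v 0\<^sub>v n" by (rule eq_vecI) auto
    ultimately show ?case using closed[of "0\<^sub>v n"] i by simp
  next
    case (Suc p)
    have "?t (Suc p) = ?t p + v $ p \<cdot>\<^sub>v unit_vec n p"
      by (rule eq_vecI) (use Suc.prems in \<open>auto simp: unit_vec_def less_Suc_eq\<close>)
    then have "f (?t (Suc p)) = f (?t p) + v $ p \<cdot>\<^sub>v f (unit_vec n p)"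
      by (simp add: add scale)
    then show ?case using Suc i closed[of "unit_vec n p"] by simp
  qed
  from this[OF _ le_refl] have "f (?t n) $ i = (\<Sum>j<n. f (unit_vec n j) $ i * v $ j)" if "i < k" for i
    using that by blast
  moreover have "?t n = v" using v by (intro eq_vecI) auto
  ultimately show "?A *\<^sub>v v = f v"
    using v closed[OF v] by (intro eq_vecI) (auto simp: scalar_prod_def atLeast0LessThan)
qed

lemma linear_form_repr:
  assumes "\<And>v w. v \<in> carrier_vec n \<Longrightarrow> w \<in> carrier_vec n \<Longrightarrow> \<alpha> (v + w) = \<alpha> v + \<alpha> w"
    and "\<And>c v. v \<in> carrier_vec n \<Longrightarrow> \<alpha> (c \<cdot>\<^sub>v v) = c * \<alpha> v"
  obtains x where "x \<in> carrier_vec n" "\<And>v. v \<in> carrier_vec n \<Longrightarrow> \<alpha> v = canon_form n x v"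
proof -
  obtain A where A: "A \<in> carrier_mat 1 n"
    "\<And>v. v \<in> carrier_vec n \<Longrightarrow> A *\<^sub>v v = vec 1 (\<lambda>_. \<alpha> v)"
    by (rule linear_map_mat[of n "\<lambda>v. vec 1 (\<lambda>_. \<alpha> v)" 1])
      (use assms in \<open>auto intro!: eq_vecI\<close>)
  define x where "x = vec n (\<lambda>i. A $$ (0, form_partner n i))"
  have "\<alpha> v = canon_form n x v" if v: "v \<in> carrier_vec n" for v
  proof -
    have "(A *\<^sub>v v) $ 0 = \<alpha> v" using A(2)[OF v] by simp
    then have "\<alpha> v = (\<Sum>i<n. A $$ (0, i) * v $ i)"
      using A(1) v by (simp add: scalar_prod_def atLeast0LessThan)
    also have "\<dots> = canon_form n v x"
      by (simp add: canon_form_partner x_def form_partner_less form_partner_involution mult.commute)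
    finally show ?thesis by (simp add: canon_form_sym)
  qed
  then show thesis using that[of x] by (simp add: x_def)
qed

lemma adjoint_exists:
  assumes A: "A \<in> carrier_mat n n"
  obtains A' where "A' \<in> carrier_mat n n"
    "\<And>v w. v \<in> carrier_vec n \<Longrightarrow> w \<in> carrier_vec n \<Longrightarrow>
      canon_form n (A *\<^sub>v v) w = canon_form n v (A' *\<^sub>v w)"
proof -
  have Av: "A *\<^sub>v v \<in> carrier_vec n" if "v \<in> carrier_vec n" for v using A that by simp
  have "\<exists>x. x \<in> carrier_vec n \<and> (\<forall>v. v \<in> carrier_vec n \<longrightarrow> canon_form n (A *\<^sub>v v) w = canon_form n x v)"
    if w: "w \<in> carrier_vec n" for w
  proof -
    obtain x where "x \<in> carrier_vec n" "\<And>v. v \<in> carrier_vec n \<Longrightarrow> canon_form n (A *\<^sub>v v) w = canon_form n x v"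
    proof (rule linear_form_repr[of n "\<lambda>v. canon_form n (A *\<^sub>v v) w"])
      show "canon_form n (A *\<^sub>v (v + v')) w = canon_form n (A *\<^sub>v v) w + canon_form n (A *\<^sub>v v') w"
        if "v \<in> carrier_vec n" "v' \<in> carrier_vec n" for v v'
        using that w A Av by (simp add: mult_add_distrib_mat_vec canon_form_add_left)
      show "canon_form n (A *\<^sub>v (c \<cdot>\<^sub>v v)) w = c * canon_form n (A *\<^sub>v v) w" if "v \<in> carrier_vec n" for c v
        using that A Av by (simp add: mult_mat_vec canon_form_smult_left)
    qed blast
    then show ?thesis by blast
  qed
  then obtain f where f: "\<And>w. w \<in> carrier_vec n \<Longrightarrow> f w \<in> carrier_vec n"
    "\<And>v w. w \<in> carrier_vec n \<Longrightarrow> v \<in> carrier_vec n \<Longrightarrow>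
      canon_form n (A *\<^sub>v v) w = canon_form n (f w) v"
    by metis
  obtain A' where A': "A' \<in> carrier_mat n n" "\<And>w. w \<in> carrier_vec n \<Longrightarrow> A' *\<^sub>v w = f w"
  proof (rule linear_map_mat[of n f n])
    show "f (v + w) = f v + f w" if "v \<in> carrier_vec n" "w \<in> carrier_vec n" for v w
      by (rule canon_form_eqI[of _ n])
        (use that in \<open>simp_all add: f(1) canon_form_bilinear Av f(2)[symmetric]\<close>)
    show "f (c \<cdot>\<^sub>v v) = c \<cdot>\<^sub>v f v" if "v \<in> carrier_vec n" for c v
      by (rule canon_form_eqI[of _ n])
        (use that in \<open>simp_all add: f(1) canon_form_bilinear Av f(2)[symmetric]\<close>)
  qed (use f in auto)
  show thesis by (rule that[OF A'(1)]) (metis A'(2) f(2) canon_form_sym)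
qed

lemma inverse_mat_exists:
  fixes A :: "'a :: field mat"
  assumes "A \<in> carrier_mat n n" "invertible_mat A"
  obtains B where "B \<in> carrier_mat n n" "A * B = 1\<^sub>m n" "B * A = 1\<^sub>m n"
    "\<And>v. v \<in> carrier_vec n \<Longrightarrow> A *\<^sub>v (B *\<^sub>v v) = v" "\<And>v. v \<in> carrier_vec n \<Longrightarrow> B *\<^sub>v (A *\<^sub>v v) = v"
proof -
  obtain B where B: "A * B = 1\<^sub>m n" "B * A = 1\<^sub>m (dim_row B)"
    using assms unfolding invertible_mat_def inverts_mat_def by auto
  have "dim_col B = n" using arg_cong[OF B(1), of dim_col] by simp
  moreover have "dim_row B = n" using arg_cong[OF B(2), of dim_col] assms by simp
  ultimately have "B \<in> carrier_mat n n" by auto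
  with that[OF this] B assms show thesis
    by (metis assoc_mult_mat_vec carrier_matD(1) one_mult_mat_vec)
qed

lemma invertible_matI:
  fixes A :: "'a :: field mat"
  assumes "A \<in> carrier_mat n n" "B \<in> carrier_mat n n"
    and "\<And>v. v \<in> carrier_vec n \<Longrightarrow> B *\<^sub>v (A *\<^sub>v v) = v"
  shows "invertible_mat A"
proof -
  have "B * A = 1\<^sub>m n" by (rule mat_eq_if_same_action[of _ n n]) (use assms in auto)
  moreover from this have "A * B = 1\<^sub>m n"
    using mat_mult_left_right_inverse[OF assms(2,1)] by blast
  ultimately show ?thesis
    using assms unfolding invertible_mat_def inverts_mat_def by (intro conjI exI[of _ B]) auto
qed

text \<open>Non-degeneracy makes the adjoint of an isometry a left inverse of it, so that the invertibility
  required of an element of the orthogonal group is automatic.\<close>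

lemma isometry_in_orth_group:
  assumes U: "U \<in> carrier_mat n n"
    and iso: "\<And>v w. v \<in> carrier_vec n \<Longrightarrow> w \<in> carrier_vec n \<Longrightarrow>
      canon_form n (U *\<^sub>v v) (U *\<^sub>v w) = canon_form n v w"
  shows "U \<in> orth_group n"
proof -
  obtain U' where U': "U' \<in> carrier_mat n n" "\<And>v w. v \<in> carrier_vec n \<Longrightarrow> w \<in> carrier_vec n \<Longrightarrow>
      canon_form n (U *\<^sub>v v) w = canon_form n v (U' *\<^sub>v w)"
    by (rule adjoint_exists[OF U]) blast
  have "U' *\<^sub>v (U *\<^sub>v w) = w" if w: "w \<in> carrier_vec n" for w
  proof (rule canon_form_eqI[of _ n])
    fix v :: "complex vec" assume v: "v \<in> carrier_vec n"
    have "canon_form n v (U' *\<^sub>v (U *\<^sub>v w)) = canon_form n v w"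
      using U'(2)[of v "U *\<^sub>v w"] iso[OF v w] U v w by simp
    then show "canon_form n (U' *\<^sub>v (U *\<^sub>v w)) v = canon_form n w v"
      by (simp add: canon_form_sym)
  qed (use U U' w in auto)
  then have "invertible_mat U" by (rule invertible_matI[OF U U'(1)])
  then show ?thesis unfolding orth_group_def using U iso by blast
qed

lemma orth_groupD:
  assumes "U \<in> orth_group n"
  shows "U \<in> carrier_mat n n" "invertible_mat U"
    "\<And>v w. v \<in> carrier_vec n \<Longrightarrow> w \<in> carrier_vec n \<Longrightarrow>
      canon_form n (U *\<^sub>v v) (U *\<^sub>v w) = canon_form n v w"
  using assms unfolding orth_group_def by auto

lemma orth_group_mult:
  assumes "U \<in> orth_group n" "V \<in> orth_group n"
  shows "U * V \<in> orth_group n"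
  by (rule isometry_in_orth_group) (use assms[THEN orth_groupD(1)] assms[THEN orth_groupD(3)] in auto)

lemma orth_group_one: "1\<^sub>m n \<in> orth_group n"
  by (rule isometry_in_orth_group) auto

lemma orth_algebraD:
  assumes "C \<in> orth_algebra n"
  shows "C \<in> carrier_mat n n"
    "\<And>v w. v \<in> carrier_vec n \<Longrightarrow> w \<in> carrier_vec n \<Longrightarrow>
      canon_form n (C *\<^sub>v v) w = - canon_form n v (C *\<^sub>v w)"
  using assms unfolding orth_algebra_def by auto

section \<open>Square roots of matrices\<close>

lemma mult_mat_zero_vec:
  fixes A :: "'a :: semiring_0 mat"
  shows "A \<in> carrier_mat k n \<Longrightarrow> A *\<^sub>v 0\<^sub>v n = 0\<^sub>v k"
  by (intro eq_vecI) auto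

text \<open>Horner's scheme matches the induction rule for polynomials. The laws below are stated for the
  action on vectors, where no sums and products of matrices of fixed dimension have to be handled.\<close>

definition mat_poly :: "'a :: comm_ring_1 poly \<Rightarrow> 'a mat \<Rightarrow> 'a mat" where
  "mat_poly p S = fold_coeffs (\<lambda>a M. a \<cdot>\<^sub>m 1\<^sub>m (dim_row S) + S * M) p (0\<^sub>m (dim_row S) (dim_row S))"

context
  fixes S :: "'a :: field mat" and n :: nat
  assumes S: "S \<in> carrier_mat n n"
begin

lemma mat_poly_0: "mat_poly 0 S = 0\<^sub>m n n"
  using S by (simp add: mat_poly_def)

lemma mat_poly_pCons: "mat_poly (pCons a p) S = a \<cdot>\<^sub>m 1\<^sub>m n + S * mat_poly p S"
proof (cases "p = 0 \<and> a = 0")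
  case True
  then show ?thesis using S by (simp add: mat_poly_0) (auto intro!: eq_matI)
next
  case False
  then show ?thesis using S by (auto simp: mat_poly_def)
qed

lemma mat_poly_carrier [simp]: "mat_poly p S \<in> carrier_mat n n"
  by (induction p) (use S in \<open>auto simp: mat_poly_0 mat_poly_pCons\<close>)

lemma mat_poly_act_carrier [simp]: "v \<in> carrier_vec n \<Longrightarrow> mat_poly p S *\<^sub>v v \<in> carrier_vec n"
  by (rule mult_mat_vec_carrier[OF mat_poly_carrier])

lemma mat_poly_act_0 [simp]: "v \<in> carrier_vec n \<Longrightarrow> mat_poly 0 S *\<^sub>v v = 0\<^sub>v n"
  by (simp add: mat_poly_0) (auto intro!: eq_vecI)

lemma mat_poly_act_pCons [simp]:
  assumes v: "v \<in> carrier_vec n"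
  shows "mat_poly (pCons a p) S *\<^sub>v v = a \<cdot>\<^sub>v v + S *\<^sub>v (mat_poly p S *\<^sub>v v)"
proof -
  have "a \<cdot>\<^sub>m 1\<^sub>m n *\<^sub>v v = a \<cdot>\<^sub>v v" using v by (intro eq_vecI) auto
  then show ?thesis
    using S v mat_poly_carrier[of p]
    by (simp add: mat_poly_pCons add_mult_distrib_mat_vec[of _ n n] assoc_mult_mat_vec[of _ n n _ n])
qed

lemma mat_poly_act_add:
  assumes v: "v \<in> carrier_vec n"
  shows "mat_poly (p + q) S *\<^sub>v v = mat_poly p S *\<^sub>v v + mat_poly q S *\<^sub>v v"
proof (induction p q rule: poly_induct2)
  case (pCons a p b q)
  then show ?case
    using S v by (simp add: mult_add_distrib_mat_vec[of _ n n] add_smult_distrib_vec)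
      (auto intro!: eq_vecI)
qed (use v in auto)

lemma mat_poly_act_smult:
  assumes v: "v \<in> carrier_vec n"
  shows "mat_poly (Polynomial.smult c p) S *\<^sub>v v = c \<cdot>\<^sub>v (mat_poly p S *\<^sub>v v)"
proof (induction p)
  case (pCons a p)
  then show ?case
    using S v by (simp add: mult_mat_vec[of _ n n] smult_add_distrib_vec[of _ n] smult_smult_assoc)
qed (use v in auto)

lemma mat_poly_act_commute:
  assumes v: "v \<in> carrier_vec n" and C: "C \<in> carrier_mat n n"
    and comm: "\<And>w. w \<in> carrier_vec n \<Longrightarrow> S *\<^sub>v (C *\<^sub>v w) = C *\<^sub>v (S *\<^sub>v w)"
  shows "mat_poly p S *\<^sub>v (C *\<^sub>v v) = C *\<^sub>v (mat_poly p S *\<^sub>v v)"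
proof (induction p)
  case 0
  then show ?case using v C by auto
next
  case (pCons a p)
  then show ?case
    using S v C by (simp add: mult_mat_vec[of _ n n] mult_add_distrib_mat_vec[of _ n n] comm)
qed

lemma mat_poly_act_mult:
  assumes v: "v \<in> carrier_vec n"
  shows "mat_poly (p * q) S *\<^sub>v v = mat_poly p S *\<^sub>v (mat_poly q S *\<^sub>v v)"
proof (induction p)
  case (pCons a p)
  have "pCons a p * q = Polynomial.smult a q + pCons 0 (p * q)" by simp
  then have "mat_poly (pCons a p * q) S *\<^sub>v v
      = a \<cdot>\<^sub>v (mat_poly q S *\<^sub>v v) + (0 \<cdot>\<^sub>v v + S *\<^sub>v (mat_poly (p * q) S *\<^sub>v v))"
    using v by (simp only: mat_poly_act_add mat_poly_act_smult mat_poly_act_pCons)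
  moreover have "0 \<cdot>\<^sub>v v + S *\<^sub>v (mat_poly (p * q) S *\<^sub>v v) = S *\<^sub>v (mat_poly (p * q) S *\<^sub>v v)"
    using v S by (intro eq_vecI) auto
  ultimately show ?case using v by (simp add: pCons.IH del: mult_pCons_left)
qed (use v in auto)

end

lemma mat_poly_act_self_adjoint:
  assumes S: "S \<in> carrier_mat n n"
    and adj: "\<And>v w. v \<in> carrier_vec n \<Longrightarrow> w \<in> carrier_vec n \<Longrightarrow>
      canon_form n (S *\<^sub>v v) w = canon_form n v (S *\<^sub>v w)"
    and v: "v \<in> carrier_vec n" and w: "w \<in> carrier_vec n"
  shows "canon_form n (mat_poly p S *\<^sub>v v) w = canon_form n v (mat_poly p S *\<^sub>v w)"
  using w
proof (induction p arbitrary: w)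
  case 0
  then show ?case using v by (simp add: mat_poly_act_0[OF S])
next
  case (pCons a p)
  have "mat_poly p S *\<^sub>v (S *\<^sub>v w) = S *\<^sub>v (mat_poly p S *\<^sub>v w)"
    by (rule mat_poly_act_commute[OF S pCons.prems S refl])
  then show ?case
    using pCons S v
    by (simp add: mat_poly_act_pCons[OF S] mat_poly_act_carrier[OF S] canon_form_bilinear adj)
qed

text \<open>A square root \<open>p\<close> of \<open>x\<close> modulo \<open>q\<close>, say \<open>p\<^sup>2 - x = q h\<close>, lifts to the modulus \<open>(x - a) q\<close>: replacing \<open>p\<close>
  by \<open>p + t q\<close> leaves the equation \<open>h(a) + 2 t p(a) + t\<^sup>2 q(a) = 0\<close> for the constant \<open>t\<close>. It is
  solvable over the complex numbers, for if \<open>q(a) = 0\<close> then \<open>p(a)\<^sup>2 = a \<noteq> 0\<close>.\<close>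

lemma poly_sqrt_mod_linear_factors:
  fixes as :: "complex list"
  assumes "0 \<notin> set as"
  shows "\<exists>p. (\<Prod>a\<leftarrow>as. [:- a, 1:]) dvd p\<^sup>2 - [:0, 1:]"
  using assms
proof (induction as)
  case Nil
  then show ?case by simp
next
  case (Cons a as)
  define q where "q = (\<Prod>a\<leftarrow>as. [:- a, 1:])"
  obtain p h where h: "p\<^sup>2 - [:0, 1:] = q * h"
    using Cons unfolding q_def by (auto elim: dvdE)
  have root: "\<exists>t. poly h a + 2 * t * poly p a + t\<^sup>2 * poly q a = 0"
  proof (cases "poly q a = 0")
    case True
    then have "(poly p a)\<^sup>2 = a" using arg_cong[OF h, of "\<lambda>r. poly r a"] by simp
    then have "poly p a \<noteq> 0" using Cons.prems by auto
    then show ?thesis using True by (intro exI[of _ "- poly h a / (2 * poly p a)"]) simp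
  next
    case False
    have "[:poly h a, 2 * poly p a, poly q a:] \<noteq> 0 \<and> degree [:poly h a, 2 * poly p a, poly q a:] \<noteq> 0"
      using False by simp
    then obtain t where "poly [:poly h a, 2 * poly p a, poly q a:] t = 0"
      using fundamental_theorem_of_algebra[of "[:poly h a, 2 * poly p a, poly q a:]"]
      by (auto simp only: constant_degree)
    then have "poly h a + t * (2 * poly p a + t * poly q a) = 0" by simp
    moreover have "poly h a + 2 * t * poly p a + t\<^sup>2 * poly q a
        = poly h a + t * (2 * poly p a + t * poly q a)"
      by (simp add: power2_eq_square distrib_left)
    ultimately show ?thesis by (intro exI[of _ t]) simp
  qed
  then obtain t where t: "poly h a + 2 * t * poly p a + t\<^sup>2 * poly q a = 0" by blast
  have "(p + [:t:] * q)\<^sup>2 - [:0, 1:] = q * h + 2 * [:t:] * p * q + [:t:]\<^sup>2 * q\<^sup>2"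
    unfolding h[symmetric] by (simp add: power2_eq_square algebra_simps)
  also have "\<dots> = q * (h + 2 * [:t:] * p + [:t:]\<^sup>2 * q)"
    by (simp only: power2_eq_square distrib_left mult_ac)
  finally have eq: "(p + [:t:] * q)\<^sup>2 - [:0, 1:] = q * (h + 2 * [:t:] * p + [:t:]\<^sup>2 * q)" .
  have "poly (h + 2 * [:t:] * p + [:t:]\<^sup>2 * q) a = poly h a + 2 * t * poly p a + t\<^sup>2 * poly q a"
    by (simp add: power2_eq_square algebra_simps)
  then have "poly (h + 2 * [:t:] * p + [:t:]\<^sup>2 * q) a = 0" using t by simp
  then have "[:- a, 1:] dvd h + 2 * [:t:] * p + [:t:]\<^sup>2 * q" by (simp only: poly_eq_0_iff_dvd)
  then have "q * [:- a, 1:] dvd (p + [:t:] * q)\<^sup>2 - [:0, 1:]" unfolding eq by (rule mult_dvd_mono[OF dvd_refl])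
  then show ?case by (auto simp: q_def mult.commute simp del: mult_pCons_left mult_pCons_right)
qed

text \<open>The theorem of Cayley and Hamilton for triangular matrices. The factor belonging to the \<open>k\<close>-th
  diagonal entry maps the span of the first \<open>k + 1\<close> unit vectors into the span of the first \<open>k\<close>, so
  that the factors dispose of the unit vectors one after the other.\<close>

lemma upper_triangular_annihilated:
  fixes T :: "'a :: field mat"
  assumes T: "T \<in> carrier_mat n n" and tri: "upper_triangular T" and "k \<le> n"
    and "w \<in> carrier_vec n" "\<And>i. k \<le> i \<Longrightarrow> i < n \<Longrightarrow> w $ i = 0"
  shows "mat_poly (\<Prod>a\<leftarrow>map (\<lambda>i. T $$ (i, i)) [0..<k]. [:- a, 1:]) T *\<^sub>v w = 0\<^sub>v n"
  using assms(3-)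
proof (induction k arbitrary: w)
  case 0
  then have "w = 0\<^sub>v n" by (intro eq_vecI) auto
  moreover have "mat_poly p T *\<^sub>v 0\<^sub>v n = 0\<^sub>v n" for p
    using mat_poly_carrier[OF T, of p] by auto
  ultimately show ?case by simp
next
  case (Suc k)
  let ?q = "\<Prod>a\<leftarrow>map (\<lambda>i. T $$ (i, i)) [0..<k]. [:- a, 1:]"
  define w' where "w' = mat_poly [:- T $$ (k, k), 1:] T *\<^sub>v w"
  have w'_eq: "w' = - T $$ (k, k) \<cdot>\<^sub>v w + T *\<^sub>v w"
    using T Suc.prems(2) mult_mat_vec_carrier[OF T]
    by (simp add: w'_def mat_poly_act_pCons[OF T] mat_poly_act_0[OF T] mult_mat_zero_vec[OF T])
  have "w' $ i = 0" if "k \<le> i" "i < n" for i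
  proof -
    have "(T *\<^sub>v w) $ i = (\<Sum>j<n. T $$ (i, j) * w $ j)"
      using T Suc.prems(2) that by (simp add: scalar_prod_def atLeast0LessThan)
    also have "\<dots> = (\<Sum>j<n. if j = i then T $$ (i, i) * w $ i else 0)"
    proof (rule sum.cong[OF refl])
      fix j assume "j \<in> {..<n}"
      moreover have "T $$ (i, j) = 0" if "j < i" using tri T that \<open>i < n\<close> by auto
      moreover have "w $ j = 0" if "i < j" "j < n" using Suc.prems(3) that \<open>k \<le> i\<close> by simp
      ultimately show "T $$ (i, j) * w $ j = (if j = i then T $$ (i, i) * w $ i else 0)"
        by (metis lessThan_iff linorder_neqE_nat mult_eq_0_iff)
    qed
    finally have "(T *\<^sub>v w) $ i = T $$ (i, i) * w $ i" using \<open>i < n\<close> by simp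
    moreover have "T $$ (i, i) * w $ i = T $$ (k, k) * w $ i"
      using Suc.prems(3)[of i] that by (cases "i = k") auto
    ultimately show ?thesis using T Suc.prems(2) \<open>i < n\<close> by (simp add: w'_eq)
  qed
  then have "mat_poly ?q T *\<^sub>v w' = 0\<^sub>v n"
    using Suc.IH[of w'] Suc.prems(1,2) T mat_poly_act_carrier[OF T] by (auto simp: w'_def)
  then show ?case
    unfolding w'_def mat_poly_act_mult[OF T Suc.prems(2), symmetric] by simp
qed

lemma invertible_mat_annihilated:
  fixes S :: "complex mat"
  assumes S: "S \<in> carrier_mat n n" and inv: "invertible_mat S"
  obtains as where "0 \<notin> set as"
    "\<And>v. v \<in> carrier_vec n \<Longrightarrow> mat_poly (\<Prod>a\<leftarrow>as. [:- a, 1:]) S *\<^sub>v v = 0\<^sub>v n"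
proof -
  obtain n_as where "jordan_nf S n_as"
    using char_poly_factorized[OF S] jordan_nf_exists[OF S] by blast
  then obtain P Q where PQ: "similar_mat_wit S (jordan_matrix n_as) P Q"
    unfolding jordan_nf_def similar_mat_def by blast
  define T where "T = jordan_matrix n_as"
  have wit: "S = P * T * Q" "S \<in> carrier_mat n n" "T \<in> carrier_mat n n" "P \<in> carrier_mat n n"
    "Q \<in> carrier_mat n n" "P * Q = 1\<^sub>m n" "Q * P = 1\<^sub>m n"
    using similar_mat_witD2[OF S PQ] unfolding T_def by auto
  have tri: "upper_triangular T"
    unfolding T_def by (intro upper_triangularI jordan_matrix_upper_triangular) auto
  define as where "as = map (\<lambda>i. T $$ (i, i)) [0..<n]"
  have "det S * det S' = 1" if "S * S' = 1\<^sub>m n" "S' \<in> carrier_mat n n" for S'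
    using that det_mult[OF S, of S'] by simp
  then have "det S \<noteq> 0" by (metis S inv inverse_mat_exists mult_zero_left zero_neq_one)
  then have "det T \<noteq> 0" using det_similar[of S T] PQ unfolding T_def similar_mat_def by metis
  then have "0 \<notin> set (diag_mat T)" using upper_triangular_imp_det_eq_0_iff[OF wit(3) tri] by simp
  then have "0 \<notin> set as" using wit(3) by (simp add: as_def diag_mat_def)
  moreover have "mat_poly (\<Prod>a\<leftarrow>as. [:- a, 1:]) S *\<^sub>v v = 0\<^sub>v n" if v: "v \<in> carrier_vec n" for v
  proof -
    have conj: "mat_poly p S *\<^sub>v v = P *\<^sub>v (mat_poly p T *\<^sub>v (Q *\<^sub>v v))" for p
    proof (induction p)
      case 0
      then show ?case using v wit mult_mat_zero_vec[OF wit(4)] by (simp add: mat_poly_act_0[of _ n])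
    next
      case (pCons a p)
      have Qv: "Q *\<^sub>v v \<in> carrier_vec n" using wit v by simp
      have PQv: "P *\<^sub>v (Q *\<^sub>v v) = v"
        using assoc_mult_mat_vec[OF wit(4,5) v] wit(6) v by simp
      let ?w = "mat_poly p T *\<^sub>v (Q *\<^sub>v v)"
      have w: "?w \<in> carrier_vec n" using mat_poly_act_carrier[OF wit(3) Qv] .
      have "S *\<^sub>v (P *\<^sub>v ?w) = (P * T * Q * P) *\<^sub>v ?w"
        using wit w by (simp add: assoc_mult_mat_vec[of _ n n _ n])
      also have "P * T * Q * P = P * T"
        using wit by (simp add: assoc_mult_mat[of _ n n _ n _ n])
      finally have "S *\<^sub>v (P *\<^sub>v ?w) = P *\<^sub>v (T *\<^sub>v ?w)"
        using wit w by (simp add: assoc_mult_mat_vec[of _ n n _ n])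
      then show ?case
        using wit(2-5) v w Qv PQv pCons.IH
        by (simp add: mat_poly_act_pCons[of _ n] mult_add_distrib_mat_vec[of _ n n] mult_mat_vec[of _ n n])
    qed
    show ?thesis unfolding conj as_def
      using upper_triangular_annihilated[OF wit(3) tri le_refl, of "Q *\<^sub>v v"]
        mult_mat_zero_vec[OF wit(4)] wit(5) v by simp
  qed
  ultimately show thesis by (rule that)
qed

lemma polynomial_sqrt_exists:
  fixes S :: "complex mat"
  assumes S: "S \<in> carrier_mat n n" and inv: "invertible_mat S"
  obtains p where "\<And>v. v \<in> carrier_vec n \<Longrightarrow> mat_poly p S *\<^sub>v (mat_poly p S *\<^sub>v v) = S *\<^sub>v v"
proof -
  obtain as where as: "0 \<notin> set as"
    "\<And>v. v \<in> carrier_vec n \<Longrightarrow> mat_poly (\<Prod>a\<leftarrow>as. [:- a, 1:]) S *\<^sub>v v = 0\<^sub>v n"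
    using invertible_mat_annihilated[OF S inv] by blast
  let ?q = "\<Prod>a\<leftarrow>as. [:- a, 1:]"
  obtain p h where "p\<^sup>2 - [:0, 1:] = ?q * h"
    using poly_sqrt_mod_linear_factors[OF as(1)] by (auto elim: dvdE)
  then have p: "p * p = [:0, 1:] + h * ?q" by (simp add: power2_eq_square algebra_simps)
  have "mat_poly p S *\<^sub>v (mat_poly p S *\<^sub>v v) = S *\<^sub>v v" if v: "v \<in> carrier_vec n" for v
  proof -
    have "mat_poly p S *\<^sub>v (mat_poly p S *\<^sub>v v) = mat_poly [:0, 1:] S *\<^sub>v v + mat_poly h S *\<^sub>v 0\<^sub>v n"
      unfolding mat_poly_act_mult[OF S v, symmetric] p
      by (simp only: mat_poly_act_add[OF S v] mat_poly_act_mult[OF S v] as(2)[OF v])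
    also have "mat_poly h S *\<^sub>v 0\<^sub>v n = 0\<^sub>v n" using mat_poly_carrier[OF S, of h] by auto
    also have "mat_poly [:0, 1:] S *\<^sub>v v + 0\<^sub>v n = S *\<^sub>v v"
      using S v mult_mat_zero_vec[OF S]
      by (intro eq_vecI) (auto simp: mat_poly_act_pCons[OF S] mat_poly_act_0[OF S])
    finally show ?thesis .
  qed
  then show thesis by (rule that)
qed

text \<open>For the adjoint \<open>P\<^sup>*\<close> of \<open>P\<close>, the matrix \<open>S = P\<^sup>* P\<close> is self-adjoint, and it commutes with \<open>C\<close>
  because \<open>C\<close> and \<open>D\<close> are skew. A square root \<open>R\<close> of \<open>S\<close> that is a polynomial in \<open>S\<close> inherits both
  properties. Hence \<open>P R\<^sup>-\<^sup>1\<close> is an isometry, and it still conjugates \<open>C\<close> to \<open>D\<close>.\<close>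

lemma similar_imp_orth_conjugate:
  assumes C: "C \<in> orth_algebra n" and D: "D \<in> orth_algebra n"
    and P: "P \<in> carrier_mat n n" "invertible_mat P"
    and PC: "\<And>v. v \<in> carrier_vec n \<Longrightarrow> P *\<^sub>v (C *\<^sub>v v) = D *\<^sub>v (P *\<^sub>v v)"
  obtains U where "U \<in> orth_group n"
    "\<And>v. v \<in> carrier_vec n \<Longrightarrow> U *\<^sub>v (C *\<^sub>v v) = D *\<^sub>v (U *\<^sub>v v)"
proof -
  note Cc = orth_algebraD(1)[OF C] note Dc = orth_algebraD(1)[OF D]
  obtain P' where P': "P' \<in> carrier_mat n n" "\<And>v w. v \<in> carrier_vec n \<Longrightarrow> w \<in> carrier_vec n \<Longrightarrow>
      canon_form n (P *\<^sub>v v) w = canon_form n v (P' *\<^sub>v w)"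
    using adjoint_exists[OF P(1)] by blast
  define S where "S = P' * P"
  have S: "S \<in> carrier_mat n n" using P P' by (simp add: S_def)
  have S_form: "canon_form n (P *\<^sub>v v) (P *\<^sub>v w) = canon_form n v (S *\<^sub>v w)"
    if "v \<in> carrier_vec n" "w \<in> carrier_vec n" for v w
    using that P P' by (simp add: S_def)
  have S_adj: "canon_form n (S *\<^sub>v v) w = canon_form n v (S *\<^sub>v w)"
    if "v \<in> carrier_vec n" "w \<in> carrier_vec n" for v w
    using S_form[OF that] S_form[OF that(2,1)] by (simp add: canon_form_sym)
  have SC: "S *\<^sub>v (C *\<^sub>v v) = C *\<^sub>v (S *\<^sub>v v)" if v: "v \<in> carrier_vec n" for v
  proof (rule canon_form_eqI[of _ n])
    fix w :: "complex vec" assume w: "w \<in> carrier_vec n"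
    have Cv: "C *\<^sub>v v \<in> carrier_vec n" and Cw: "C *\<^sub>v w \<in> carrier_vec n"
      and Pv: "P *\<^sub>v v \<in> carrier_vec n" and Pw: "P *\<^sub>v w \<in> carrier_vec n"
      and Sv: "S *\<^sub>v v \<in> carrier_vec n" using Cc P S v w by auto
    have "canon_form n (S *\<^sub>v (C *\<^sub>v v)) w = canon_form n (D *\<^sub>v (P *\<^sub>v v)) (P *\<^sub>v w)"
      using S_adj[OF Cv w] S_form[OF Cv w] PC[OF v] by simp
    also have "\<dots> = - canon_form n (P *\<^sub>v v) (P *\<^sub>v (C *\<^sub>v w))"
      using orth_algebraD(2)[OF D Pv Pw] PC[OF w] by simp
    also have "\<dots> = - canon_form n (S *\<^sub>v v) (C *\<^sub>v w)"
      using S_adj[OF v Cw] S_form[OF v Cw] by simp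
    also have "\<dots> = canon_form n (C *\<^sub>v (S *\<^sub>v v)) w"
      using orth_algebraD(2)[OF C Sv w] by simp
    finally show "canon_form n (S *\<^sub>v (C *\<^sub>v v)) w = canon_form n (C *\<^sub>v (S *\<^sub>v v)) w" .
  qed (use S Cc v in auto)
  obtain Q where Q: "Q \<in> carrier_mat n n" "\<And>v. v \<in> carrier_vec n \<Longrightarrow> P *\<^sub>v (Q *\<^sub>v v) = v"
    "\<And>v. v \<in> carrier_vec n \<Longrightarrow> Q *\<^sub>v (P *\<^sub>v v) = v"
    using inverse_mat_exists[OF P] by metis
  obtain Q' where Q': "Q' \<in> carrier_mat n n" "\<And>v w. v \<in> carrier_vec n \<Longrightarrow> w \<in> carrier_vec n \<Longrightarrow>
      canon_form n (Q *\<^sub>v v) w = canon_form n v (Q' *\<^sub>v w)"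
    using adjoint_exists[OF Q(1)] by blast
  have Q'P': "Q' *\<^sub>v (P' *\<^sub>v v) = v" if v: "v \<in> carrier_vec n" for v
  proof (rule canon_form_eqI[of _ n])
    fix w :: "complex vec" assume w: "w \<in> carrier_vec n"
    have "canon_form n w (Q' *\<^sub>v (P' *\<^sub>v v)) = canon_form n (P *\<^sub>v (Q *\<^sub>v w)) v"
      using P'(1) Q(1) v w by (simp add: P'(2) Q'(2)[symmetric])
    then show "canon_form n (Q' *\<^sub>v (P' *\<^sub>v v)) w = canon_form n v w"
      using Q(2)[OF w] by (simp add: canon_form_sym)
  qed (use Q' P' v in auto)
  have QQ'S: "(Q * Q') *\<^sub>v (S *\<^sub>v v) = v" if v: "v \<in> carrier_vec n" for v
  proof -
    have "(Q * Q') *\<^sub>v (S *\<^sub>v v) = Q *\<^sub>v (Q' *\<^sub>v (P' *\<^sub>v (P *\<^sub>v v)))"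
      using P(1) P'(1) Q(1) Q'(1) v by (simp add: S_def)
    then show ?thesis using Q'P'[of "P *\<^sub>v v"] Q(3)[OF v] P(1) v by simp
  qed
  then have "invertible_mat S"
    by (rule invertible_matI[OF S mult_carrier_mat[OF Q(1) Q'(1)]])
  then obtain p where p: "\<And>v. v \<in> carrier_vec n \<Longrightarrow> mat_poly p S *\<^sub>v (mat_poly p S *\<^sub>v v) = S *\<^sub>v v"
    using polynomial_sqrt_exists[OF S] by blast
  define R where "R = mat_poly p S"
  have R: "R \<in> carrier_mat n n" unfolding R_def by (rule mat_poly_carrier[OF S])
  have R_adj: "canon_form n (R *\<^sub>v v) w = canon_form n v (R *\<^sub>v w)"
    if "v \<in> carrier_vec n" "w \<in> carrier_vec n" for v w
    unfolding R_def by (rule mat_poly_act_self_adjoint[OF S S_adj that])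
  have RC: "R *\<^sub>v (C *\<^sub>v v) = C *\<^sub>v (R *\<^sub>v v)" if "v \<in> carrier_vec n" for v
    unfolding R_def by (rule mat_poly_act_commute[OF S that Cc SC])
  have RR: "R *\<^sub>v (R *\<^sub>v v) = S *\<^sub>v v" if "v \<in> carrier_vec n" for v
    unfolding R_def using that by (rule p)
  have QQ': "Q * Q' \<in> carrier_mat n n" using Q Q' by simp
  have "(Q * Q' * R) *\<^sub>v (R *\<^sub>v v) = v" if v: "v \<in> carrier_vec n" for v
    using assoc_mult_mat_vec[OF QQ' R, of "R *\<^sub>v v"] R v by (simp only: RR QQ'S mult_mat_vec_carrier)
  then have "invertible_mat R"
    by (rule invertible_matI[OF R mult_carrier_mat[OF QQ' R]])
  then obtain W where W: "W \<in> carrier_mat n n" "\<And>v. v \<in> carrier_vec n \<Longrightarrow> R *\<^sub>v (W *\<^sub>v v) = v"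
    "\<And>v. v \<in> carrier_vec n \<Longrightarrow> W *\<^sub>v (R *\<^sub>v v) = v"
    using inverse_mat_exists[OF R] by metis
  have WC: "W *\<^sub>v (C *\<^sub>v v) = C *\<^sub>v (W *\<^sub>v v)" if v: "v \<in> carrier_vec n" for v
    using RC[of "W *\<^sub>v v"] W v Cc by (metis mult_mat_vec_carrier)
  show thesis
  proof (rule that[of "P * W"])
    show "P * W \<in> orth_group n"
    proof (rule isometry_in_orth_group)
      fix v w :: "complex vec" assume v: "v \<in> carrier_vec n" and w: "w \<in> carrier_vec n"
      have Wv: "W *\<^sub>v v \<in> carrier_vec n" and Ww: "W *\<^sub>v w \<in> carrier_vec n" using W(1) v w by auto
      have "canon_form n ((P * W) *\<^sub>v v) ((P * W) *\<^sub>v w) = canon_form n (W *\<^sub>v v) (R *\<^sub>v (R *\<^sub>v (W *\<^sub>v w)))"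
        using P(1) W(1) v w Wv Ww by (simp add: S_form RR)
      also have "\<dots> = canon_form n (R *\<^sub>v (W *\<^sub>v v)) (R *\<^sub>v (W *\<^sub>v w))"
        using R_adj[OF Wv] R Ww by simp
      finally show "canon_form n ((P * W) *\<^sub>v v) ((P * W) *\<^sub>v w) = canon_form n v w"
        using W(2) v w by simp
    qed (use P W in auto)
    show "(P * W) *\<^sub>v (C *\<^sub>v v) = D *\<^sub>v ((P * W) *\<^sub>v v)" if v: "v \<in> carrier_vec n" for v
      using P(1) W(1) Cc Dc v PC WC[OF v] by simp
  qed
qed

section \<open>Nilpotent orbits\<close>

lemma jordan_matrix_zero_entries:
  assumes "\<And>m a. (m, a) \<in> set n_as \<Longrightarrow> a = (0 :: 'a :: zero_neq_one)"
    and "i < sum_list (map fst n_as)" "j < sum_list (map fst n_as)"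
  shows "jordan_matrix n_as $$ (i, j) \<in> {0, 1} \<and> (jordan_matrix n_as $$ (i, j) \<noteq> 0 \<longrightarrow> j = Suc i)"
  using assms
proof (induction n_as arbitrary: i j)
  case Nil
  then show ?case by simp
next
  case (Cons na n_as)
  obtain m a where na: "na = (m, a)" by force
  then have a: "a = 0" using Cons.prems(1) by auto
  let ?J = "jordan_matrix n_as"
  have J: "jordan_matrix (na # n_as) = four_block_mat (jordan_block m 0)
      (0\<^sub>m m (dim_col ?J)) (0\<^sub>m (dim_row ?J) m) ?J"
    by (simp add: jordan_matrix_def na a Let_def)
  have IH: "?J $$ (i', j') \<in> {0, 1} \<and> (?J $$ (i', j') \<noteq> 0 \<longrightarrow> j' = Suc i')"
    if "i' < sum_list (map fst n_as)" "j' < sum_list (map fst n_as)" for i' j'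
    by (rule Cons.IH) (use that Cons.prems(1) in auto)
  show ?case
  proof (cases "i < m \<or> j < m")
    case True
    then show ?thesis using Cons.prems(2,3) by (auto simp: J[unfolded na] na)
  next
    case False
    then have "i - m < sum_list (map fst n_as)" "j - m < sum_list (map fst n_as)"
      using Cons.prems(2,3) by (auto simp: na)
    note IH = IH[OF this]
    have "jordan_matrix (na # n_as) $$ (i, j) = ?J $$ (i - m, j - m)"
      using False Cons.prems(2,3) by (simp add: J[unfolded na] na)
    with IH False show ?thesis by (metis Suc_diff_le le_add_diff_inverse linorder_not_less add_Suc_right)
  qed
qed

text \<open>A finite set that contains all nilpotent Jordan matrices of size \<open>n\<close>.\<close>

definition zero_one_mats :: "nat \<Rightarrow> complex mat set" where
  "zero_one_mats n = {J \<in> carrier_mat n n. \<forall>i<n. \<forall>j<n. J $$ (i, j) \<in> {0, 1}}"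

lemma finite_zero_one_mats: "finite (zero_one_mats n)"
proof (rule finite_subset)
  let ?I = "{..<n} \<times> {..<n}"
  show "zero_one_mats n \<subseteq> mat n n ` (?I \<rightarrow>\<^sub>E {0, 1})"
  proof
    fix J assume "J \<in> zero_one_mats n"
    then have "J = mat n n (restrict (\<lambda>ij. J $$ ij) ?I)" "restrict (\<lambda>ij. J $$ ij) ?I \<in> ?I \<rightarrow>\<^sub>E {0, 1}"
      by (auto simp: zero_one_mats_def intro!: eq_matI)
    then show "J \<in> mat n n ` (?I \<rightarrow>\<^sub>E {0, 1})" by blast
  qed
  show "finite (mat n n ` (?I \<rightarrow>\<^sub>E {0, 1 :: complex}))" by (intro finite_imageI finite_PiE) auto
qed

lemma nilpotent_similar_superdiagonal:
  fixes C :: "complex mat"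
  assumes C: "C \<in> carrier_mat n n" and nil: "C ^\<^sub>m k = 0\<^sub>m n n"
  obtains J where "J \<in> zero_one_mats n" "\<And>i j. i < n \<Longrightarrow> j < n \<Longrightarrow> J $$ (i, j) \<noteq> 0 \<Longrightarrow> j = Suc i"
    "similar_mat C J"
proof -
  obtain n_as where jnf: "jordan_nf C n_as"
    using char_poly_factorized[OF C] jordan_nf_exists[OF C] by blast
  then have sim: "similar_mat C (jordan_matrix n_as)" by (simp add: jordan_nf_def)
  have zero: "a = 0" if ma: "(m, a) \<in> set n_as" for m a
  proof -
    have "m \<noteq> 0" using jnf ma unfolding jordan_nf_def by force
    then have "poly (char_poly C) a = 0"
      unfolding jordan_nf_char_poly[OF jnf] poly_prod_list prod_list_zero_iff
      using ma by (auto intro!: image_eqI[of _ _ "(m, a)"])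
    then obtain v where v: "eigenvector C v a"
      using eigenvalue_root_char_poly[OF C] unfolding eigenvalue_def by blast
    then have vc: "v \<in> carrier_vec n" "v \<noteq> 0\<^sub>v n" using C unfolding eigenvector_def by auto
    have "0\<^sub>m n n *\<^sub>v v = 0\<^sub>v n" using vc by (intro eq_vecI) auto
    then have "a ^ k \<cdot>\<^sub>v v = 0\<^sub>v n" using eigenvector_pow[OF C v, of k] nil by simp
    then have "a ^ k = 0" using vc by (auto simp: vec_eq_iff)
    then show ?thesis by simp
  qed
  have "jordan_matrix n_as \<in> carrier_mat n n" using similar_matD[OF sim] C by auto
  then have "sum_list (map fst n_as) = n" by (metis carrier_matD(1) jordan_matrix_dim(1))
  with jordan_matrix_zero_entries[of n_as, OF zero] sim \<open>jordan_matrix n_as \<in> carrier_mat n n\<close>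
  show thesis by (intro that[of "jordan_matrix n_as"]) (auto simp: zero_one_mats_def)
qed

text \<open>On a matrix that is supported on the superdiagonal, conjugation by the diagonal matrix with entries
  \<open>c\<^sup>i\<close> divides by \<open>c\<close>; a nilpotent Jordan matrix is of this kind.\<close>

lemma nilpotent_similar_smult:
  fixes C :: "complex mat"
  assumes C: "C \<in> carrier_mat n n" and nil: "C ^\<^sub>m k = 0\<^sub>m n n" and c: "c \<noteq> 0"
  shows "similar_mat C (c \<cdot>\<^sub>m C)"
proof -
  obtain J where "J \<in> zero_one_mats n" and
    super: "\<And>i j. i < n \<Longrightarrow> j < n \<Longrightarrow> J $$ (i, j) \<noteq> 0 \<Longrightarrow> j = Suc i" and sim: "similar_mat C J"
    using nilpotent_similar_superdiagonal[OF C nil] by blast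
  then have J: "J \<in> carrier_mat n n" by (simp add: zero_one_mats_def)
  have "similar_mat J (c \<cdot>\<^sub>m J)"
  proof (rule similar_matI)
    have "inverse c ^ i * c ^ i = 1" "c ^ i * inverse c ^ i = 1" for i :: nat
      using c by (simp_all flip: power_mult_distrib)
    then show "mat_diag n (\<lambda>i. c ^ i) * mat_diag n (\<lambda>i. inverse c ^ i) = 1\<^sub>m n"
      "mat_diag n (\<lambda>i. inverse c ^ i) * mat_diag n (\<lambda>i. c ^ i) = 1\<^sub>m n" by simp_all
    show "J = mat_diag n (\<lambda>i. c ^ i) * (c \<cdot>\<^sub>m J) * mat_diag n (\<lambda>i. inverse c ^ i)"
    proof (rule eq_matI)
      fix i j
      assume "i < dim_row (mat_diag n (\<lambda>i. c ^ i) * (c \<cdot>\<^sub>m J) * mat_diag n (\<lambda>i. inverse c ^ i))"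
        and "j < dim_col (mat_diag n (\<lambda>i. c ^ i) * (c \<cdot>\<^sub>m J) * mat_diag n (\<lambda>i. inverse c ^ i))"
      then have ij: "i < n" "j < n" by (auto simp: mat_diag_def)
      have "c ^ i * (c * J $$ (i, j)) * inverse c ^ j = J $$ (i, j)"
        using super[OF ij] c by (cases "J $$ (i, j) = 0") (auto simp: field_simps)
      then show "J $$ (i, j) = (mat_diag n (\<lambda>i. c ^ i) * (c \<cdot>\<^sub>m J) * mat_diag n (\<lambda>i. inverse c ^ i)) $$ (i, j)"
        using J ij mat_diag_mult_left[of "c \<cdot>\<^sub>m J" n n "\<lambda>i. c ^ i"]
          mat_diag_mult_right[of "mat_diag n (\<lambda>i. c ^ i) * (c \<cdot>\<^sub>m J)" n n "\<lambda>i. inverse c ^ i"] by simp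
    qed (use J in \<open>auto simp: mat_diag_def\<close>)
  qed (use J in auto)
  moreover have "similar_mat (c \<cdot>\<^sub>m C) (c \<cdot>\<^sub>m J)" using similar_mat_smult[OF sim] .
  ultimately show ?thesis using sim similar_mat_trans similar_mat_sym by blast
qed

lemma adjoint_orbit_iff:
  assumes C: "C \<in> carrier_mat n n"
  shows "D \<in> adjoint_orbit n C \<longleftrightarrow> D \<in> carrier_mat n n \<and>
    (\<exists>U\<in>orth_group n. \<forall>v\<in>carrier_vec n. U *\<^sub>v (C *\<^sub>v v) = D *\<^sub>v (U *\<^sub>v v))"
proof
  assume "D \<in> adjoint_orbit n C"
  then obtain U V where U: "U \<in> orth_group n" and wit: "similar_mat_wit D C U V"
    unfolding adjoint_orbit_def by blast
  have D: "D \<in> carrier_mat n n"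
    using similar_mat_witD[OF refl wit] C by (metis carrier_matD(1))
  have w: "U * V = 1\<^sub>m n" "V * U = 1\<^sub>m n" "D = U * C * V" "U \<in> carrier_mat n n" "V \<in> carrier_mat n n"
    using similar_mat_witD2[OF D wit] by auto
  have "D * U = U * C * (V * U)" using w(3-) C by (simp add: assoc_mult_mat[of _ n n _ n _ n])
  then have "D * U = U * C" using w C by simp
  then have "U *\<^sub>v (C *\<^sub>v v) = D *\<^sub>v (U *\<^sub>v v)" if "v \<in> carrier_vec n" for v
    using w(4) C D that by (metis assoc_mult_mat_vec)
  then show "D \<in> carrier_mat n n \<and>
    (\<exists>U\<in>orth_group n. \<forall>v\<in>carrier_vec n. U *\<^sub>v (C *\<^sub>v v) = D *\<^sub>v (U *\<^sub>v v))" using U D by blast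
next
  assume "D \<in> carrier_mat n n \<and>
    (\<exists>U\<in>orth_group n. \<forall>v\<in>carrier_vec n. U *\<^sub>v (C *\<^sub>v v) = D *\<^sub>v (U *\<^sub>v v))"
  then obtain U where D: "D \<in> carrier_mat n n" and U: "U \<in> orth_group n"
    and UC: "\<And>v. v \<in> carrier_vec n \<Longrightarrow> U *\<^sub>v (C *\<^sub>v v) = D *\<^sub>v (U *\<^sub>v v)" by blast
  obtain V where V: "V \<in> carrier_mat n n" "U * V = 1\<^sub>m n" "V * U = 1\<^sub>m n"
    "\<And>v. v \<in> carrier_vec n \<Longrightarrow> U *\<^sub>v (V *\<^sub>v v) = v"
    using inverse_mat_exists[OF orth_groupD(1,2)[OF U]] by metis
  note Uc = orth_groupD(1)[OF U]
  have "D = U * C * V"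
    by (rule mat_eq_if_same_action[of _ n n])
      (use Uc C D V UC in \<open>auto simp: assoc_mult_mat_vec[of _ n n _ n]\<close>)
  then have "similar_mat_wit D C U V"
    by (intro similar_mat_witI[of _ _ n]) (use Uc C D V in auto)
  then show "D \<in> adjoint_orbit n C" using U unfolding adjoint_orbit_def by blast
qed

lemma orth_group_inverse:
  assumes U: "U \<in> orth_group n"
  obtains V where "V \<in> orth_group n" "\<And>v. v \<in> carrier_vec n \<Longrightarrow> V *\<^sub>v (U *\<^sub>v v) = v"
    "\<And>v. v \<in> carrier_vec n \<Longrightarrow> U *\<^sub>v (V *\<^sub>v v) = v"
proof -
  obtain V where V: "V \<in> carrier_mat n n" "\<And>v. v \<in> carrier_vec n \<Longrightarrow> U *\<^sub>v (V *\<^sub>v v) = v"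
    "\<And>v. v \<in> carrier_vec n \<Longrightarrow> V *\<^sub>v (U *\<^sub>v v) = v"
    using inverse_mat_exists[OF orth_groupD(1,2)[OF U]] by metis
  have "canon_form n (V *\<^sub>v v) (V *\<^sub>v w) = canon_form n v w"
    if "v \<in> carrier_vec n" "w \<in> carrier_vec n" for v w
    using orth_groupD(3)[OF U, of "V *\<^sub>v v" "V *\<^sub>v w"] V that by simp
  then have "V \<in> orth_group n" by (rule isometry_in_orth_group[OF V(1)])
  then show thesis using that V by blast
qed

lemma adjoint_orbit_sym:
  assumes C: "C \<in> carrier_mat n n" and D: "D \<in> adjoint_orbit n C"
  shows "C \<in> adjoint_orbit n D"
proof -
  have Dc: "D \<in> carrier_mat n n" using D by (simp add: adjoint_orbit_iff[OF C])
  obtain U where U: "U \<in> orth_group n" and UC: "\<And>v. v \<in> carrier_vec n \<Longrightarrow> U *\<^sub>v (C *\<^sub>v v) = D *\<^sub>v (U *\<^sub>v v)"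
    using D adjoint_orbit_iff[OF C] by blast
  obtain V where V: "V \<in> orth_group n" "\<And>v. v \<in> carrier_vec n \<Longrightarrow> V *\<^sub>v (U *\<^sub>v v) = v"
    "\<And>v. v \<in> carrier_vec n \<Longrightarrow> U *\<^sub>v (V *\<^sub>v v) = v"
    using orth_group_inverse[OF U] by metis
  have "V *\<^sub>v (D *\<^sub>v v) = C *\<^sub>v (V *\<^sub>v v)" if v: "v \<in> carrier_vec n" for v
    using UC[of "V *\<^sub>v v"] V(2)[of "C *\<^sub>v (V *\<^sub>v v)"] V(3)[OF v] orth_groupD(1)[OF V(1)] C v by simp
  then show ?thesis using V(1) C by (auto simp: adjoint_orbit_iff[OF Dc])
qed

lemma adjoint_orbit_subset:
  assumes C: "C \<in> carrier_mat n n" and D: "D \<in> adjoint_orbit n C"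
  shows "adjoint_orbit n D \<subseteq> adjoint_orbit n C"
proof
  fix E assume E: "E \<in> adjoint_orbit n D"
  have Dc: "D \<in> carrier_mat n n" using D by (simp add: adjoint_orbit_iff[OF C])
  obtain U where U: "U \<in> orth_group n" and UC: "\<And>v. v \<in> carrier_vec n \<Longrightarrow> U *\<^sub>v (C *\<^sub>v v) = D *\<^sub>v (U *\<^sub>v v)"
    using D adjoint_orbit_iff[OF C] by blast
  obtain V where V: "V \<in> orth_group n" and VD: "\<And>v. v \<in> carrier_vec n \<Longrightarrow> V *\<^sub>v (D *\<^sub>v v) = E *\<^sub>v (V *\<^sub>v v)"
    and Ec: "E \<in> carrier_mat n n"
    using E adjoint_orbit_iff[OF Dc] by blast
  note Uc = orth_groupD(1)[OF U] note Vc = orth_groupD(1)[OF V]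
  have "(V * U) *\<^sub>v (C *\<^sub>v v) = E *\<^sub>v ((V * U) *\<^sub>v v)" if "v \<in> carrier_vec n" for v
    using Uc Vc C Dc Ec that UC[OF that] VD[of "U *\<^sub>v v"] by simp
  then show "E \<in> adjoint_orbit n C"
    unfolding adjoint_orbit_iff[OF C] using orth_group_mult[OF V U] Ec by blast
qed

lemma adjoint_orbit_eqI:
  assumes C: "C \<in> carrier_mat n n" and D: "D \<in> adjoint_orbit n C"
  shows "adjoint_orbit n C = adjoint_orbit n D"
proof -
  have "D \<in> carrier_mat n n" using D by (simp add: adjoint_orbit_iff[OF C])
  then show ?thesis using adjoint_orbit_subset[OF C D] adjoint_orbit_subset adjoint_orbit_sym[OF C D] by blast
qed

lemma self_in_adjoint_orbit:
  assumes "C \<in> carrier_mat n n"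
  shows "C \<in> adjoint_orbit n C"
  unfolding adjoint_orbit_iff[OF assms] using assms orth_group_one
  by (intro conjI bexI[of _ "1\<^sub>m n"]) auto

lemma similar_imp_same_adjoint_orbit:
  assumes C: "C \<in> orth_algebra n" and D: "D \<in> orth_algebra n" and sim: "similar_mat C D"
  shows "adjoint_orbit n C = adjoint_orbit n D"
proof -
  note Cc = orth_algebraD(1)[OF C] note Dc = orth_algebraD(1)[OF D]
  obtain P Q where wit: "similar_mat_wit D C P Q"
    using similar_mat_sym[OF sim] unfolding similar_mat_def by blast
  have w: "P * Q = 1\<^sub>m n" "Q * P = 1\<^sub>m n" "D = P * C * Q" "P \<in> carrier_mat n n" "Q \<in> carrier_mat n n"
    using similar_mat_witD2[OF Dc wit] by auto
  have "D * P = P * C * (Q * P)" using w(3-) Cc by (simp add: assoc_mult_mat[of _ n n _ n _ n])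
  then have DP: "D * P = P * C" using w Cc by simp
  have "invertible_mat P"
    unfolding invertible_mat_def inverts_mat_def using w by (intro conjI exI[of _ Q]) auto
  moreover have "P *\<^sub>v (C *\<^sub>v v) = D *\<^sub>v (P *\<^sub>v v)" if "v \<in> carrier_vec n" for v
    using w(4) Cc Dc that DP by (metis assoc_mult_mat_vec)
  ultimately obtain U where "U \<in> orth_group n"
    "\<And>v. v \<in> carrier_vec n \<Longrightarrow> U *\<^sub>v (C *\<^sub>v v) = D *\<^sub>v (U *\<^sub>v v)"
    using similar_imp_orth_conjugate[OF C D w(4)] by blast
  then have "D \<in> adjoint_orbit n C" unfolding adjoint_orbit_iff[OF Cc] using Dc by blast
  then show ?thesis by (rule adjoint_orbit_eqI[OF Cc])
qed

lemma nonzero_nilpotentsD: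
  assumes "C \<in> nonzero_nilpotents n"
  obtains k where "C \<in> orth_algebra n" "C \<in> carrier_mat n n" "C \<noteq> 0\<^sub>m n n" "C ^\<^sub>m k = 0\<^sub>m n n"
  using assms orth_algebraD(1) unfolding nonzero_nilpotents_def by blast

lemma adjoint_orbit_smult:
  assumes C: "C \<in> nonzero_nilpotents n" and c: "c \<noteq> 0"
  shows "c \<cdot>\<^sub>m C \<in> orth_algebra n" "adjoint_orbit n (c \<cdot>\<^sub>m C) = adjoint_orbit n C"
proof -
  obtain k where Co: "C \<in> orth_algebra n" and Cc: "C \<in> carrier_mat n n" and nil: "C ^\<^sub>m k = 0\<^sub>m n n"
    using nonzero_nilpotentsD[OF C] by blast
  have act: "(c \<cdot>\<^sub>m C) *\<^sub>v v = c \<cdot>\<^sub>v (C *\<^sub>v v)" if "v \<in> carrier_vec n" for v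
    using Cc that by (intro eq_vecI) auto
  have Cv: "C *\<^sub>v v \<in> carrier_vec n" if "v \<in> carrier_vec n" for v using Cc that by simp
  show cC: "c \<cdot>\<^sub>m C \<in> orth_algebra n"
    unfolding orth_algebra_def using Cc
    by (auto simp: act canon_form_smult_left canon_form_smult_right Cv orth_algebraD(2)[OF Co])
  show "adjoint_orbit n (c \<cdot>\<^sub>m C) = adjoint_orbit n C"
    using similar_imp_same_adjoint_orbit[OF Co cC nilpotent_similar_smult[OF Cc nil c]] by simp
qed

lemma finite_nilpotent_orbits: "finite (nilpotent_orbits n)"
proof -
  have "\<forall>C\<in>nonzero_nilpotents n. \<exists>J. J \<in> zero_one_mats n \<and> similar_mat C J"
    using nonzero_nilpotentsD nilpotent_similar_superdiagonal by metis
  then obtain J where J: "\<And>C. C \<in> nonzero_nilpotents n \<Longrightarrow> J C \<in> zero_one_mats n"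
    "\<And>C. C \<in> nonzero_nilpotents n \<Longrightarrow> similar_mat C (J C)" by metis
  have orbit: "adjoint_orbit n C = adjoint_orbit n D"
    if "C \<in> nonzero_nilpotents n" "D \<in> nonzero_nilpotents n" "J C = J D" for C D
  proof (rule similar_imp_same_adjoint_orbit)
    show "similar_mat C D" using J(2) that similar_mat_trans similar_mat_sym by metis
  qed (use that in \<open>auto simp: nonzero_nilpotents_def\<close>)
  \<comment> \<open>hence \<open>J\<close> induces an injection from the orbits into a finite set\<close>
  define rep where "rep = inv_into (nonzero_nilpotents n) (adjoint_orbit n)"
  have rep: "rep X \<in> nonzero_nilpotents n" "adjoint_orbit n (rep X) = X" if "X \<in> nilpotent_orbits n" for X
    using that unfolding rep_def nilpotent_orbits_def by (simp_all add: inv_into_into f_inv_into_f)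
  show ?thesis
  proof (rule inj_on_finite[of "J \<circ> rep"])
    show "inj_on (J \<circ> rep) (nilpotent_orbits n)"
      by (rule inj_onI) (metis comp_apply orbit rep)
    show "(J \<circ> rep) ` nilpotent_orbits n \<subseteq> zero_one_mats n" using J(1) rep(1) by auto
  qed (rule finite_zero_one_mats)
qed

section \<open>Moving hyperbolic pairs inside a kernel\<close>

text \<open>The image of the skew map \<open>D\<close> is orthogonal to its kernel. So the reflection in \<open>w\<close> fixes the image of
  \<open>D\<close>, while it changes a vector only by a multiple of \<open>w\<close>, which \<open>D\<close> does not see.\<close>

lemma reflection_in_kernel:
  assumes D: "D \<in> orth_algebra n" and w: "w \<in> carrier_vec n" "canon_form n w w \<noteq> 0" "D *\<^sub>v w = 0\<^sub>v n"
  obtains R where "R \<in> orth_group n"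
    "\<And>v. v \<in> carrier_vec n \<Longrightarrow> R *\<^sub>v v = v - (2 * canon_form n v w / canon_form n w w) \<cdot>\<^sub>v w"
    "\<And>v. v \<in> carrier_vec n \<Longrightarrow> R *\<^sub>v (D *\<^sub>v v) = D *\<^sub>v (R *\<^sub>v v)"
proof -
  let ?f = "\<lambda>v. v - (2 * canon_form n v w / canon_form n w w) \<cdot>\<^sub>v w"
  note Dc = orth_algebraD(1)[OF D]
  obtain R where R: "R \<in> carrier_mat n n" "\<And>v. v \<in> carrier_vec n \<Longrightarrow> R *\<^sub>v v = ?f v"
  proof (rule linear_map_mat[of n ?f n])
    show "?f (v + v') = ?f v + ?f v'" if "v \<in> carrier_vec n" "v' \<in> carrier_vec n" for v v'
      using that w by (intro eq_vecI) (auto simp: canon_form_add_left add_divide_distrib algebra_simps)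
    show "?f (c \<cdot>\<^sub>v v) = c \<cdot>\<^sub>v ?f v" if "v \<in> carrier_vec n" for c v
      using that w by (intro eq_vecI) (auto simp: canon_form_smult_left algebra_simps)
  qed (use w in auto)
  show thesis
  proof (rule that[of R])
    show "R \<in> orth_group n"
    proof (rule isometry_in_orth_group[OF R(1)])
      fix v v' :: "complex vec" assume v: "v \<in> carrier_vec n" and v': "v' \<in> carrier_vec n"
      have "canon_form n w v' = canon_form n v' w" by (rule canon_form_sym)
      then show "canon_form n (R *\<^sub>v v) (R *\<^sub>v v') = canon_form n v v'"
        using v v' w by (simp add: R(2) canon_form_bilinear field_simps)
    qed
    show "R *\<^sub>v (D *\<^sub>v v) = D *\<^sub>v (R *\<^sub>v v)" if v: "v \<in> carrier_vec n" for v
    proof -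
      have Dv: "D *\<^sub>v v \<in> carrier_vec n" using Dc v by simp
      have "canon_form n (D *\<^sub>v v) w = 0" using orth_algebraD(2)[OF D v w(1)] w v by simp
      moreover have "u - 0 \<cdot>\<^sub>v w = u" if "u \<in> carrier_vec n" for u
        using that w by (intro eq_vecI) auto
      ultimately have "R *\<^sub>v (D *\<^sub>v v) = D *\<^sub>v v" using Dv w by (simp add: R(2))
      moreover have "D *\<^sub>v (R *\<^sub>v v) = D *\<^sub>v v - (2 * canon_form n v w / canon_form n w w) \<cdot>\<^sub>v (D *\<^sub>v w)"
        using Dc v w(1) by (simp add: R(2) mult_minus_distrib_mat_vec[of _ n n] mult_mat_vec[of _ n n])
      moreover have "u - c \<cdot>\<^sub>v 0\<^sub>v n = u" if "u \<in> carrier_vec n" for u :: "complex vec" and c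
        using that by (intro eq_vecI) auto
      ultimately show ?thesis using Dv w by simp
    qed
  qed (rule R(2))
qed

text \<open>The reflection in \<open>a - b\<close> exchanges \<open>a\<close> and \<open>b\<close>. If \<open>a - b\<close> is isotropic, the reflections in \<open>a + b\<close> and
  in \<open>b\<close> do the job together. All three vectors are in the kernel of \<open>D\<close>, and all these reflections
  fix what is orthogonal to \<open>a\<close> and \<open>b\<close>.\<close>

lemma transport_anisotropic_in_kernel:
  assumes D: "D \<in> orth_algebra n"
    and a: "a \<in> carrier_vec n" "D *\<^sub>v a = 0\<^sub>v n" and b: "b \<in> carrier_vec n" "D *\<^sub>v b = 0\<^sub>v n"
    and eq: "canon_form n a a = canon_form n b b" and nz: "canon_form n b b \<noteq> 0"
  obtains T where "T \<in> orth_group n" "T *\<^sub>v a = b"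
    "\<And>v. v \<in> carrier_vec n \<Longrightarrow> canon_form n v a = 0 \<Longrightarrow> canon_form n v b = 0 \<Longrightarrow> T *\<^sub>v v = v"
    "\<And>v. v \<in> carrier_vec n \<Longrightarrow> T *\<^sub>v (D *\<^sub>v v) = D *\<^sub>v (T *\<^sub>v v)"
proof (cases "canon_form n (a - b) (a - b) = 0")
  case False
  have Dab: "D *\<^sub>v (a - b) = 0\<^sub>v n"
    using orth_algebraD(1)[OF D] a b by (simp add: mult_minus_distrib_mat_vec[of _ n n])
  obtain R where R: "R \<in> orth_group n"
    "\<And>v. v \<in> carrier_vec n \<Longrightarrow>
      R *\<^sub>v v = v - (2 * canon_form n v (a - b) / canon_form n (a - b) (a - b)) \<cdot>\<^sub>v (a - b)"
    "\<And>v. v \<in> carrier_vec n \<Longrightarrow> R *\<^sub>v (D *\<^sub>v v) = D *\<^sub>v (R *\<^sub>v v)"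
    using reflection_in_kernel[OF D _ False Dab] a b by (metis minus_carrier_vec)
  have "2 * canon_form n a (a - b) = canon_form n (a - b) (a - b)"
    using a b eq by (simp add: canon_form_bilinear canon_form_sym[of n b a])
  then have "R *\<^sub>v a = b" using a b False by (simp add: R(2)) (auto intro!: eq_vecI)
  moreover have "R *\<^sub>v v = v" if "v \<in> carrier_vec n" "canon_form n v a = 0" "canon_form n v b = 0" for v
    using that a b by (simp add: R(2) canon_form_diff_right) (auto intro!: eq_vecI)
  ultimately show thesis using that R by blast
next
  case True
  have Dab: "D *\<^sub>v (a + b) = 0\<^sub>v n"
    using orth_algebraD(1)[OF D] a b by (simp add: mult_add_distrib_mat_vec[of _ n n])
  \<comment> \<open>by the parallelogram law \<open>a + b\<close> is anisotropic; its reflection sends \<open>a\<close> to \<open>- b\<close>\<close>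
  have sum: "canon_form n (a + b) (a + b) = 4 * canon_form n b b"
    using True a b eq by (simp add: canon_form_bilinear canon_form_sym[of n b a])
  then have nz': "canon_form n (a + b) (a + b) \<noteq> 0" using nz by simp
  obtain R where R: "R \<in> orth_group n"
    "\<And>v. v \<in> carrier_vec n \<Longrightarrow>
      R *\<^sub>v v = v - (2 * canon_form n v (a + b) / canon_form n (a + b) (a + b)) \<cdot>\<^sub>v (a + b)"
    "\<And>v. v \<in> carrier_vec n \<Longrightarrow> R *\<^sub>v (D *\<^sub>v v) = D *\<^sub>v (R *\<^sub>v v)"
    using reflection_in_kernel[OF D _ nz' Dab] a b by (metis add_carrier_vec)
  obtain Q where Q: "Q \<in> orth_group n"
    "\<And>v. v \<in> carrier_vec n \<Longrightarrow> Q *\<^sub>v v = v - (2 * canon_form n v b / canon_form n b b) \<cdot>\<^sub>v b"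
    "\<And>v. v \<in> carrier_vec n \<Longrightarrow> Q *\<^sub>v (D *\<^sub>v v) = D *\<^sub>v (Q *\<^sub>v v)"
    using reflection_in_kernel[OF D b(1) nz b(2)] by metis
  note Rc = orth_groupD(1)[OF R(1)] note Qc = orth_groupD(1)[OF Q(1)]
  have "2 * canon_form n a (a + b) = canon_form n (a + b) (a + b)"
    using a b eq by (simp add: canon_form_bilinear canon_form_sym[of n b a])
  then have "R *\<^sub>v a = - 1 \<cdot>\<^sub>v b" using a b nz' by (simp add: R(2)) (auto intro!: eq_vecI)
  moreover have "Q *\<^sub>v (- 1 \<cdot>\<^sub>v b) = b"
    using b nz by (simp add: Q(2) canon_form_smult_left) (auto intro!: eq_vecI)
  ultimately have "(Q * R) *\<^sub>v a = b" using Rc Qc a by simp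
  moreover have "(Q * R) *\<^sub>v v = v"
    if v: "v \<in> carrier_vec n" "canon_form n v a = 0" "canon_form n v b = 0" for v
  proof -
    have "R *\<^sub>v v = v" using that a b by (simp add: R(2) canon_form_add_right) (auto intro!: eq_vecI)
    moreover have "Q *\<^sub>v v = v" using that b by (simp add: Q(2)) (auto intro!: eq_vecI)
    ultimately show ?thesis using Rc Qc v by simp
  qed
  moreover have "(Q * R) *\<^sub>v (D *\<^sub>v v) = D *\<^sub>v ((Q * R) *\<^sub>v v)" if v: "v \<in> carrier_vec n" for v
    using Rc Qc orth_algebraD(1)[OF D] v R(3)[OF v] Q(3)[of "R *\<^sub>v v"] by simp
  ultimately show thesis using that orth_group_mult[OF Q(1) R(1)] by blast
qed

text \<open>Witt's theorem for hyperbolic pairs, inside the centralizer of \<open>D\<close>. A hyperbolic pair amounts to the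
  orthogonal anisotropic vectors \<open>x + y\<close> and \<open>x - y\<close>, which are moved one after the other; the second
  step fixes \<open>x' + y'\<close> since it only involves vectors orthogonal to it.\<close>

lemma transport_hyperbolic_pair_in_kernel:
  assumes D: "D \<in> orth_algebra n"
    and x: "x \<in> carrier_vec n" "D *\<^sub>v x = 0\<^sub>v n" and y: "y \<in> carrier_vec n" "D *\<^sub>v y = 0\<^sub>v n"
    and x': "x' \<in> carrier_vec n" "D *\<^sub>v x' = 0\<^sub>v n" and y': "y' \<in> carrier_vec n" "D *\<^sub>v y' = 0\<^sub>v n"
    and "canon_form n x x = 0" "canon_form n y y = 0" "canon_form n x y = 1"
    and "canon_form n x' x' = 0" "canon_form n y' y' = 0" "canon_form n x' y' = 1"
  obtains T where "T \<in> orth_group n" "T *\<^sub>v x = x'" "T *\<^sub>v y = y'"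
    "\<And>v. v \<in> carrier_vec n \<Longrightarrow> T *\<^sub>v (D *\<^sub>v v) = D *\<^sub>v (T *\<^sub>v v)"
proof -
  note Dc = orth_algebraD(1)[OF D]
  note form = assms(10-15) canon_form_sym[of n y x] canon_form_sym[of n y' x']
  have add: "D *\<^sub>v (x + y) = 0\<^sub>v n" "D *\<^sub>v (x' + y') = 0\<^sub>v n"
    using Dc x y x' y' by (simp_all add: mult_add_distrib_mat_vec[of _ n n])
  have diff: "D *\<^sub>v (x - y) = 0\<^sub>v n" "D *\<^sub>v (x' - y') = 0\<^sub>v n"
    using Dc x y x' y' by (simp_all add: mult_minus_distrib_mat_vec[of _ n n])
  obtain T where T: "T \<in> orth_group n" "T *\<^sub>v (x + y) = x' + y'"
    "\<And>v. v \<in> carrier_vec n \<Longrightarrow> T *\<^sub>v (D *\<^sub>v v) = D *\<^sub>v (T *\<^sub>v v)"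
  proof (rule transport_anisotropic_in_kernel[OF D _ add(1) _ add(2)])
    show "canon_form n (x + y) (x + y) = canon_form n (x' + y') (x' + y')"
      "canon_form n (x' + y') (x' + y') \<noteq> 0"
      using x y x' y' form by (simp_all add: canon_form_bilinear)
  qed (use x y x' y' in auto)
  note Tc = orth_groupD(1)[OF T(1)]
  define z where "z = T *\<^sub>v (x - y)"
  have z: "z \<in> carrier_vec n" using Tc x y by (simp add: z_def)
  have Dz: "D *\<^sub>v z = 0\<^sub>v n"
    using T(3)[of "x - y"] diff(1) Tc x y by (simp add: z_def mult_mat_zero_vec[of _ n n])
  have "canon_form n (x' + y') z = canon_form n (x + y) (x - y)"
    using orth_groupD(3)[OF T(1), of "x + y" "x - y"] T(2) x y by (simp add: z_def)
  then have orth: "canon_form n (x' + y') z = 0" using x y form by (simp add: canon_form_bilinear)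
  have zz: "canon_form n z z = canon_form n (x - y) (x - y)"
    using orth_groupD(3)[OF T(1), of "x - y" "x - y"] x y by (simp add: z_def)
  obtain W where W: "W \<in> orth_group n" "W *\<^sub>v z = x' - y'" "W *\<^sub>v (x' + y') = x' + y'"
    "\<And>v. v \<in> carrier_vec n \<Longrightarrow> W *\<^sub>v (D *\<^sub>v v) = D *\<^sub>v (W *\<^sub>v v)"
  proof (rule transport_anisotropic_in_kernel[OF D z Dz _ diff(2)])
    show "canon_form n z z = canon_form n (x' - y') (x' - y')" "canon_form n (x' - y') (x' - y') \<noteq> 0"
      using x y x' y' form by (simp_all add: canon_form_bilinear zz)
    have o2: "canon_form n (x' + y') (x' - y') = 0" using x' y' form by (simp add: canon_form_bilinear)
    fix W assume "W \<in> orth_group n" "W *\<^sub>v z = x' - y'"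
      "\<And>v. v \<in> carrier_vec n \<Longrightarrow> canon_form n v z = 0 \<Longrightarrow> canon_form n v (x' - y') = 0 \<Longrightarrow> W *\<^sub>v v = v"
      "\<And>v. v \<in> carrier_vec n \<Longrightarrow> W *\<^sub>v (D *\<^sub>v v) = D *\<^sub>v (W *\<^sub>v v)"
    with orth o2 x' y' show thesis by (intro that[of W]) auto
  qed (use x' y' in auto)
  note Wc = orth_groupD(1)[OF W(1)]
  let ?V = "W * T"
  have V: "?V \<in> carrier_mat n n" using Wc Tc by simp
  have plus: "?V *\<^sub>v (x + y) = x' + y'" using Wc Tc x y T(2) W(3) by simp
  have minus: "?V *\<^sub>v (x - y) = x' - y'" using Wc Tc x y W(2) by (simp add: z_def)
  have half: "a = (1/2) \<cdot>\<^sub>v ((a + b) + (a - b))" "b = (1/2) \<cdot>\<^sub>v ((a + b) - (a - b))"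
    if "a \<in> carrier_vec n" "b \<in> carrier_vec n" for a b :: "complex vec"
    using that by (auto intro!: eq_vecI)
  have lin_add: "?V *\<^sub>v ((1/2) \<cdot>\<^sub>v (s + d)) = (1/2) \<cdot>\<^sub>v (?V *\<^sub>v s + ?V *\<^sub>v d)"
    and lin_diff: "?V *\<^sub>v ((1/2) \<cdot>\<^sub>v (s - d)) = (1/2) \<cdot>\<^sub>v (?V *\<^sub>v s - ?V *\<^sub>v d)"
    if "s \<in> carrier_vec n" "d \<in> carrier_vec n" for s d
    using that V by (simp_all add: mult_mat_vec[of _ n n] mult_add_distrib_mat_vec[of _ n n]
        mult_minus_distrib_mat_vec[of _ n n])
  have "?V *\<^sub>v x = (1/2) \<cdot>\<^sub>v ((x' + y') + (x' - y'))"
    unfolding plus[symmetric] minus[symmetric]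
    by (subst half(1)[OF x(1) y(1)]) (rule lin_add; use x y in simp)
  moreover have "?V *\<^sub>v y = (1/2) \<cdot>\<^sub>v ((x' + y') - (x' - y'))"
    unfolding plus[symmetric] minus[symmetric]
    by (subst half(2)[OF x(1) y(1)]) (rule lin_diff; use x y in simp)
  ultimately have "?V *\<^sub>v x = x'" "?V *\<^sub>v y = y'" using half[OF x'(1) y'(1)] by simp_all
  moreover have "?V *\<^sub>v (D *\<^sub>v v) = D *\<^sub>v (?V *\<^sub>v v)" if v: "v \<in> carrier_vec n" for v
    using Tc Wc Dc v T(3)[OF v] W(4)[of "T *\<^sub>v v"] by simp
  ultimately show thesis using that orth_group_mult[OF W(1) T(1)] by blast
qed

section \<open>The dup number and nilpotency\<close>

(* the dimension n + 2 has to keep this form for the carrier facts about it to apply *)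
declare add_2_eq_Suc [simp del] add_2_eq_Suc' [simp del]

lemma diff_zero_smult_vec [simp]:
  fixes v w :: "complex vec"
  shows "v \<in> carrier_vec n \<Longrightarrow> w \<in> carrier_vec n \<Longrightarrow> v - 0 \<cdot>\<^sub>v w = v"
  by (intro eq_vecI) auto

lemma sum_fun_apply: "(\<Sum>i\<in>A. f i) x = (\<Sum>i\<in>A. f i x)"
  by (induction A rule: infinite_finite_induct) auto

definition coordinate_form :: "nat \<Rightarrow> nat \<Rightarrow> complex vec \<Rightarrow> complex" where
  "coordinate_form m j = (\<lambda>v. if v \<in> carrier_vec m then v $ j else 0)"

lemma dual_space_finitely_spanned:
  "dual_space m \<subseteq> Modules.module.span fun_scale (coordinate_form m ` {..<m})"
proof
  interpret fv: vector_space "fun_scale :: complex \<Rightarrow> (complex vec \<Rightarrow> complex) \<Rightarrow> _"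
    by (rule vector_space_fun_scale)
  fix \<alpha> assume \<alpha>: "\<alpha> \<in> dual_space m"
  obtain x where x: "\<And>v. v \<in> carrier_vec m \<Longrightarrow> \<alpha> v = canon_form m x v"
  proof (rule linear_form_repr[of m \<alpha>])
    show "\<alpha> (v + w) = \<alpha> v + \<alpha> w" if "v \<in> carrier_vec m" "w \<in> carrier_vec m" for v w
      using \<alpha> that unfolding dual_space_def by blast
    show "\<alpha> (c \<cdot>\<^sub>v v) = c * \<alpha> v" if "v \<in> carrier_vec m" for c v
      using \<alpha> that unfolding dual_space_def by blast
  qed blast
  have \<alpha>0: "\<alpha> v = 0" if "v \<notin> carrier_vec m" for v using \<alpha> that unfolding dual_space_def by blast
  have "\<alpha> = (\<Sum>i<m. fun_scale (x $ i) (coordinate_form m (form_partner m i)))"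
  proof
    fix v show "\<alpha> v = (\<Sum>i<m. fun_scale (x $ i) (coordinate_form m (form_partner m i))) v"
      using x[of v] \<alpha>0[of v]
      by (cases "v \<in> carrier_vec m") (simp_all add: sum_fun_apply fun_scale_def coordinate_form_def canon_form_partner)
  qed
  also have "\<dots> \<in> fv.span (coordinate_form m ` {..<m})"
    by (intro fv.span_sum fv.span_scale fv.span_base) (auto simp: form_partner_less)
  finally show "\<alpha> \<in> fv.span (coordinate_form m ` {..<m})" .
qed

text \<open>A dimension is by convention \<open>0\<close> in the absence of a finite basis. That a non-zero form makes the
  dup number positive therefore depends on the dual space being finitely spanned.\<close>

lemma dup_pos_iff: "dup m br \<ge> 1 \<longleftrightarrow> (\<exists>\<alpha>\<in>wedge_annihilator m br. \<exists>v\<in>carrier_vec m. \<alpha> v \<noteq> 0)"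
proof -
  interpret fv: vector_space "fun_scale :: complex \<Rightarrow> (complex vec \<Rightarrow> complex) \<Rightarrow> _"
    by (rule vector_space_fun_scale)
  obtain B where B: "B \<subseteq> wedge_annihilator m br" "fv.independent B" "wedge_annihilator m br \<subseteq> fv.span B"
    using fv.maximal_independent_subset by blast
  have dup: "dup m br = card B"
    unfolding dup_def by (rule fv.dim_unique[OF B(1,3,2) refl])
  have sub: "wedge_annihilator m br \<subseteq> dual_space m" by (auto simp: wedge_annihilator_def)
  have fin: "finite B"
    using fv.independent_span_bound[OF _ B(2), of "coordinate_form m ` {..<m}"] B(1) sub
      dual_space_finitely_spanned[of m] by blast
  have nonzero: "(\<exists>v\<in>carrier_vec m. \<alpha> v \<noteq> 0) \<longleftrightarrow> \<alpha> \<noteq> 0" if "\<alpha> \<in> wedge_annihilator m br" for \<alpha>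
  proof -
    have "\<forall>v. v \<notin> carrier_vec m \<longrightarrow> \<alpha> v = 0" using that sub unfolding dual_space_def by blast
    then show ?thesis by (auto simp: fun_eq_iff)
  qed
  show ?thesis
  proof
    assume "dup m br \<ge> 1"
    then obtain \<alpha> where "\<alpha> \<in> B" using dup by (metis all_not_in_conv card.empty not_one_le_zero)
    then show "\<exists>\<alpha>\<in>wedge_annihilator m br. \<exists>v\<in>carrier_vec m. \<alpha> v \<noteq> 0"
      using B(1,2) fv.dependent_zero nonzero by blast
  next
    assume "\<exists>\<alpha>\<in>wedge_annihilator m br. \<exists>v\<in>carrier_vec m. \<alpha> v \<noteq> 0"
    then obtain \<alpha> where \<alpha>: "\<alpha> \<in> wedge_annihilator m br" "\<alpha> \<noteq> 0" using nonzero by blast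
    then have "B \<noteq> {}" using B(3) by auto
    then show "dup m br \<ge> 1" using dup fin by (metis One_nat_def Suc_leI card_gt_0_iff)
  qed
qed

lemma bracket_in_lower_central:
  assumes br: "\<And>X Y. X \<in> carrier_vec m \<Longrightarrow> Y \<in> carrier_vec m \<Longrightarrow> br X Y \<in> carrier_vec m"
    and X: "X \<in> carrier_vec m" and Y: "Y \<in> lower_central m br k"
  shows "br X Y \<in> lower_central m br (Suc k)"
proof -
  interpret vec_space "TYPE(complex)" m .
  have "lower_central m br j \<subseteq> carrier_vec m" for j
  proof (induction j)
    case (Suc j)
    then show ?case using br by (simp, intro span_is_subset2) auto
  qed simp
  then have "{br X Y | X Y. X \<in> carrier_vec m \<and> Y \<in> lower_central m br k} \<subseteq> carrier_vec m"
    using br by blast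
  from in_own_span[OF this] show ?thesis using X Y by auto
qed

lemma lower_central_Suc_subset:
  assumes W: "W \<subseteq> carrier_vec m" "0\<^sub>v m \<in> W" "\<And>v w. v \<in> W \<Longrightarrow> w \<in> W \<Longrightarrow> v + w \<in> W"
    "\<And>c v. v \<in> W \<Longrightarrow> c \<cdot>\<^sub>v v \<in> W"
    and br: "\<And>X Y. X \<in> carrier_vec m \<Longrightarrow> Y \<in> lower_central m br k \<Longrightarrow> br X Y \<in> W"
  shows "lower_central m br (Suc k) \<subseteq> W"
proof -
  interpret vec_space "TYPE(complex)" m .
  have "submodule class_ring W V"
    by unfold_locales (use W in auto)
  then show ?thesis unfolding lower_central.simps by (intro span_is_subset) (use br in auto)
qed

lemma zero_in_lower_central: "0\<^sub>v m \<in> lower_central m br k"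
proof (cases k)
  case (Suc j)
  interpret vec_space "TYPE(complex)" m .
  show ?thesis unfolding Suc lower_central.simps by (rule span_zero)
qed simp

text \<open>A fixed vector of some \<open>ad Z\<close> belongs to every term of the lower central series.\<close>

lemma nilpotent_no_eigenvector:
  assumes br: "\<And>X Y. X \<in> carrier_vec m \<Longrightarrow> Y \<in> carrier_vec m \<Longrightarrow> br X Y \<in> carrier_vec m"
    and nil: "nilpotent_bracket m br"
    and Z: "Z \<in> carrier_vec m" and v: "v \<in> carrier_vec m" and fixed: "br Z v = v"
  shows "v = 0\<^sub>v m"
proof -
  have "v \<in> lower_central m br k" for k
  proof (induction k)
    case (Suc k)
    then show ?case using bracket_in_lower_central[of m br Z v k] br Z fixed by simp
  qed (use v in simp)
  then show ?thesis using nil unfolding nilpotent_bracket_def by blast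
qed

lemma pow_mat_act:
  fixes C :: "complex mat"
  assumes C: "C \<in> carrier_mat n n" and v: "v \<in> carrier_vec n"
  shows "C ^\<^sub>m k *\<^sub>v v = ((*\<^sub>v) C ^^ k) v"
  using v
proof (induction k arbitrary: v)
  case (Suc k)
  have "C ^\<^sub>m k \<in> carrier_mat n n" using C by simp
  then show ?case using Suc C by (simp add: funpow_swap1 assoc_mult_mat_vec[of _ n n _ n])
qed (use C in simp)

section \<open>Double extensions\<close>

context
  fixes n :: nat and \<phi> :: "dext_vec \<Rightarrow> complex vec"
  assumes \<phi>: "dext_isometry n \<phi>"
begin

lemma dext_closed [simp]: "X \<in> carrier_vec n \<Longrightarrow> \<phi> (l, \<mu>, X) \<in> carrier_vec (n + 2)"
  using \<phi> unfolding dext_isometry_def dext_carrier_def by (auto dest: bij_betwE)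

lemma dext_surj:
  assumes "v \<in> carrier_vec (n + 2)"
  obtains l \<mu> X where "X \<in> carrier_vec n" "v = \<phi> (l, \<mu>, X)"
proof -
  have "\<phi> ` dext_carrier n = carrier_vec (n + 2)" using \<phi> unfolding dext_isometry_def bij_betw_def by blast
  then obtain u where "u \<in> dext_carrier n" "v = \<phi> u" using assms by blast
  then show thesis using that by (cases u) (auto simp: dext_carrier_def)
qed

lemma dext_eq_iff:
  assumes "X \<in> carrier_vec n" "Y \<in> carrier_vec n"
  shows "\<phi> (l, \<mu>, X) = \<phi> (l', \<mu>', Y) \<longleftrightarrow> l = l' \<and> \<mu> = \<mu>' \<and> X = Y"
proof -
  have "inj_on \<phi> (dext_carrier n)" using \<phi> by (simp add: dext_isometry_def bij_betw_def)
  then show ?thesis using assms by (auto simp: dext_carrier_def inj_on_eq_iff)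
qed

lemma dext_plus:
  assumes "X \<in> carrier_vec n" "Y \<in> carrier_vec n"
  shows "\<phi> (l, \<mu>, X) + \<phi> (l', \<mu>', Y) = \<phi> (l + l', \<mu> + \<mu>', X + Y)"
  using \<phi> assms unfolding dext_isometry_def dext_carrier_def by force

lemma dext_smult:
  assumes "X \<in> carrier_vec n"
  shows "c \<cdot>\<^sub>v \<phi> (l, \<mu>, X) = \<phi> (c * l, c * \<mu>, c \<cdot>\<^sub>v X)"
  using \<phi> assms unfolding dext_isometry_def dext_carrier_def by force

lemma dext_canon_form:
  assumes "X \<in> carrier_vec n" "Y \<in> carrier_vec n"
  shows "canon_form (n + 2) (\<phi> (l, \<mu>, X)) (\<phi> (l', \<mu>', Y)) = l * \<mu>' + \<mu> * l' + canon_form n X Y"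
  using \<phi> assms unfolding dext_isometry_def dext_carrier_def by force

lemma dext_minus:
  assumes "X \<in> carrier_vec n" "Y \<in> carrier_vec n"
  shows "\<phi> (l, \<mu>, X) - \<phi> (l', \<mu>', Y) = \<phi> (l - l', \<mu> - \<mu>', X - Y)"
proof -
  have neg: "v - w = v + (- 1) \<cdot>\<^sub>v w" if "v \<in> carrier_vec k" "w \<in> carrier_vec k" for v w :: "complex vec" and k
    using that by (intro eq_vecI) auto
  show ?thesis
    using assms by (simp add: neg[of _ "n + 2"] dext_smult dext_plus) (simp add: neg[of _ n])
qed

lemma dext_zero: "\<phi> (0, 0, 0\<^sub>v n) = 0\<^sub>v (n + 2)"
proof -
  have "0 \<cdot>\<^sub>v 0\<^sub>v n = (0\<^sub>v n :: complex vec)" by (intro eq_vecI) auto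
  then have "0 \<cdot>\<^sub>v \<phi> (0, 0, 0\<^sub>v n) = \<phi> (0, 0, 0\<^sub>v n)" by (simp add: dext_smult)
  moreover have "0 \<cdot>\<^sub>v v = 0\<^sub>v (n + 2)" if "v \<in> carrier_vec (n + 2)" for v :: "complex vec"
    using that by (intro eq_vecI) auto
  ultimately show ?thesis by simp
qed

lemma dext_inv: "X \<in> carrier_vec n \<Longrightarrow> inv_into (dext_carrier n) \<phi> (\<phi> (l, \<mu>, X)) = (l, \<mu>, X)"
  using \<phi> unfolding dext_isometry_def by (intro inv_into_f_f) (auto simp: bij_betw_def dext_carrier_def)

lemma double_extension_apply:
  assumes "X \<in> carrier_vec n" "Y \<in> carrier_vec n"
  shows "double_extension n \<phi> C (\<phi> (l, \<mu>, X)) (\<phi> (l', \<mu>', Y))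
    = \<phi> (canon_form n (C *\<^sub>v X) Y, 0, \<mu> \<cdot>\<^sub>v (C *\<^sub>v Y) - \<mu>' \<cdot>\<^sub>v (C *\<^sub>v X))"
  using assms by (simp add: double_extension_def dext_inv)

lemma double_extension_closed:
  assumes C: "C \<in> carrier_mat n n" and "u \<in> carrier_vec (n + 2)" "v \<in> carrier_vec (n + 2)"
  shows "double_extension n \<phi> C u v \<in> carrier_vec (n + 2)"
proof -
  obtain l \<mu> X where X: "X \<in> carrier_vec n" "u = \<phi> (l, \<mu>, X)" using dext_surj[OF assms(2)] .
  obtain l' \<mu>' Y where Y: "Y \<in> carrier_vec n" "v = \<phi> (l', \<mu>', Y)" using dext_surj[OF assms(3)] .
  show ?thesis using X Y C by (simp add: double_extension_apply)
qed

lemma double_extension_quadratic: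
  assumes C: "C \<in> orth_algebra n"
  shows "double_extension n \<phi> C \<in> quadratic_structures (n + 2)"
proof -
  let ?g = "double_extension n \<phi> C"
  note Cc = orth_algebraD(1)[OF C]
  have Cv: "C *\<^sub>v X \<in> carrier_vec n" if "X \<in> carrier_vec n" for X using Cc that by simp
  have skew: "canon_form n (C *\<^sub>v X) Y = - canon_form n (C *\<^sub>v Y) X"
    if "X \<in> carrier_vec n" "Y \<in> carrier_vec n" for X Y
    using orth_algebraD(2)[OF C that] by (simp add: canon_form_sym)
  have skew0: "canon_form n (C *\<^sub>v X) X = 0" if "X \<in> carrier_vec n" for X
    using skew[OF that that] by simp
  note lin = mult_add_distrib_mat_vec[OF Cc] mult_mat_vec[OF Cc] mult_minus_distrib_mat_vec[OF Cc]
  note simps = double_extension_apply dext_plus dext_smult dext_eq_iff dext_canon_form lin Cv canon_form_bilinear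
  have "?g (u + v) w = ?g u w + ?g v w \<and> ?g w (u + v) = ?g w u + ?g w v \<and>
      ?g (c \<cdot>\<^sub>v u) w = c \<cdot>\<^sub>v ?g u w \<and> ?g w (c \<cdot>\<^sub>v u) = c \<cdot>\<^sub>v ?g w u"
    if u: "u \<in> carrier_vec (n + 2)" and v: "v \<in> carrier_vec (n + 2)" and w: "w \<in> carrier_vec (n + 2)"
    for u v w c
  proof -
    obtain l1 m1 X where X: "X \<in> carrier_vec n" "u = \<phi> (l1, m1, X)" using dext_surj[OF u] .
    obtain l2 m2 Y where Y: "Y \<in> carrier_vec n" "v = \<phi> (l2, m2, Y)" using dext_surj[OF v] .
    obtain l3 m3 Z where Z: "Z \<in> carrier_vec n" "w = \<phi> (l3, m3, Z)" using dext_surj[OF w] .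
    show ?thesis using X(1) Y(1) Z(1) Cv[OF X(1)] Cv[OF Y(1)] Cv[OF Z(1)] unfolding X(2) Y(2) Z(2)
      by (simp add: simps) (auto intro!: eq_vecI simp: algebra_simps)
  qed
  moreover have "?g u u = 0\<^sub>v (n + 2)" if u: "u \<in> carrier_vec (n + 2)" for u
  proof -
    obtain l m X where X: "X \<in> carrier_vec n" "u = \<phi> (l, m, X)" using dext_surj[OF u] .
    have "v - v = 0\<^sub>v n" if "v \<in> carrier_vec n" for v :: "complex vec" using that by auto
    then show ?thesis using X(1) Cv[OF X(1)] unfolding X(2)
      by (simp add: double_extension_apply skew0 dext_zero)
  qed
  moreover have "?g u (?g v w) + ?g v (?g w u) + ?g w (?g u v) = 0\<^sub>v (n + 2)"
    if u: "u \<in> carrier_vec (n + 2)" and v: "v \<in> carrier_vec (n + 2)" and w: "w \<in> carrier_vec (n + 2)"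
    for u v w
  proof -
    obtain l1 m1 X where X: "X \<in> carrier_vec n" "u = \<phi> (l1, m1, X)" using dext_surj[OF u] .
    obtain l2 m2 Y where Y: "Y \<in> carrier_vec n" "v = \<phi> (l2, m2, Y)" using dext_surj[OF v] .
    obtain l3 m3 Z where Z: "Z \<in> carrier_vec n" "w = \<phi> (l3, m3, Z)" using dext_surj[OF w] .
    have C2: "C *\<^sub>v (C *\<^sub>v T) \<in> carrier_vec n" if "T \<in> carrier_vec n" for T using Cv that by simp
    have sym: "canon_form n (C *\<^sub>v Y) (C *\<^sub>v X) = canon_form n (C *\<^sub>v X) (C *\<^sub>v Y)"
      "canon_form n (C *\<^sub>v Z) (C *\<^sub>v X) = canon_form n (C *\<^sub>v X) (C *\<^sub>v Z)"
      "canon_form n (C *\<^sub>v Z) (C *\<^sub>v Y) = canon_form n (C *\<^sub>v Y) (C *\<^sub>v Z)" by (rule canon_form_sym)+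
    have cyc: "a \<cdot>\<^sub>v (b \<cdot>\<^sub>v z - c \<cdot>\<^sub>v y) - 0 \<cdot>\<^sub>v x' + (b \<cdot>\<^sub>v (c \<cdot>\<^sub>v x - a \<cdot>\<^sub>v z) - 0 \<cdot>\<^sub>v y')
        + (c \<cdot>\<^sub>v (a \<cdot>\<^sub>v y - b \<cdot>\<^sub>v x) - 0 \<cdot>\<^sub>v z') = 0\<^sub>v n"
      if "x \<in> carrier_vec n" "y \<in> carrier_vec n" "z \<in> carrier_vec n"
        "x' \<in> carrier_vec n" "y' \<in> carrier_vec n" "z' \<in> carrier_vec n"
      for x y z x' y' z' :: "complex vec" and a b c
      using that by (intro eq_vecI) (auto simp: algebra_simps)
    have "?g u (?g v w) + ?g v (?g w u) + ?g w (?g u v) = \<phi> (0, 0, 0\<^sub>v n)"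
      using X(1) Y(1) Z(1) Cv[OF X(1)] Cv[OF Y(1)] Cv[OF Z(1)] C2[OF X(1)] C2[OF Y(1)] C2[OF Z(1)]
      unfolding X(2) Y(2) Z(2)
      by (simp add: simps sym algebra_simps) (rule cyc; simp add: Cv)
    then show ?thesis by (simp add: dext_zero)
  qed
  moreover have "canon_form (n + 2) (?g u v) w = canon_form (n + 2) u (?g v w)"
    if u: "u \<in> carrier_vec (n + 2)" and v: "v \<in> carrier_vec (n + 2)" and w: "w \<in> carrier_vec (n + 2)"
    for u v w
  proof -
    obtain l1 m1 X where X: "X \<in> carrier_vec n" "u = \<phi> (l1, m1, X)" using dext_surj[OF u] .
    obtain l2 m2 Y where Y: "Y \<in> carrier_vec n" "v = \<phi> (l2, m2, Y)" using dext_surj[OF v] .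
    obtain l3 m3 Z where Z: "Z \<in> carrier_vec n" "w = \<phi> (l3, m3, Z)" using dext_surj[OF w] .
    show ?thesis
      using X(1) Y(1) Z(1) Cv[OF X(1)] Cv[OF Y(1)] Cv[OF Z(1)] skew[OF X(1) Y(1)] skew[OF X(1) Z(1)]
        skew[OF Y(1) Z(1)] canon_form_sym[of n X "C *\<^sub>v Y"] canon_form_sym[of n X "C *\<^sub>v Z"]
      unfolding X(2) Y(2) Z(2) by (simp add: simps algebra_simps)
  qed
  moreover have "?g \<in> carrier_vec (n + 2) \<rightarrow>\<^sub>E (carrier_vec (n + 2) \<rightarrow>\<^sub>E carrier_vec (n + 2))"
    using double_extension_closed[OF Cc] by (auto simp: double_extension_def)
  ultimately show ?thesis unfolding quadratic_structures_def lie_structures_def by blast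
qed

text \<open>From the first step on, the \<open>k\<close>-th term of the lower central series is contained in the sum of the
  line of \<open>X\<^sub>1\<close> and the image of \<open>C\<^sup>k\<close>. Once \<open>C\<^sup>k = 0\<close>, only that central line is left.\<close>

lemma double_extension_nilpotent:
  assumes C: "C \<in> carrier_mat n n" and nil: "C ^\<^sub>m k = 0\<^sub>m n n"
  shows "nilpotent_bracket (n + 2) (double_extension n \<phi> C)"
proof -
  let ?g = "double_extension n \<phi> C" and ?f = "\<lambda>k. (*\<^sub>v) C ^^ k"
  let ?W = "\<lambda>k. {\<phi> (l, 0, C ^\<^sub>m k *\<^sub>v X) | l X. X \<in> carrier_vec n}"
  have Ck: "C ^\<^sub>m k \<in> carrier_mat n n" for k using C by simp
  note closed = mult_mat_vec_carrier[OF Ck] mult_mat_vec_carrier[OF C]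
  note lin = mult_add_distrib_mat_vec[OF Ck] mult_mat_vec[OF Ck]
  have CCk: "C *\<^sub>v (C ^\<^sub>m k *\<^sub>v X) = C ^\<^sub>m Suc k *\<^sub>v X" if "X \<in> carrier_vec n" for k X
    using that C by (simp add: pow_mat_act[OF C] del: pow_mat.simps)
  have W: "?W k \<subseteq> carrier_vec (n + 2)" "0\<^sub>v (n + 2) \<in> ?W k" for k
  proof -
    show "?W k \<subseteq> carrier_vec (n + 2)" by (auto simp: closed)
    have "0\<^sub>v (n + 2) = \<phi> (0, 0, C ^\<^sub>m k *\<^sub>v 0\<^sub>v n)" by (simp add: mult_mat_zero_vec[OF Ck] dext_zero)
    then show "0\<^sub>v (n + 2) \<in> ?W k" by (blast intro: zero_carrier_vec)
  qed
  have W_add: "v + w \<in> ?W k" if vw: "v \<in> ?W k" "w \<in> ?W k" for v w k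
  proof -
    obtain l X l' Y where "X \<in> carrier_vec n" "v = \<phi> (l, 0, C ^\<^sub>m k *\<^sub>v X)"
      "Y \<in> carrier_vec n" "w = \<phi> (l', 0, C ^\<^sub>m k *\<^sub>v Y)" using vw by blast
    then have "v + w = \<phi> (l + l', 0, C ^\<^sub>m k *\<^sub>v (X + Y))" "X + Y \<in> carrier_vec n"
      by (simp_all add: dext_plus closed lin)
    then show ?thesis by blast
  qed
  have W_smult: "c \<cdot>\<^sub>v v \<in> ?W k" if v: "v \<in> ?W k" for c v k
  proof -
    obtain l X where "X \<in> carrier_vec n" "v = \<phi> (l, 0, C ^\<^sub>m k *\<^sub>v X)" using v by blast
    then have "c \<cdot>\<^sub>v v = \<phi> (c * l, 0, C ^\<^sub>m k *\<^sub>v (c \<cdot>\<^sub>v X))" "c \<cdot>\<^sub>v X \<in> carrier_vec n"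
      by (simp_all add: dext_smult closed lin)
    then show ?thesis by blast
  qed
  have bracket: "?g u (\<phi> (l, 0, C ^\<^sub>m k *\<^sub>v Y)) \<in> ?W (Suc k)"
    if u: "u \<in> carrier_vec (n + 2)" and Y: "Y \<in> carrier_vec n" for u l k Y
  proof -
    obtain l' \<mu> X where X: "X \<in> carrier_vec n" "u = \<phi> (l', \<mu>, X)" using dext_surj[OF u] .
    have "?g u (\<phi> (l, 0, C ^\<^sub>m k *\<^sub>v Y))
        = \<phi> (canon_form n (C *\<^sub>v X) (C ^\<^sub>m k *\<^sub>v Y), 0, C ^\<^sub>m Suc k *\<^sub>v (\<mu> \<cdot>\<^sub>v Y))"
      using X Y closed
      by (simp add: double_extension_apply CCk mult_mat_vec[OF Ck[of "Suc k"]] del: pow_mat.simps)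
        (auto intro!: arg_cong[of _ _ \<phi>] eq_vecI)
    moreover have "\<mu> \<cdot>\<^sub>v Y \<in> carrier_vec n" using Y by simp
    ultimately show ?thesis by blast
  qed
  have "lower_central (n + 2) ?g (Suc j) \<subseteq> ?W (Suc j)" for j
  proof (induction j)
    case 0
    have "?g u v \<in> ?W (Suc 0)" if u: "u \<in> carrier_vec (n + 2)" and v: "v \<in> carrier_vec (n + 2)" for u v
    proof -
      obtain l \<mu> X where X: "X \<in> carrier_vec n" "u = \<phi> (l, \<mu>, X)" using dext_surj[OF u] .
      obtain l' \<mu>' Y where Y: "Y \<in> carrier_vec n" "v = \<phi> (l', \<mu>', Y)" using dext_surj[OF v] .
      have "?g u v = \<phi> (canon_form n (C *\<^sub>v X) Y, 0, C ^\<^sub>m Suc 0 *\<^sub>v (\<mu> \<cdot>\<^sub>v Y - \<mu>' \<cdot>\<^sub>v X))"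
        using X Y C by (simp add: double_extension_apply mult_minus_distrib_mat_vec[OF C] mult_mat_vec[OF C])
      moreover have "\<mu> \<cdot>\<^sub>v Y - \<mu>' \<cdot>\<^sub>v X \<in> carrier_vec n" using X Y by simp
      ultimately show ?thesis by blast
    qed
    then show ?case by (intro lower_central_Suc_subset W W_add W_smult) auto
  next
    case (Suc j)
    have "?g u v \<in> ?W (Suc (Suc j))"
      if u: "u \<in> carrier_vec (n + 2)" and v: "v \<in> lower_central (n + 2) ?g (Suc j)" for u v
    proof -
      obtain l Y where "Y \<in> carrier_vec n" "v = \<phi> (l, 0, C ^\<^sub>m Suc j *\<^sub>v Y)" using Suc v by blast
      then show ?thesis using bracket[OF u, of Y l "Suc j"] by simp
    qed
    then show ?case by (intro lower_central_Suc_subset W W_add W_smult) auto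
  qed
  then have sub: "lower_central (n + 2) ?g (Suc k) \<subseteq> ?W (Suc k)" .
  have zero: "C ^\<^sub>m Suc k *\<^sub>v X = 0\<^sub>v n" if "X \<in> carrier_vec n" for X
    using that C nil by (simp add: closed) (auto intro!: eq_vecI)
  have "lower_central (n + 2) ?g (Suc k) \<subseteq> {\<phi> (l, 0, 0\<^sub>v n) | l. True}"
  proof
    fix w assume "w \<in> lower_central (n + 2) ?g (Suc k)"
    then obtain l X where "X \<in> carrier_vec n" "w = \<phi> (l, 0, C ^\<^sub>m Suc k *\<^sub>v X)" using sub by blast
    then have "w = \<phi> (l, 0, 0\<^sub>v n)" by (simp only: zero)
    then show "w \<in> {\<phi> (l, 0, 0\<^sub>v n) | l. True}" by blast
  qed
  moreover have "?g u (\<phi> (l, 0, 0\<^sub>v n)) = 0\<^sub>v (n + 2)" if u: "u \<in> carrier_vec (n + 2)" for u l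
  proof -
    obtain l' \<mu> X where X: "X \<in> carrier_vec n" "u = \<phi> (l', \<mu>, X)" using dext_surj[OF u] .
    have "\<mu> \<cdot>\<^sub>v 0\<^sub>v n - 0 \<cdot>\<^sub>v (C *\<^sub>v X) = 0\<^sub>v n" using X C by (intro eq_vecI) auto
    then show ?thesis
      using X closed by (simp add: double_extension_apply mult_mat_zero_vec[OF C] dext_zero)
  qed
  ultimately have "lower_central (n + 2) ?g (Suc (Suc k)) \<subseteq> {0\<^sub>v (n + 2)}"
    by (intro lower_central_Suc_subset) auto
  then have "lower_central (n + 2) ?g (Suc (Suc k)) = {0\<^sub>v (n + 2)}"
    using zero_in_lower_central by blast
  then show ?thesis unfolding nilpotent_bracket_def by blast
qed

text \<open>The \<open>Y\<^sub>1\<close>-coordinate, which is the form dual to \<open>X\<^sub>1\<close>, divides \<open>I\<close>: each term of \<open>I\<close> is the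
  \<open>Y\<^sub>1\<close>-coordinate of one argument times the value of the form \<open>B(C -, -)\<close> on the other two.\<close>

lemma double_extension_singular:
  assumes C: "C \<in> orth_algebra n" and nz: "C \<noteq> 0\<^sub>m n n"
  shows "singular (n + 2) (double_extension n \<phi> C)"
proof -
  let ?g = "double_extension n \<phi> C"
  note Cc = orth_algebraD(1)[OF C]
  have Cv: "C *\<^sub>v X \<in> carrier_vec n" if "X \<in> carrier_vec n" for X using Cc that by simp
  obtain X where X: "X \<in> carrier_vec n" "C *\<^sub>v X \<noteq> 0\<^sub>m n n *\<^sub>v X"
    using mat_eq_if_same_action[OF Cc zero_carrier_mat] nz by blast
  have "0\<^sub>m n n *\<^sub>v X = 0\<^sub>v n" using X(1) by (intro eq_vecI) auto
  then have CX: "C *\<^sub>v X \<noteq> 0\<^sub>v n" using X by simp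
  have z: "1 \<cdot>\<^sub>v (C *\<^sub>v X) - 0 \<cdot>\<^sub>v (C *\<^sub>v 0\<^sub>v n) = C *\<^sub>v X"
    using Cv[OF X(1)] by (simp add: mult_mat_zero_vec[OF Cc])
  have "?g (\<phi> (0, 1, 0\<^sub>v n)) (\<phi> (0, 0, X)) = \<phi> (0, 0, C *\<^sub>v X)"
    using X(1) z by (simp add: double_extension_apply mult_mat_zero_vec[OF Cc])
  also have "\<dots> \<noteq> 0\<^sub>v (n + 2)" unfolding dext_zero[symmetric] using CX Cv X by (simp add: dext_eq_iff)
  finally have "\<not> abelian (n + 2) ?g" unfolding abelian_def using X(1)
    by (metis dext_closed zero_carrier_vec)
  moreover have "dup (n + 2) ?g \<ge> 1"
  proof -
    let ?x = "\<phi> (1, 0, 0\<^sub>v n)"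
    define \<alpha> where "\<alpha> v = (if v \<in> carrier_vec (n + 2) then canon_form (n + 2) ?x v else 0)" for v
    have "\<alpha> \<in> dual_space (n + 2)"
      by (auto simp: dual_space_def \<alpha>_def canon_form_bilinear)
    have \<alpha>: "\<alpha> (\<phi> (l, \<mu>, X)) = \<mu>" if "X \<in> carrier_vec n" for l \<mu> X
      using that by (simp add: \<alpha>_def dext_canon_form)
    have I: "assoc_form (n + 2) ?g (\<phi> (l1, m1, X)) (\<phi> (l2, m2, Y)) (\<phi> (l3, m3, Z))
        = canon_form n (C *\<^sub>v X) Y * m3 + m1 * canon_form n (C *\<^sub>v Y) Z - m2 * canon_form n (C *\<^sub>v X) Z"
      if "X \<in> carrier_vec n" "Y \<in> carrier_vec n" "Z \<in> carrier_vec n" for l1 m1 X l2 m2 Y l3 m3 Z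
      using that Cv by (simp add: assoc_form_def double_extension_apply dext_canon_form canon_form_bilinear)
    have skew: "canon_form n (C *\<^sub>v X) Y = - canon_form n (C *\<^sub>v Y) X"
      if "X \<in> carrier_vec n" "Y \<in> carrier_vec n" for X Y
      using orth_algebraD(2)[OF C that] by (simp add: canon_form_sym)
    have "wedge_1_3 \<alpha> (assoc_form (n + 2) ?g) u v w t = 0"
      if u: "u \<in> carrier_vec (n + 2)" and v: "v \<in> carrier_vec (n + 2)"
        and w: "w \<in> carrier_vec (n + 2)" and t: "t \<in> carrier_vec (n + 2)"
      for u v w t
    proof -
      obtain l1 m1 X where X: "X \<in> carrier_vec n" "u = \<phi> (l1, m1, X)" using dext_surj[OF u] .
      obtain l2 m2 Y where Y: "Y \<in> carrier_vec n" "v = \<phi> (l2, m2, Y)" using dext_surj[OF v] .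
      obtain l3 m3 Z where Z: "Z \<in> carrier_vec n" "w = \<phi> (l3, m3, Z)" using dext_surj[OF w] .
      obtain l4 m4 T where T: "T \<in> carrier_vec n" "t = \<phi> (l4, m4, T)" using dext_surj[OF t] .
      show ?thesis
        using X(1) Y(1) Z(1) T(1) unfolding X(2) Y(2) Z(2) T(2) wedge_1_3_def
        by (simp add: I \<alpha> algebra_simps)
    qed
    then have "\<alpha> \<in> wedge_annihilator (n + 2) ?g"
      unfolding wedge_annihilator_def using \<open>\<alpha> \<in> dual_space (n + 2)\<close> by blast
    moreover have "\<alpha> (\<phi> (0, 1, 0\<^sub>v n)) \<noteq> 0" by (simp add: \<alpha>)
    moreover have "\<phi> (0, 1, 0\<^sub>v n) \<in> carrier_vec (n + 2)" by simp
    ultimately show ?thesis unfolding dup_pos_iff by blast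
  qed
  ultimately show ?thesis by (simp add: singular_def)
qed

theorem double_extension_nilpotent_singular:
  assumes "C \<in> nonzero_nilpotents n"
  shows "double_extension n \<phi> C \<in> nilpotent_singular (n + 2)"
proof -
  obtain k where "C \<in> orth_algebra n" "C \<in> carrier_mat n n" "C \<noteq> 0\<^sub>m n n" "C ^\<^sub>m k = 0\<^sub>m n n"
    using nonzero_nilpotentsD[OF assms] by blast
  then show ?thesis
    unfolding nilpotent_singular_def
    using double_extension_quadratic double_extension_nilpotent double_extension_singular by blast
qed

end

section \<open>Isomorphisms between double extensions\<close>

lemma dext_linear_mat:
  assumes \<phi>: "dext_isometry n \<phi>" and \<phi>': "dext_isometry n \<phi>'"
    and T: "\<And>u. u \<in> dext_carrier n \<Longrightarrow> T u \<in> dext_carrier n"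
    and T_add: "\<And>u v. u \<in> dext_carrier n \<Longrightarrow> v \<in> dext_carrier n \<Longrightarrow> T (dext_add u v) = dext_add (T u) (T v)"
    and T_scale: "\<And>c u. u \<in> dext_carrier n \<Longrightarrow> T (dext_scale c u) = dext_scale c (T u)"
  obtains A where "A \<in> carrier_mat (n + 2) (n + 2)"
    "\<And>l \<mu> X. X \<in> carrier_vec n \<Longrightarrow> A *\<^sub>v \<phi> (l, \<mu>, X) = \<phi>' (T (l, \<mu>, X))"
proof -
  let ?f = "\<lambda>v. \<phi>' (T (inv_into (dext_carrier n) \<phi> v))"
  have f: "?f (\<phi> (l, \<mu>, X)) = \<phi>' (T (l, \<mu>, X))" if "X \<in> carrier_vec n" for l \<mu> X
    using that by (simp add: dext_inv[OF \<phi>])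
  have mem: "(l, \<mu>, X) \<in> dext_carrier n" if "X \<in> carrier_vec n" for l \<mu> X
    using that by (simp add: dext_carrier_def)
  have \<phi>'_add: "\<phi>' (dext_add u v) = \<phi>' u + \<phi>' v"
    if "u \<in> dext_carrier n" "v \<in> dext_carrier n" for u v
    using \<phi>' that unfolding dext_isometry_def by auto
  have \<phi>'_scale: "\<phi>' (dext_scale c u) = c \<cdot>\<^sub>v \<phi>' u" if "u \<in> dext_carrier n" for u c
    using \<phi>' that unfolding dext_isometry_def by auto
  have \<phi>'_closed: "\<phi>' u \<in> carrier_vec (n + 2)" if "u \<in> dext_carrier n" for u
    using \<phi>' that unfolding dext_isometry_def by (auto dest: bij_betwE)
  obtain A where A: "A \<in> carrier_mat (n + 2) (n + 2)" "\<And>v. v \<in> carrier_vec (n + 2) \<Longrightarrow> A *\<^sub>v v = ?f v"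
  proof (rule linear_map_mat[of "n + 2" ?f "n + 2"])
    show "?f v \<in> carrier_vec (n + 2)" if v: "v \<in> carrier_vec (n + 2)" for v
    proof -
      obtain l \<mu> X where "X \<in> carrier_vec n" "v = \<phi> (l, \<mu>, X)" using dext_surj[OF \<phi> v] .
      then show ?thesis using T mem \<phi>'_closed by (simp add: f)
    qed
    show "?f (v + w) = ?f v + ?f w" if v: "v \<in> carrier_vec (n + 2)" and w: "w \<in> carrier_vec (n + 2)" for v w
    proof -
      obtain l \<mu> X where X: "X \<in> carrier_vec n" "v = \<phi> (l, \<mu>, X)" using dext_surj[OF \<phi> v] .
      obtain l' \<mu>' Y where Y: "Y \<in> carrier_vec n" "w = \<phi> (l', \<mu>', Y)" using dext_surj[OF \<phi> w] .
      have "T (l + l', \<mu> + \<mu>', X + Y) = dext_add (T (l, \<mu>, X)) (T (l', \<mu>', Y))"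
        using T_add[OF mem[OF X(1)] mem[OF Y(1)]] by simp
      then show ?thesis
        using X Y T[OF mem[OF X(1)]] T[OF mem[OF Y(1)]] by (simp add: dext_plus[OF \<phi>] f \<phi>'_add)
    qed
    show "?f (c \<cdot>\<^sub>v v) = c \<cdot>\<^sub>v ?f v" if v: "v \<in> carrier_vec (n + 2)" for c v
    proof -
      obtain l \<mu> X where X: "X \<in> carrier_vec n" "v = \<phi> (l, \<mu>, X)" using dext_surj[OF \<phi> v] .
      have "T (c * l, c * \<mu>, c \<cdot>\<^sub>v X) = dext_scale c (T (l, \<mu>, X))"
        using T_scale[OF mem[OF X(1)]] by simp
      then show ?thesis
        using X T[OF mem[OF X(1)]] by (simp add: dext_smult[OF \<phi>] f \<phi>'_scale)
    qed
  qed blast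
  show thesis by (rule that[OF A(1)]) (simp add: A(2) dext_closed[OF \<phi>] f)
qed

text \<open>The map \<open>C \<oplus> 0\<close> on the orthogonal sum of \<open>\<complex>\<^sup>n\<close> and the hyperbolic plane of \<open>X\<^sub>1\<close> and \<open>Y\<^sub>1\<close>.\<close>

lemma kernel_extension:
  assumes \<phi>: "dext_isometry n \<phi>" and C: "C \<in> orth_algebra n"
  obtains D where "D \<in> orth_algebra (n + 2)"
    "\<And>l \<mu> X. X \<in> carrier_vec n \<Longrightarrow> D *\<^sub>v \<phi> (l, \<mu>, X) = \<phi> (0, 0, C *\<^sub>v X)"
proof -
  note Cc = orth_algebraD(1)[OF C]
  have Cv: "C *\<^sub>v X \<in> carrier_vec n" if "X \<in> carrier_vec n" for X using Cc that by simp
  let ?T = "\<lambda>(l :: complex, \<mu> :: complex, X). (0 :: complex, 0 :: complex, C *\<^sub>v X)"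
  obtain D where D: "D \<in> carrier_mat (n + 2) (n + 2)"
    "\<And>l \<mu> X. X \<in> carrier_vec n \<Longrightarrow> D *\<^sub>v \<phi> (l, \<mu>, X) = \<phi> (?T (l, \<mu>, X))"
    by (rule dext_linear_mat[OF \<phi> \<phi>, of ?T])
      (auto simp: dext_carrier_def Cv mult_add_distrib_mat_vec[OF Cc] mult_mat_vec[OF Cc])
  have "canon_form (n + 2) (D *\<^sub>v u) v = - canon_form (n + 2) u (D *\<^sub>v v)"
    if u: "u \<in> carrier_vec (n + 2)" and v: "v \<in> carrier_vec (n + 2)" for u v
  proof -
    obtain l \<mu> X where X: "X \<in> carrier_vec n" "u = \<phi> (l, \<mu>, X)" using dext_surj[OF \<phi> u] .
    obtain l' \<mu>' Y where Y: "Y \<in> carrier_vec n" "v = \<phi> (l', \<mu>', Y)" using dext_surj[OF \<phi> v] .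
    show ?thesis using X Y orth_algebraD(2)[OF C X(1) Y(1)] by (simp add: D(2) Cv dext_canon_form[OF \<phi>])
  qed
  then have "D \<in> orth_algebra (n + 2)" unfolding orth_algebra_def using D(1) by blast
  then show thesis using that[of D] D(2) by simp
qed

text \<open>A cancellation theorem of Witt type. The isometry \<open>U\<close> moves the first hyperbolic plane to one in the
  kernel of \<open>D'\<close>, and an isometry commuting with \<open>D'\<close> moves it on to the second hyperbolic plane. The
  composition conjugates \<open>D\<close> to \<open>D'\<close> and respects the two decompositions, so it restricts to \<open>\<complex>\<^sup>n\<close>.\<close>

lemma same_orbit_if_extensions_conjugate:
  assumes \<phi>: "dext_isometry n \<phi>" and \<phi>': "dext_isometry n \<phi>'"
    and C: "C \<in> orth_algebra n" and C': "C' \<in> orth_algebra n"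
    and D: "\<And>l \<mu> X. X \<in> carrier_vec n \<Longrightarrow> D *\<^sub>v \<phi> (l, \<mu>, X) = \<phi> (0, 0, C *\<^sub>v X)"
    and D': "D' \<in> orth_algebra (n + 2)"
      "\<And>l \<mu> X. X \<in> carrier_vec n \<Longrightarrow> D' *\<^sub>v \<phi>' (l, \<mu>, X) = \<phi>' (0, 0, C' *\<^sub>v X)"
    and U: "U \<in> orth_group (n + 2)"
      "\<And>v. v \<in> carrier_vec (n + 2) \<Longrightarrow> U *\<^sub>v (D *\<^sub>v v) = D' *\<^sub>v (U *\<^sub>v v)"
  shows "adjoint_orbit n C = adjoint_orbit n C'"
proof -
  note Cc = orth_algebraD(1)[OF C] note C'c = orth_algebraD(1)[OF C']
  have Cv: "C *\<^sub>v X \<in> carrier_vec n" if "X \<in> carrier_vec n" for X using Cc that by simp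
  have C'v: "C' *\<^sub>v X \<in> carrier_vec n" if "X \<in> carrier_vec n" for X using C'c that by simp
  note Uc = orth_groupD(1)[OF U(1)]
  define x y x' y' where "x = \<phi> (1, 0, 0\<^sub>v n)" "y = \<phi> (0, 1, 0\<^sub>v n)"
    "x' = \<phi>' (1, 0, 0\<^sub>v n)" "y' = \<phi>' (0, 1, 0\<^sub>v n)"
  note xy_def = this
  have car: "x \<in> carrier_vec (n + 2)" "y \<in> carrier_vec (n + 2)" "x' \<in> carrier_vec (n + 2)" "y' \<in> carrier_vec (n + 2)"
    by (simp_all add: xy_def dext_closed[OF \<phi>] dext_closed[OF \<phi>'])
  have "D *\<^sub>v x = 0\<^sub>v (n + 2)" "D *\<^sub>v y = 0\<^sub>v (n + 2)"
    by (simp_all add: xy_def D mult_mat_zero_vec[OF Cc] dext_zero[OF \<phi>])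
  then have kerU: "D' *\<^sub>v (U *\<^sub>v x) = 0\<^sub>v (n + 2)" "D' *\<^sub>v (U *\<^sub>v y) = 0\<^sub>v (n + 2)"
    using U(2)[OF car(1)] U(2)[OF car(2)] mult_mat_zero_vec[OF Uc] by simp_all
  have ker': "D' *\<^sub>v x' = 0\<^sub>v (n + 2)" "D' *\<^sub>v y' = 0\<^sub>v (n + 2)"
    by (simp_all add: xy_def D' mult_mat_zero_vec[OF C'c] dext_zero[OF \<phi>'])
  have pair: "canon_form (n + 2) (U *\<^sub>v x) (U *\<^sub>v x) = 0" "canon_form (n + 2) (U *\<^sub>v y) (U *\<^sub>v y) = 0"
    "canon_form (n + 2) (U *\<^sub>v x) (U *\<^sub>v y) = 1"
    "canon_form (n + 2) x' x' = 0" "canon_form (n + 2) y' y' = 0" "canon_form (n + 2) x' y' = 1"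
    using orth_groupD(3)[OF U(1)] car
    by (simp_all add: xy_def dext_canon_form[OF \<phi>] dext_canon_form[OF \<phi>'])
  have Uxy: "U *\<^sub>v x \<in> carrier_vec (n + 2)" "U *\<^sub>v y \<in> carrier_vec (n + 2)"
    using Uc car by simp_all
  obtain T where T: "T \<in> orth_group (n + 2)" "T *\<^sub>v (U *\<^sub>v x) = x'" "T *\<^sub>v (U *\<^sub>v y) = y'"
    "\<And>v. v \<in> carrier_vec (n + 2) \<Longrightarrow> T *\<^sub>v (D' *\<^sub>v v) = D' *\<^sub>v (T *\<^sub>v v)"
    using transport_hyperbolic_pair_in_kernel[OF D'(1) Uxy(1) kerU(1) Uxy(2) kerU(2) car(3) ker'(1)
        car(4) ker'(2) pair] by metis
  note Tc = orth_groupD(1)[OF T(1)]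
  define V where "V v = T *\<^sub>v (U *\<^sub>v v)" for v
  have V_iso: "canon_form (n + 2) (V v) (V w) = canon_form (n + 2) v w"
    if "v \<in> carrier_vec (n + 2)" "w \<in> carrier_vec (n + 2)" for v w
    using that Uc orth_groupD(3)[OF T(1), of "U *\<^sub>v v" "U *\<^sub>v w"] orth_groupD(3)[OF U(1)] by (simp add: V_def)
  have V_closed: "V v \<in> carrier_vec (n + 2)" if "v \<in> carrier_vec (n + 2)" for v
    using that Uc Tc by (simp add: V_def)
  have Vxy: "V x = x'" "V y = y'" using T by (simp_all add: V_def)
  have VD: "V (D *\<^sub>v v) = D' *\<^sub>v V v" if "v \<in> carrier_vec (n + 2)" for v
    using that Uc U(2) T(4)[of "U *\<^sub>v v"] by (simp add: V_def)
  \<comment> \<open>\<open>V\<close> takes one hyperbolic pair to the other, hence one copy of \<open>\<complex>\<^sup>n\<close> to the other\<close>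
  have "\<exists>Y. Y \<in> carrier_vec n \<and> V (\<phi> (0, 0, X)) = \<phi>' (0, 0, Y)" if X: "X \<in> carrier_vec n" for X
  proof -
    have c: "\<phi> (0, 0, X) \<in> carrier_vec (n + 2)" using X by (simp add: dext_closed[OF \<phi>])
    obtain l \<mu> Y where Y: "Y \<in> carrier_vec n" "V (\<phi> (0, 0, X)) = \<phi>' (l, \<mu>, Y)"
      using dext_surj[OF \<phi>' V_closed[OF c]] .
    have "canon_form (n + 2) (V (\<phi> (0, 0, X))) (V x) = 0" "canon_form (n + 2) (V (\<phi> (0, 0, X))) (V y) = 0"
      unfolding V_iso[OF c car(1)] V_iso[OF c car(2)] using X by (simp_all add: xy_def dext_canon_form[OF \<phi>])
    then have "canon_form (n + 2) (\<phi>' (l, \<mu>, Y)) x' = 0" "canon_form (n + 2) (\<phi>' (l, \<mu>, Y)) y' = 0"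
      by (simp_all add: Vxy Y(2))
    then have "\<mu> = 0" "l = 0" using Y(1) by (simp_all add: xy_def dext_canon_form[OF \<phi>'])
    then show ?thesis using Y by blast
  qed
  then obtain f where f: "\<And>X. X \<in> carrier_vec n \<Longrightarrow> f X \<in> carrier_vec n"
    "\<And>X. X \<in> carrier_vec n \<Longrightarrow> V (\<phi> (0, 0, X)) = \<phi>' (0, 0, f X)" by metis
  obtain P where P: "P \<in> carrier_mat n n" "\<And>X. X \<in> carrier_vec n \<Longrightarrow> P *\<^sub>v X = f X"
  proof (rule linear_map_mat[of n f n])
    show "f (X + Y) = f X + f Y" if "X \<in> carrier_vec n" "Y \<in> carrier_vec n" for X Y
    proof -
      have "\<phi> (0, 0, X + Y) = \<phi> (0, 0, X) + \<phi> (0, 0, Y)" using that by (simp add: dext_plus[OF \<phi>])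
      then have "V (\<phi> (0, 0, X + Y)) = V (\<phi> (0, 0, X)) + V (\<phi> (0, 0, Y))"
        using that Uc Tc dext_closed[OF \<phi>]
        by (simp add: V_def mult_add_distrib_mat_vec[OF Uc] mult_add_distrib_mat_vec[OF Tc])
      then show ?thesis using that f(1) by (simp add: f(2) dext_plus[OF \<phi>'] dext_eq_iff[OF \<phi>'])
    qed
    show "f (c \<cdot>\<^sub>v X) = c \<cdot>\<^sub>v f X" if "X \<in> carrier_vec n" for c X
    proof -
      have "\<phi> (0, 0, c \<cdot>\<^sub>v X) = c \<cdot>\<^sub>v \<phi> (0, 0, X)" using that by (simp add: dext_smult[OF \<phi>])
      then have "V (\<phi> (0, 0, c \<cdot>\<^sub>v X)) = c \<cdot>\<^sub>v V (\<phi> (0, 0, X))"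
        using that Uc Tc dext_closed[OF \<phi>]
        by (simp add: V_def mult_mat_vec[OF Uc] mult_mat_vec[OF Tc])
      then show ?thesis using that f(1) by (simp add: f(2) dext_smult[OF \<phi>'] dext_eq_iff[OF \<phi>'])
    qed
  qed (use f in auto)
  have "P \<in> orth_group n"
  proof (rule isometry_in_orth_group[OF P(1)])
    fix X Y :: "complex vec" assume X: "X \<in> carrier_vec n" and Y: "Y \<in> carrier_vec n"
    have "canon_form (n + 2) (V (\<phi> (0, 0, X))) (V (\<phi> (0, 0, Y))) = canon_form n X Y"
      using X Y by (simp add: V_iso dext_closed[OF \<phi>] dext_canon_form[OF \<phi>])
    then show "canon_form n (P *\<^sub>v X) (P *\<^sub>v Y) = canon_form n X Y"
      using X Y f(1) by (simp add: f(2) P(2) dext_canon_form[OF \<phi>'])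
  qed
  moreover have "P *\<^sub>v (C *\<^sub>v X) = C' *\<^sub>v (P *\<^sub>v X)" if X: "X \<in> carrier_vec n" for X
  proof -
    have "V (D *\<^sub>v \<phi> (0, 0, X)) = D' *\<^sub>v V (\<phi> (0, 0, X))" using X by (simp add: VD dext_closed[OF \<phi>])
    then show ?thesis
      using X Cv[OF X] f(1)[OF X] f(1)[OF Cv[OF X]] C'v[OF f(1)[OF X]]
      by (simp add: D D' f(2) P(2) dext_eq_iff[OF \<phi>'])
  qed
  ultimately have "C' \<in> adjoint_orbit n C" unfolding adjoint_orbit_iff[OF Cc] using C'c by blast
  then show ?thesis by (rule adjoint_orbit_eqI[OF Cc])
qed

text \<open>The map \<open>E\<close> is given by \<open>X\<^sub>1 \<mapsto> X\<^sub>1\<close>, \<open>Y\<^sub>1 \<mapsto> Y\<^sub>1 + X\<close>, \<open>W \<mapsto> W - B(W, X) X\<^sub>1\<close> for \<open>W\<close> in \<open>\<complex>\<^sup>n\<close>;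
  up to a multiple of \<open>X\<^sub>1\<close> in the image of \<open>Y\<^sub>1\<close> it is an Eichler transformation. It
  turns \<open>ad Y\<^sub>1 = C \<oplus> 0\<close> into the adjoint map of \<open>Y\<^sub>1 + X + l X\<^sub>1\<close>, for every \<open>l\<close> since \<open>X\<^sub>1\<close> is central.\<close>

lemma ad_conjugate_to_kernel_extension:
  assumes \<phi>: "dext_isometry n \<phi>" and C: "C \<in> orth_algebra n" and X: "X \<in> carrier_vec n"
  obtains E F where "E \<in> carrier_mat (n + 2) (n + 2)" "F \<in> carrier_mat (n + 2) (n + 2)"
    "\<And>v. v \<in> carrier_vec (n + 2) \<Longrightarrow> F *\<^sub>v (E *\<^sub>v v) = v"
    "\<And>v. v \<in> carrier_vec (n + 2) \<Longrightarrow> E *\<^sub>v (F *\<^sub>v v) = v"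
    "\<And>l l' \<mu> Y. Y \<in> carrier_vec n \<Longrightarrow>
      double_extension n \<phi> C (\<phi> (l, 1, X)) (E *\<^sub>v \<phi> (l', \<mu>, Y)) = E *\<^sub>v \<phi> (0, 0, C *\<^sub>v Y)"
proof -
  note Cc = orth_algebraD(1)[OF C]
  have Cv: "C *\<^sub>v Y \<in> carrier_vec n" if "Y \<in> carrier_vec n" for Y using Cc that by simp
  let ?T = "\<lambda>(l, \<mu>, Y). (l - canon_form n Y X, \<mu>, Y + \<mu> \<cdot>\<^sub>v X)"
  let ?S = "\<lambda>(l, \<mu>, Y). (l + canon_form n (Y - \<mu> \<cdot>\<^sub>v X) X, \<mu>, Y - \<mu> \<cdot>\<^sub>v X)"
  have vec1: "a + (b + (s + t) \<cdot>\<^sub>v X) = a + (s \<cdot>\<^sub>v X + (b + t \<cdot>\<^sub>v X))"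
    "(a + b) - (s + t) \<cdot>\<^sub>v X = (a - s \<cdot>\<^sub>v X) + (b - t \<cdot>\<^sub>v X)"
    "c \<cdot>\<^sub>v a + (c * s) \<cdot>\<^sub>v X = c \<cdot>\<^sub>v (a + s \<cdot>\<^sub>v X)"
    "c \<cdot>\<^sub>v a - (c * s) \<cdot>\<^sub>v X = c \<cdot>\<^sub>v (a - s \<cdot>\<^sub>v X)"
    "(a + s \<cdot>\<^sub>v X) - s \<cdot>\<^sub>v X = a" "(a - s \<cdot>\<^sub>v X) + s \<cdot>\<^sub>v X = a"
    if "a \<in> carrier_vec n" "b \<in> carrier_vec n" for a b and c s t :: complex
    using that X by (auto intro!: eq_vecI simp: algebra_simps)
  obtain E where E: "E \<in> carrier_mat (n + 2) (n + 2)"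
    "\<And>l \<mu> Y. Y \<in> carrier_vec n \<Longrightarrow> E *\<^sub>v \<phi> (l, \<mu>, Y) = \<phi> (?T (l, \<mu>, Y))"
    by (rule dext_linear_mat[OF \<phi> \<phi>, of ?T])
      (use X in \<open>auto simp: dext_carrier_def vec1 canon_form_bilinear right_diff_distrib\<close>)
  obtain F where F: "F \<in> carrier_mat (n + 2) (n + 2)"
    "\<And>l \<mu> Y. Y \<in> carrier_vec n \<Longrightarrow> F *\<^sub>v \<phi> (l, \<mu>, Y) = \<phi> (?S (l, \<mu>, Y))"
    by (rule dext_linear_mat[OF \<phi> \<phi>, of ?S])
      (use X in \<open>auto simp: dext_carrier_def vec1 canon_form_bilinear distrib_left\<close>)
  show thesis
  proof (rule that[OF E(1) F(1)])
    fix v :: "complex vec" assume v: "v \<in> carrier_vec (n + 2)"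
    obtain l \<mu> Y where Y: "Y \<in> carrier_vec n" "v = \<phi> (l, \<mu>, Y)" using dext_surj[OF \<phi> v] .
    show "F *\<^sub>v (E *\<^sub>v v) = v" "E *\<^sub>v (F *\<^sub>v v) = v" using Y X by (simp_all add: E(2) F(2) vec1[of _ Y])
  next
    fix l l' \<mu> and Y :: "complex vec" assume Y: "Y \<in> carrier_vec n"
    have skew: "canon_form n (C *\<^sub>v X) Y = - canon_form n (C *\<^sub>v Y) X"
      using orth_algebraD(2)[OF C X Y] by (simp add: canon_form_sym)
    have skew0: "canon_form n (C *\<^sub>v X) X = 0"
      using orth_algebraD(2)[OF C X X] by (simp add: canon_form_sym)
    have "1 \<cdot>\<^sub>v (a + \<mu> \<cdot>\<^sub>v b) - \<mu> \<cdot>\<^sub>v b = a + 0 \<cdot>\<^sub>v X" if "a \<in> carrier_vec n" "b \<in> carrier_vec n" for a b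
      using that X by (intro eq_vecI) auto
    from this[OF Cv[OF Y] Cv[OF X]]
    show "double_extension n \<phi> C (\<phi> (l, 1, X)) (E *\<^sub>v \<phi> (l', \<mu>, Y)) = E *\<^sub>v \<phi> (0, 0, C *\<^sub>v Y)"
      using X Y Cv[OF X] Cv[OF Y]
      by (simp add: E(2) double_extension_apply[OF \<phi>] mult_add_distrib_mat_vec[OF Cc] mult_mat_vec[OF Cc]
          canon_form_bilinear skew skew0)
  qed
qed

text \<open>An isomorphism need not preserve the hyperplane \<open>\<complex>\<^sup>n \<oplus> \<complex>X\<^sub>1\<close>: if \<open>C\<close> has rank 2, then \<open>I\<close> is decomposable and
  several hyperplanes are on the same footing. Comparing adjoint maps of elements outside both
  hyperplanes, instead of the hyperplanes themselves, avoids a case distinction.\<close>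

theorem isomorphic_double_extensions_same_orbit:
  assumes \<phi>: "dext_isometry n \<phi>" and \<phi>': "dext_isometry n \<phi>'"
    and C: "C \<in> nonzero_nilpotents n" and C': "C' \<in> nonzero_nilpotents n"
    and iso: "isomorphic (n + 2) (double_extension n \<phi> C) (double_extension n \<phi>' C')"
  shows "adjoint_orbit n C = adjoint_orbit n C'"
proof -
  let ?g = "double_extension n \<phi> C" and ?g' = "double_extension n \<phi>' C'"
  obtain Co: "C \<in> orth_algebra n" and Co': "C' \<in> orth_algebra n"
    using C C' by (simp add: nonzero_nilpotents_def)
  note Cc = orth_algebraD(1)[OF Co] note C'c = orth_algebraD(1)[OF Co']
  obtain A where inv: "invertible_mat A" and Ac: "A \<in> carrier_mat (n + 2) (n + 2)"
    and hom: "\<And>u v. u \<in> carrier_vec (n + 2) \<Longrightarrow> v \<in> carrier_vec (n + 2) \<Longrightarrow>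
      A *\<^sub>v ?g u v = ?g' (A *\<^sub>v u) (A *\<^sub>v v)"
    using iso unfolding isomorphic_def lie_hom_mat_def by blast
  obtain B where Bc: "B \<in> carrier_mat (n + 2) (n + 2)"
    and AB: "\<And>v. v \<in> carrier_vec (n + 2) \<Longrightarrow> A *\<^sub>v (B *\<^sub>v v) = v"
    and BA: "\<And>v. v \<in> carrier_vec (n + 2) \<Longrightarrow> B *\<^sub>v (A *\<^sub>v v) = v"
    using inverse_mat_exists[OF Ac inv] by metis
  note dc = dext_closed[OF \<phi>] note dc' = dext_closed[OF \<phi>']
  \<comment> \<open>two hyperplanes do not cover the space: some \<open>Z\<close> has both \<open>Y\<^sub>1\<close>-coordinates non-zero\<close>
  obtain l X l' \<mu> X' where X: "X \<in> carrier_vec n" and X': "X' \<in> carrier_vec n" and \<mu>: "\<mu> \<noteq> 0"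
    and AZ: "A *\<^sub>v \<phi> (l, 1, X) = \<phi>' (l', \<mu>, X')"
  proof -
    obtain l1 m1 X1 where 1: "X1 \<in> carrier_vec n" "A *\<^sub>v \<phi> (0, 1, 0\<^sub>v n) = \<phi>' (l1, m1, X1)"
      using dext_surj[OF \<phi>', of "A *\<^sub>v \<phi> (0, 1, 0\<^sub>v n)"] Ac dc by (metis mult_mat_vec_carrier zero_carrier_vec)
    show thesis
    proof (cases "m1 = 0")
      case False
      then show thesis using 1 that[of "0\<^sub>v n"] by auto
    next
      case True
      obtain l2 m2 X2 where 2: "X2 \<in> carrier_vec n" "B *\<^sub>v \<phi>' (0, 1, 0\<^sub>v n) = \<phi> (l2, m2, X2)"
        using dext_surj[OF \<phi>, of "B *\<^sub>v \<phi>' (0, 1, 0\<^sub>v n)"] Bc dc' by (metis mult_mat_vec_carrier zero_carrier_vec)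
      then have A2: "A *\<^sub>v \<phi> (l2, m2, X2) = \<phi>' (0, 1, 0\<^sub>v n)" using AB[of "\<phi>' (0, 1, 0\<^sub>v n)"] dc' by simp
      obtain t where t: "t \<noteq> 0" "1 + t * m2 \<noteq> 0"
      proof (cases "m2 = - 1")
        case True
        then show thesis by (intro that[of 2]) auto
      next
        case False
        then have "1 + m2 \<noteq> 0" by (metis add.inverse_unique)
        then show thesis by (intro that[of 1]) auto
      qed
      define s where "s = inverse (1 + t * m2)"
      have s: "s \<noteq> 0" "s * (1 + t * m2) = 1" using t by (simp_all add: s_def)
      have "\<phi> (s * (t * l2), 1, s \<cdot>\<^sub>v (0\<^sub>v n + t \<cdot>\<^sub>v X2)) = s \<cdot>\<^sub>v (\<phi> (0, 1, 0\<^sub>v n) + t \<cdot>\<^sub>v \<phi> (l2, m2, X2))"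
        using 2(1) s(2) by (simp add: dext_plus[OF \<phi>] dext_smult[OF \<phi>])
      then have "A *\<^sub>v \<phi> (s * (t * l2), 1, s \<cdot>\<^sub>v (0\<^sub>v n + t \<cdot>\<^sub>v X2))
          = s \<cdot>\<^sub>v (\<phi>' (l1, m1, X1) + t \<cdot>\<^sub>v \<phi>' (0, 1, 0\<^sub>v n))"
        using 2(1) dc by (simp add: mult_add_distrib_mat_vec[OF Ac] mult_mat_vec[OF Ac] 1(2) A2)
      also have "\<dots> = \<phi>' (s * l1, s * t, s \<cdot>\<^sub>v (X1 + t \<cdot>\<^sub>v 0\<^sub>v n))"
        using 1(1) True by (simp add: dext_plus[OF \<phi>'] dext_smult[OF \<phi>'])
      finally show thesis
        by (rule that[rotated -1]) (use s t 1 2 in auto)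
    qed
  qed
  have zeta: "\<phi>' (l', \<mu>, X') = \<mu> \<cdot>\<^sub>v \<phi>' (l' / \<mu>, 1, inverse \<mu> \<cdot>\<^sub>v X')"
    using X' \<mu> by (simp add: dext_smult[OF \<phi>'] smult_smult_assoc)
  let ?X' = "inverse \<mu> \<cdot>\<^sub>v X'"
  have X'': "?X' \<in> carrier_vec n" using X' by simp
  obtain E F where E: "E \<in> carrier_mat (n + 2) (n + 2)" "F \<in> carrier_mat (n + 2) (n + 2)"
    "\<And>v. v \<in> carrier_vec (n + 2) \<Longrightarrow> F *\<^sub>v (E *\<^sub>v v) = v"
    "\<And>l' m Y. Y \<in> carrier_vec n \<Longrightarrow>
      ?g (\<phi> (l, 1, X)) (E *\<^sub>v \<phi> (l', m, Y)) = E *\<^sub>v \<phi> (0, 0, C *\<^sub>v Y)"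
    using ad_conjugate_to_kernel_extension[OF \<phi> Co X] by metis
  obtain E' F' where E': "E' \<in> carrier_mat (n + 2) (n + 2)" "F' \<in> carrier_mat (n + 2) (n + 2)"
    "\<And>v. v \<in> carrier_vec (n + 2) \<Longrightarrow> F' *\<^sub>v (E' *\<^sub>v v) = v"
    "\<And>v. v \<in> carrier_vec (n + 2) \<Longrightarrow> E' *\<^sub>v (F' *\<^sub>v v) = v"
    "\<And>l l' m Y. Y \<in> carrier_vec n \<Longrightarrow>
      ?g' (\<phi>' (l, 1, ?X')) (E' *\<^sub>v \<phi>' (l', m, Y)) = E' *\<^sub>v \<phi>' (0, 0, C' *\<^sub>v Y)"
    using ad_conjugate_to_kernel_extension[OF \<phi>' Co' X''] by metis
  have \<mu>C': "\<mu> \<cdot>\<^sub>m C' \<in> orth_algebra n" and orbit: "adjoint_orbit n (\<mu> \<cdot>\<^sub>m C') = adjoint_orbit n C'"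
    using adjoint_orbit_smult[OF C' \<mu>] by blast+
  have \<mu>C'_act: "(\<mu> \<cdot>\<^sub>m C') *\<^sub>v Y = \<mu> \<cdot>\<^sub>v (C' *\<^sub>v Y)" if "Y \<in> carrier_vec n" for Y
    using C'c that by (intro eq_vecI) auto
  obtain D where D: "D \<in> orth_algebra (n + 2)"
    "\<And>l \<mu> X. X \<in> carrier_vec n \<Longrightarrow> D *\<^sub>v \<phi> (l, \<mu>, X) = \<phi> (0, 0, C *\<^sub>v X)"
    using kernel_extension[OF \<phi> Co] by metis
  obtain D' where D': "D' \<in> orth_algebra (n + 2)"
    "\<And>l m X. X \<in> carrier_vec n \<Longrightarrow> D' *\<^sub>v \<phi>' (l, m, X) = \<phi>' (0, 0, (\<mu> \<cdot>\<^sub>m C') *\<^sub>v X)"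
    using kernel_extension[OF \<phi>' \<mu>C'] by metis
  note carr = E(1,2) E'(1,2) Ac Bc orth_algebraD(1)[OF D(1)] orth_algebraD(1)[OF D'(1)]
  have g'_smult: "?g' (c \<cdot>\<^sub>v u) v = c \<cdot>\<^sub>v ?g' u v"
    if "u \<in> carrier_vec (n + 2)" "v \<in> carrier_vec (n + 2)" for c u v
    using double_extension_quadratic[OF \<phi>' Co'] that
    unfolding quadratic_structures_def lie_structures_def by blast
  define Q where "Q = F' * (A * E)"
  have Q: "Q \<in> carrier_mat (n + 2) (n + 2)" using carr by (simp add: Q_def)
  have Q_act: "Q *\<^sub>v v = F' *\<^sub>v (A *\<^sub>v (E *\<^sub>v v))" if "v \<in> carrier_vec (n + 2)" for v
    using that carr by (simp add: Q_def assoc_mult_mat_vec[of _ "n + 2" "n + 2" _ "n + 2"])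
  have "invertible_mat Q"
  proof (rule invertible_matI[OF Q, of "F * (B * E')"])
    show "(F * (B * E')) *\<^sub>v (Q *\<^sub>v v) = v" if "v \<in> carrier_vec (n + 2)" for v
    proof -
      have AEv: "A *\<^sub>v (E *\<^sub>v v) \<in> carrier_vec (n + 2)" and Ev: "E *\<^sub>v v \<in> carrier_vec (n + 2)"
        using that carr by simp_all
      have "(F * (B * E')) *\<^sub>v (Q *\<^sub>v v) = F *\<^sub>v (B *\<^sub>v (E' *\<^sub>v (Q *\<^sub>v v)))"
        using that carr Q by (simp add: assoc_mult_mat_vec[of _ "n + 2" "n + 2" _ "n + 2"])
      also have "E' *\<^sub>v (Q *\<^sub>v v) = A *\<^sub>v (E *\<^sub>v v)" using Q_act[OF that] E'(4)[OF AEv] by simp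
      finally show ?thesis using BA[OF Ev] E(3)[OF that] by simp
    qed
  qed (use carr in simp)
  moreover have "Q *\<^sub>v (D *\<^sub>v v) = D' *\<^sub>v (Q *\<^sub>v v)" if v: "v \<in> carrier_vec (n + 2)" for v
  proof -
    obtain k m Y where Y: "Y \<in> carrier_vec n" "v = \<phi> (k, m, Y)" using dext_surj[OF \<phi> v] .
    have CY: "C *\<^sub>v Y \<in> carrier_vec n" using Cc Y by simp
    have Qv: "Q *\<^sub>v v \<in> carrier_vec (n + 2)" using Q v by simp
    obtain k' m' Y' where Y': "Y' \<in> carrier_vec n" "Q *\<^sub>v v = \<phi>' (k', m', Y')" using dext_surj[OF \<phi>' Qv] .
    have C'Y': "C' *\<^sub>v Y' \<in> carrier_vec n" using C'c Y' by simp
    have "A *\<^sub>v (E *\<^sub>v v) \<in> carrier_vec (n + 2)" using carr v by simp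
    then have AE: "A *\<^sub>v (E *\<^sub>v v) = E' *\<^sub>v \<phi>' (k', m', Y')"
      using E'(4)[of "A *\<^sub>v (E *\<^sub>v v)"] Q_act[OF v] Y'(2) by simp
    have "A *\<^sub>v (E *\<^sub>v (D *\<^sub>v v)) = A *\<^sub>v ?g (\<phi> (l, 1, X)) (E *\<^sub>v v)"
      unfolding Y(2) using Y(1) by (simp add: D(2) E(4))
    also have "\<dots> = ?g' (\<mu> \<cdot>\<^sub>v \<phi>' (l' / \<mu>, 1, ?X')) (E' *\<^sub>v \<phi>' (k', m', Y'))"
      using hom[of "\<phi> (l, 1, X)" "E *\<^sub>v v"] X v carr dc by (simp add: AZ AE zeta)
    also have "\<dots> = \<mu> \<cdot>\<^sub>v ?g' (\<phi>' (l' / \<mu>, 1, ?X')) (E' *\<^sub>v \<phi>' (k', m', Y'))"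
      by (rule g'_smult) (use X'' Y' dc' carr in auto)
    also have "\<dots> = E' *\<^sub>v (\<mu> \<cdot>\<^sub>v \<phi>' (0, 0, C' *\<^sub>v Y'))"
      using Y' C'Y' carr dc' by (simp add: E'(5) mult_mat_vec[of _ "n + 2" "n + 2"])
    also have "\<mu> \<cdot>\<^sub>v \<phi>' (0, 0, C' *\<^sub>v Y') = D' *\<^sub>v (Q *\<^sub>v v)"
      using Y' C'Y' by (simp add: D'(2) \<mu>C'_act dext_smult[OF \<phi>'])
    finally have "F' *\<^sub>v (A *\<^sub>v (E *\<^sub>v (D *\<^sub>v v))) = D' *\<^sub>v (Q *\<^sub>v v)"
      using Qv carr by (simp add: E'(3))
    then show ?thesis using Q_act[of "D *\<^sub>v v"] carr v by simp
  qed
  ultimately obtain U where "U \<in> orth_group (n + 2)"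
    "\<And>v. v \<in> carrier_vec (n + 2) \<Longrightarrow> U *\<^sub>v (D *\<^sub>v v) = D' *\<^sub>v (U *\<^sub>v v)"
    using similar_imp_orth_conjugate[OF D(1) D'(1) Q] by metis
  from same_orbit_if_extensions_conjugate[OF \<phi> \<phi>' Co \<mu>C' D(2) D'(1,2) this]
  show ?thesis using orbit by simp
qed

lemma same_orbit_imp_i_isomorphic:
  assumes \<phi>: "dext_isometry n \<phi>" and \<phi>': "dext_isometry n \<phi>'"
    and C: "C \<in> orth_algebra n" and C': "C' \<in> orth_algebra n"
    and orbit: "adjoint_orbit n C = adjoint_orbit n C'"
  shows "i_isomorphic (n + 2) (double_extension n \<phi> C) (double_extension n \<phi>' C')"
proof -
  note Cc = orth_algebraD(1)[OF C] note C'c = orth_algebraD(1)[OF C']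
  obtain U where U: "U \<in> orth_group n" and UC: "\<And>X. X \<in> carrier_vec n \<Longrightarrow> U *\<^sub>v (C *\<^sub>v X) = C' *\<^sub>v (U *\<^sub>v X)"
    using self_in_adjoint_orbit[OF C'c] unfolding orbit[symmetric] adjoint_orbit_iff[OF Cc] by blast
  note Uc = orth_groupD(1)[OF U]
  have Cv: "C *\<^sub>v X \<in> carrier_vec n" "U *\<^sub>v X \<in> carrier_vec n" "C' *\<^sub>v X \<in> carrier_vec n"
    if "X \<in> carrier_vec n" for X using Cc C'c Uc that by simp_all
  let ?T = "\<lambda>(l :: complex, \<mu> :: complex, X). (l, \<mu>, U *\<^sub>v X)"
  obtain A where A: "A \<in> carrier_mat (n + 2) (n + 2)"
    "\<And>l \<mu> X. X \<in> carrier_vec n \<Longrightarrow> A *\<^sub>v \<phi> (l, \<mu>, X) = \<phi>' (?T (l, \<mu>, X))"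
    by (rule dext_linear_mat[OF \<phi> \<phi>', of ?T])
      (auto simp: dext_carrier_def Cv mult_add_distrib_mat_vec[OF Uc] mult_mat_vec[OF Uc])
  have "A \<in> orth_group (n + 2)"
  proof (rule isometry_in_orth_group[OF A(1)])
    fix u v :: "complex vec" assume u: "u \<in> carrier_vec (n + 2)" and v: "v \<in> carrier_vec (n + 2)"
    obtain l \<mu> X where X: "X \<in> carrier_vec n" "u = \<phi> (l, \<mu>, X)" using dext_surj[OF \<phi> u] .
    obtain l' \<mu>' Y where Y: "Y \<in> carrier_vec n" "v = \<phi> (l', \<mu>', Y)" using dext_surj[OF \<phi> v] .
    show "canon_form (n + 2) (A *\<^sub>v u) (A *\<^sub>v v) = canon_form (n + 2) u v"
      using X Y orth_groupD(3)[OF U] by (simp add: A(2) Cv dext_canon_form[OF \<phi>] dext_canon_form[OF \<phi>'])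
  qed
  moreover have "A *\<^sub>v double_extension n \<phi> C u v = double_extension n \<phi>' C' (A *\<^sub>v u) (A *\<^sub>v v)"
    if u: "u \<in> carrier_vec (n + 2)" and v: "v \<in> carrier_vec (n + 2)" for u v
  proof -
    obtain l \<mu> X where X: "X \<in> carrier_vec n" "u = \<phi> (l, \<mu>, X)" using dext_surj[OF \<phi> u] .
    obtain l' \<mu>' Y where Y: "Y \<in> carrier_vec n" "v = \<phi> (l', \<mu>', Y)" using dext_surj[OF \<phi> v] .
    show ?thesis
      using X Y orth_groupD(3)[OF U Cv(1)[OF X(1)] Y(1)]
      by (simp add: A(2) Cv UC[symmetric] double_extension_apply[OF \<phi>] double_extension_apply[OF \<phi>']
          mult_minus_distrib_mat_vec[OF Uc] mult_mat_vec[OF Uc])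
  qed
  ultimately show ?thesis unfolding i_isomorphic_def lie_hom_mat_def using A(1) by blast
qed

section \<open>Nilpotent singular structures are double extensions\<close>

text \<open>For a nilpotent linear map \<open>f \<noteq> 0\<close> and \<open>z = 0\<close>, this gives a non-zero vector \<open>f w\<close> in both the image and
  the kernel of \<open>f\<close>.\<close>

lemma exists_last_iterate:
  fixes f :: "'a \<Rightarrow> 'a"
  assumes nz: "f v \<noteq> z" and fin: "(f ^^ k) v = z" and fz: "f z = z"
  obtains w where "f w \<noteq> z" "f (f w) = z" "\<exists>i. w = (f ^^ i) v"
proof -
  define m where "m = (LEAST k. (f ^^ k) v = z)"
  have m: "(f ^^ m) v = z" unfolding m_def using fin by (rule LeastI)
  have less: "(f ^^ i) v \<noteq> z" if "i < m" for i using not_less_Least that unfolding m_def by blast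
  have "m \<noteq> 0" using m nz fz by (metis funpow_0)
  moreover have "m \<noteq> 1" using m nz by auto
  ultimately obtain i where i: "m = Suc (Suc i)" by (metis One_nat_def not0_implies_Suc)
  show thesis
    by (rule that[of "(f ^^ i) v"]) (use m less[of "Suc i"] i in auto)
qed

text \<open>Here \<open>J = \<alpha> \<and> \<omega>\<close> and \<open>\<omega> \<and> \<omega> = 0\<close>. Contracting the latter with \<open>P\<close> gives \<open>\<omega>(P, -) \<and> \<omega> = 0\<close>, which
  survives the multiplication by \<open>\<alpha>\<close>.\<close>

lemma contraction_wedge_zero:
  fixes \<alpha> :: "'v \<Rightarrow> complex"
  assumes alt: "\<And>X Y. X \<in> V \<Longrightarrow> Y \<in> V \<Longrightarrow> \<omega> X Y = - \<omega> Y X"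
    and pluecker: "\<And>X Y Z W. X \<in> V \<Longrightarrow> Y \<in> V \<Longrightarrow> Z \<in> V \<Longrightarrow> W \<in> V \<Longrightarrow>
      \<omega> X Y * \<omega> Z W + \<omega> Y Z * \<omega> X W + \<omega> Z X * \<omega> Y W = 0"
    and J: "\<And>X Y Z. X \<in> V \<Longrightarrow> Y \<in> V \<Longrightarrow> Z \<in> V \<Longrightarrow> J X Y Z = \<alpha> X * \<omega> Y Z - \<alpha> Y * \<omega> X Z + \<alpha> Z * \<omega> X Y"
    and mem: "P \<in> V" "X \<in> V" "Y \<in> V" "Z \<in> V" "W \<in> V"
  shows "wedge_1_3 (\<omega> P) J X Y Z W = 0"
proof -
  have p: "\<omega> P A * \<omega> B C - \<omega> P B * \<omega> A C + \<omega> P C * \<omega> A B = 0" if "A \<in> V" "B \<in> V" "C \<in> V" for A B C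
    using pluecker[OF mem(1) that] by (simp add: alt[OF that(2) mem(1)] algebra_simps)
  have "wedge_1_3 (\<omega> P) J X Y Z W
      = - \<alpha> X * (\<omega> P Y * \<omega> Z W - \<omega> P Z * \<omega> Y W + \<omega> P W * \<omega> Y Z)
        + \<alpha> Y * (\<omega> P X * \<omega> Z W - \<omega> P Z * \<omega> X W + \<omega> P W * \<omega> X Z)
        - \<alpha> Z * (\<omega> P X * \<omega> Y W - \<omega> P Y * \<omega> X W + \<omega> P W * \<omega> X Y)
        + \<alpha> W * (\<omega> P X * \<omega> Y Z - \<omega> P Y * \<omega> X Z + \<omega> P Z * \<omega> X Y)"
    using mem by (simp add: wedge_1_3_def J algebra_simps)
  then show ?thesis using mem by (simp only: p) simp
qed

definition wedge_annihilating :: "nat \<Rightarrow> bracket \<Rightarrow> complex vec \<Rightarrow> bool" where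
  "wedge_annihilating m br x \<longleftrightarrow>
     (\<forall>X\<in>carrier_vec m. \<forall>Y\<in>carrier_vec m. \<forall>Z\<in>carrier_vec m. \<forall>W\<in>carrier_vec m.
        wedge_1_3 (canon_form m x) (assoc_form m br) X Y Z W = 0)"

lemma wedge_annihilatingD:
  "wedge_annihilating m br x \<Longrightarrow> X \<in> carrier_vec m \<Longrightarrow> Y \<in> carrier_vec m \<Longrightarrow> Z \<in> carrier_vec m \<Longrightarrow>
    W \<in> carrier_vec m \<Longrightarrow> wedge_1_3 (canon_form m x) (assoc_form m br) X Y Z W = 0"
  unfolding wedge_annihilating_def by blast

context
  fixes m :: nat and br :: bracket
  assumes NS: "br \<in> nilpotent_singular m"
begin

abbreviation (input) "V \<equiv> carrier_vec m :: complex vec set"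
abbreviation (input) "B \<equiv> canon_form m"

lemma br_closed [simp]: "X \<in> V \<Longrightarrow> Y \<in> V \<Longrightarrow> br X Y \<in> V"
  using NS unfolding nilpotent_singular_def quadratic_structures_def lie_structures_def by auto

lemma br_linear:
  assumes "X \<in> V" "Y \<in> V" "Z \<in> V"
  shows "br (X + Y) Z = br X Z + br Y Z" "br (c \<cdot>\<^sub>v X) Z = c \<cdot>\<^sub>v br X Z"
    "br Z (X + Y) = br Z X + br Z Y" "br Z (c \<cdot>\<^sub>v X) = c \<cdot>\<^sub>v br Z X"
  using NS assms unfolding nilpotent_singular_def quadratic_structures_def lie_structures_def by blast+

lemma br_self [simp]: "X \<in> V \<Longrightarrow> br X X = 0\<^sub>v m"
  using NS unfolding nilpotent_singular_def quadratic_structures_def lie_structures_def by blast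

lemma br_jacobi:
  "X \<in> V \<Longrightarrow> Y \<in> V \<Longrightarrow> Z \<in> V \<Longrightarrow> br X (br Y Z) + br Y (br Z X) + br Z (br X Y) = 0\<^sub>v m"
  using NS unfolding nilpotent_singular_def quadratic_structures_def lie_structures_def by blast

lemma br_invariant: "X \<in> V \<Longrightarrow> Y \<in> V \<Longrightarrow> Z \<in> V \<Longrightarrow> B (br X Y) Z = B X (br Y Z)"
  using NS unfolding nilpotent_singular_def quadratic_structures_def by blast

lemma br_skew:
  assumes "X \<in> V" "Y \<in> V" "Z \<in> V"
  shows "B (br X Y) Z = - B (br Y X) Z"
proof -
  have "br (X + Y) (X + Y) = (br X X + br X Y) + (br Y X + br Y Y)"
    using assms by (simp only: br_linear(1)[of X Y "X + Y"] br_linear(3)[of X Y X] br_linear(3)[of X Y Y]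
        add_carrier_vec)
  then have "B (br (X + Y) (X + Y)) Z = B ((br X X + br X Y) + (br Y X + br Y Y)) Z" by (simp only:)
  then have "B (br X Y) Z + B (br Y X) Z = 0" using assms by (simp add: canon_form_add_left)
  then show ?thesis by (simp add: add_eq_0_iff2)
qed

lemma br_ad_skew:
  assumes "X \<in> V" "Y \<in> V" "Z \<in> V"
  shows "B (br Z X) Y = - B X (br Z Y)" "B (br Z X) Y = - B (br Z Y) X"
  using assms br_skew[of X Z Y] br_invariant[of X Z Y] canon_form_sym[of m X] by simp_all

lemma br_zero: "X \<in> V \<Longrightarrow> br X (0\<^sub>v m) = 0\<^sub>v m"
proof -
  assume X: "X \<in> V"
  have "0 \<cdot>\<^sub>v v = 0\<^sub>v m" if "v \<in> V" for v using that by (intro eq_vecI) auto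
  then show ?thesis using br_linear(4)[of "0\<^sub>v m" "0\<^sub>v m" X 0] X by simp
qed

lemma br_iterate_vanishes: "\<exists>k. \<forall>X\<in>V. \<forall>Z\<in>V. (br Z ^^ k) X = 0\<^sub>v m"
proof -
  obtain k where k: "lower_central m br k = {0\<^sub>v m}"
    using NS unfolding nilpotent_singular_def nilpotent_bracket_def by blast
  have "(br Z ^^ i) X \<in> lower_central m br i" if "X \<in> V" "Z \<in> V" for X Z i
  proof (induction i)
    case (Suc i)
    then show ?case using bracket_in_lower_central[of m br Z _ i] that br_closed by simp
  qed (use that in simp)
  then show ?thesis using k by blast
qed

lemma br_iterate_closed: "X \<in> V \<Longrightarrow> Z \<in> V \<Longrightarrow> (br Z ^^ i) X \<in> V"
  by (induction i) auto

text \<open>The identity \<open>B(x, -) \<and> I = 0\<close>, evaluated with \<open>y\<close> in the fourth slot, expresses \<open>I(X, Y, Z)\<close> through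
  the values \<open>I(-, -, y)\<close>, that is, through \<open>ad y\<close>; non-degeneracy then gives the bracket itself.\<close>

lemma wedge_bracket_formula:
  assumes x: "x \<in> V" and wedge: "wedge_annihilating m br x"
    and y: "y \<in> V" "B x y = 1" and XY: "X \<in> V" "Y \<in> V"
  shows "br X Y = B x X \<cdot>\<^sub>v br y Y - B x Y \<cdot>\<^sub>v br y X + B (br y X) Y \<cdot>\<^sub>v x"
proof (rule canon_form_eqI[of _ m])
  fix Z assume Z: "Z \<in> V"
  have I: "assoc_form m br P Q y = B (br y P) Q" if "P \<in> V" "Q \<in> V" for P Q
    using that y br_invariant[of y P Q] canon_form_sym[of m y] by (simp add: assoc_form_def)
  show "B (br X Y) Z = B (B x X \<cdot>\<^sub>v br y Y - B x Y \<cdot>\<^sub>v br y X + B (br y X) Y \<cdot>\<^sub>v x) Z"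
    using wedge_annihilatingD[OF wedge XY Z y(1)] x y XY Z I[OF XY(2) Z] I[OF XY(1) Z] I[OF XY]
    by (simp add: wedge_1_3_def canon_form_bilinear) (simp add: assoc_form_def algebra_simps)
qed (use x y XY in auto)

lemma annihilator_vector:
  obtains x where "x \<in> V" "x \<noteq> 0\<^sub>v m" "wedge_annihilating m br x"
proof -
  have "dup m br \<ge> 1" using NS by (simp add: nilpotent_singular_def singular_def)
  then obtain \<alpha> v where \<alpha>: "\<alpha> \<in> wedge_annihilator m br" and v: "v \<in> V" "\<alpha> v \<noteq> 0"
    unfolding dup_pos_iff by blast
  obtain x where x: "x \<in> V" "\<And>v. v \<in> V \<Longrightarrow> \<alpha> v = B x v"
  proof (rule linear_form_repr[of m \<alpha>])
    show "\<alpha> (v + w) = \<alpha> v + \<alpha> w" if "v \<in> V" "w \<in> V" for v w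
      using \<alpha> that unfolding wedge_annihilator_def dual_space_def by blast
    show "\<alpha> (c \<cdot>\<^sub>v v) = c * \<alpha> v" if "v \<in> V" for c v
      using \<alpha> that unfolding wedge_annihilator_def dual_space_def by blast
  qed blast
  have "wedge_1_3 (B x) (assoc_form m br) X Y Z W = 0"
    if XYZW: "X \<in> V" "Y \<in> V" "Z \<in> V" "W \<in> V" for X Y Z W
  proof -
    have "wedge_1_3 \<alpha> (assoc_form m br) X Y Z W = 0"
      using \<alpha> XYZW unfolding wedge_annihilator_def by blast
    then show ?thesis using XYZW by (simp add: wedge_1_3_def x(2))
  qed
  moreover have "x \<noteq> 0\<^sub>v m" using v x(2)[OF v(1)] by auto
  ultimately show thesis using that x(1) unfolding wedge_annihilating_def by blast
qed

text \<open>Suppose that \<open>x\<close> is anisotropic and let \<open>y\<close> be its multiple with \<open>B(x, y) = 1\<close>. For \<open>X, Y\<close> orthogonal to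
  \<open>x\<close> the bracket is \<open>\<omega>(X, Y) x\<close> with \<open>\<omega>(X, Y) = B([y, X], Y)\<close>, and the Jacobi identity becomes
  \<open>\<omega> \<and> \<omega> = 0\<close>. So every vector in the image of \<open>ad y\<close> annihilates \<open>I\<close>, and a non-zero one that is also
  in the kernel is isotropic because \<open>ad y\<close> is skew.\<close>

lemma isotropic_annihilator_vector:
  obtains x where "x \<in> V" "x \<noteq> 0\<^sub>v m" "B x x = 0" "wedge_annihilating m br x"
proof -
  obtain x where x: "x \<in> V" "x \<noteq> 0\<^sub>v m" and wedge: "wedge_annihilating m br x"
    using annihilator_vector by metis
  show thesis
  proof (cases "B x x = 0")
    case True
    then show thesis using that x wedge by blast
  next
    case False
    define c where "c = B x x"
    have c: "c \<noteq> 0" using False by (simp add: c_def)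
    define y where "y = inverse c \<cdot>\<^sub>v x"
    have y: "y \<in> V" "B x y = 1" using x c by (simp_all add: y_def canon_form_smult_right c_def)
    have xy: "x = c \<cdot>\<^sub>v y" using x c by (simp add: y_def smult_smult_assoc)
    have br_x: "br x X = c \<cdot>\<^sub>v br y X" if "X \<in> V" for X
      unfolding xy using y(1) that br_linear(2)[of y y X c] by (simp add: xy[symmetric])
    define \<omega> where "\<omega> X Y = B (br y X) Y" for X Y
    note formula = wedge_bracket_formula[OF x(1) wedge y, folded \<omega>_def]
    have alt: "\<omega> X Y = - \<omega> Y X" if "X \<in> V" "Y \<in> V" for X Y
      using br_ad_skew(2)[OF that y(1)] by (simp add: \<omega>_def)
    have \<omega>y: "\<omega> X y = 0" if "X \<in> V" for X using alt[OF that y(1)] that y(1) by (simp add: \<omega>_def)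
    have pluecker_ker: "\<omega> X Y * \<omega> Z W + \<omega> Y Z * \<omega> X W + \<omega> Z X * \<omega> Y W = 0"
      if X: "X \<in> V" "B x X = 0" and Y: "Y \<in> V" "B x Y = 0" and Z: "Z \<in> V" "B x Z = 0" and W: "W \<in> V"
      for X Y Z W
    proof -
      have inner: "br P Q = \<omega> P Q \<cdot>\<^sub>v x" if "P \<in> V" "Q \<in> V" "B x P = 0" "B x Q = 0" for P Q
      proof -
        have "0 \<cdot>\<^sub>v br y Q - 0 \<cdot>\<^sub>v br y P + \<omega> P Q \<cdot>\<^sub>v x = \<omega> P Q \<cdot>\<^sub>v x"
          using x(1) br_closed[OF y(1) that(1)] br_closed[OF y(1) that(2)] by (intro eq_vecI) auto
        then show ?thesis using formula[OF that(1,2)] that by simp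
      qed
      have outer: "B (br P (br Q R)) W = - c * \<omega> Q R * \<omega> P W"
        if "P \<in> V" "Q \<in> V" "R \<in> V" "B x P = 0" "B x Q = 0" "B x R = 0" for P Q R
      proof -
        have "B (br P (br Q R)) W = \<omega> Q R * B (br P x) W"
          unfolding inner[OF that(2,3,5,6)] br_linear(4)[OF x(1) x(1) that(1)]
          using that x W by (intro canon_form_smult_left) simp
        also have "B (br P x) W = - B (br x P) W" by (rule br_skew[OF that(1) x(1) W])
        also have "B (br x P) W = c * \<omega> P W"
          using that y(1) W by (simp add: br_x canon_form_smult_left \<omega>_def)
        finally show ?thesis by simp
      qed
      have "B (br Z (br X Y) + br X (br Y Z) + br Y (br Z X)) W = 0"
        using br_jacobi[OF Z(1) X(1) Y(1)] W by simp
      then have "- c * (\<omega> X Y * \<omega> Z W + \<omega> Y Z * \<omega> X W + \<omega> Z X * \<omega> Y W) = 0"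
        using X Y Z W by (simp add: canon_form_add_left outer algebra_simps)
      then show ?thesis using c by simp
    qed
    \<comment> \<open>\<open>\<omega>\<close> only sees the component orthogonal to \<open>x\<close>\<close>
    have pluecker: "\<omega> X Y * \<omega> Z W + \<omega> Y Z * \<omega> X W + \<omega> Z X * \<omega> Y W = 0"
      if "X \<in> V" "Y \<in> V" "Z \<in> V" "W \<in> V" for X Y Z W
    proof -
      define p where "p X = X + (- B x X) \<cdot>\<^sub>v y" for X
      have p: "p X \<in> V" "B x (p X) = 0" if "X \<in> V" for X
        using that x y by (simp_all add: p_def canon_form_bilinear)
      have \<omega>p: "\<omega> (p X) Y = \<omega> X Y" if "X \<in> V" "Y \<in> V" for X Y
        using that y alt[OF y(1) that(2)] \<omega>y[OF that(2)]
        by (simp add: p_def \<omega>_def br_linear(3)[of X "(- B x X) \<cdot>\<^sub>v y" y] br_linear(4)[of y y y] canon_form_bilinear)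
      have \<omega>p2: "\<omega> X (p Y) = \<omega> X Y" if "X \<in> V" "Y \<in> V" for X Y
        using alt[OF that(1) p(1)[OF that(2)]] \<omega>p[OF that(2,1)] alt[OF that] by simp
      show ?thesis
        using pluecker_ker[OF p(1)[OF that(1)] p(2)[OF that(1)] p(1)[OF that(2)] p(2)[OF that(2)]
            p(1)[OF that(3)] p(2)[OF that(3)] that(4)]
        using that by (simp add: \<omega>p \<omega>p2 p(1))
    qed
    have J: "assoc_form m br X Y Z = B x X * \<omega> Y Z - B x Y * \<omega> X Z + B x Z * \<omega> X Y"
      if "X \<in> V" "Y \<in> V" "Z \<in> V" for X Y Z
      using that x y unfolding assoc_form_def formula[OF that(1,2)]
      by (simp add: canon_form_bilinear \<omega>_def)
    obtain X where X: "X \<in> V" "br y X \<noteq> 0\<^sub>v m"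
    proof (rule ccontr)
      assume "\<not> thesis"
      then have "br y X = 0\<^sub>v m" if "X \<in> V" for X using that \<open>\<And>X. X \<in> V \<Longrightarrow> br y X \<noteq> 0\<^sub>v m \<Longrightarrow> thesis\<close> by blast
      then have "br X Y = 0\<^sub>v m" if "X \<in> V" "Y \<in> V" for X Y
        unfolding formula[OF that] using that x by (auto simp: \<omega>_def)
      then have "abelian m br" by (simp add: abelian_def)
      then show False using NS by (simp add: nilpotent_singular_def singular_def)
    qed
    obtain k where "(br y ^^ k) X = 0\<^sub>v m" using br_iterate_vanishes X(1) y(1) by blast
    then obtain w where w: "br y w \<noteq> 0\<^sub>v m" "br y (br y w) = 0\<^sub>v m" "w \<in> V"
      using exists_last_iterate[of "br y" X "0\<^sub>v m" k] X y(1) br_zero br_iterate_closed by metis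
    show thesis
    proof (rule that[of "br y w"])
      show "B (br y w) (br y w) = 0" using br_ad_skew(1)[of w "br y w" y] w y(1) by simp
      have "wedge_1_3 (\<omega> w) (assoc_form m br) X Y Z W = 0"
        if XYZW: "X \<in> V" "Y \<in> V" "Z \<in> V" "W \<in> V" for X Y Z W
        by (rule contraction_wedge_zero[where V = V and \<alpha> = "B x"])
          (assumption | rule alt pluecker J w(3) XYZW)+
      then show "wedge_annihilating m br (br y w)"
        unfolding wedge_annihilating_def by (simp add: \<omega>_def[abs_def])
    qed (use w y in auto)
  qed
qed

end

text \<open>Once \<open>x\<close> is known to be central, \<open>ad y\<close> kills the hyperbolic pair \<open>x, y\<close> and preserves its orthogonal
  complement. By Witt's theorem there is an isometry \<open>\<phi>\<close> that takes \<open>X\<^sub>1, Y\<^sub>1\<close> to \<open>x, y\<close>, and \<open>C\<close> is the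
  restriction of \<open>ad y\<close> in the coordinates given by \<open>\<phi>\<close>.\<close>

theorem nilpotent_singular_is_double_extension:
  assumes NS: "g \<in> nilpotent_singular (n + 2)"
  obtains \<phi> C where "dext_isometry n \<phi>" "C \<in> nonzero_nilpotents n" "g = double_extension n \<phi> C"
proof -
  let ?V = "carrier_vec (n + 2) :: complex vec set" and ?B = "canon_form (n + 2)"
  note closed = br_closed[OF NS] note linear = br_linear[OF NS]
  obtain x where x: "x \<in> ?V" "x \<noteq> 0\<^sub>v (n + 2)" "?B x x = 0" and wedge: "wedge_annihilating (n + 2) g x"
    using isotropic_annihilator_vector[OF NS] by metis
  obtain y where y: "y \<in> ?V" "?B x y = 1" "?B y y = 0"
  proof -
    obtain z where z: "z \<in> ?V" "?B x z \<noteq> 0" using canon_form_nondegenerate[OF x(1,2)] .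
    define z' where "z' = inverse (?B x z) \<cdot>\<^sub>v z"
    have z': "z' \<in> ?V" "?B x z' = 1" using z by (simp_all add: z'_def canon_form_smult_right)
    have "?B (z' - (?B z' z' / 2) \<cdot>\<^sub>v x) (z' - (?B z' z' / 2) \<cdot>\<^sub>v x) = 0"
      using x z' canon_form_sym[of "n + 2" z' x] by (simp add: canon_form_bilinear)
    then show thesis
      by (intro that[of "z' - (?B z' z' / 2) \<cdot>\<^sub>v x"]) (use x z' in \<open>simp_all add: canon_form_bilinear\<close>)
  qed
  define d where "d = g y"
  have d: "d X \<in> ?V" if "X \<in> ?V" for X using that y(1) closed by (simp add: d_def)
  have d_add: "d (X + Y) = d X + d Y" if "X \<in> ?V" "Y \<in> ?V" for X Y
    using linear(3)[OF that y(1)] by (simp add: d_def)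
  have d_smult: "d (c \<cdot>\<^sub>v X) = c \<cdot>\<^sub>v d X" if "X \<in> ?V" for X c
    using linear(4)[OF that that y(1)] by (simp add: d_def)
  have dy: "d y = 0\<^sub>v (n + 2)" using br_self[OF NS y(1)] by (simp add: d_def)
  have d_skew: "?B (d X) Y = - ?B X (d Y)" if "X \<in> ?V" "Y \<in> ?V" for X Y
    using br_ad_skew(1)[OF NS that y(1)] by (simp add: d_def)
  note formula = wedge_bracket_formula[OF NS x(1) wedge y(1,2), folded d_def]
  \<comment> \<open>\<open>x\<close> is an eigenvector of each element \<open>Z\<close> orthogonal to it, with eigenvalue \<open>B([y, Z], x)\<close>, which
    vanishes by nilpotency\<close>
  have dx_ker: "?B (d x) Z = 0" if Z: "Z \<in> ?V" "?B x Z = 0" for Z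
  proof (rule ccontr)
    assume nz: "?B (d x) Z \<noteq> 0"
    define c where "c = ?B (d Z) x"
    have c: "c \<noteq> 0"
      using nz d_skew[OF Z(1) x(1)] canon_form_sym[of "n + 2" Z "d x"] by (simp add: c_def)
    have "0 \<cdot>\<^sub>v d x - 0 \<cdot>\<^sub>v d Z + c \<cdot>\<^sub>v x = c \<cdot>\<^sub>v x"
      using x(1) d[OF x(1)] d[OF Z(1)] by (intro eq_vecI) auto
    then have "g Z x = c \<cdot>\<^sub>v x" using formula[OF Z(1) x(1)] Z x by (simp add: c_def)
    then have "g (inverse c \<cdot>\<^sub>v Z) x = x"
      using linear(2)[OF Z(1) Z(1) x(1)] c x by (simp add: smult_smult_assoc)
    then have "x = 0\<^sub>v (n + 2)"
      using nilpotent_no_eigenvector[of "n + 2" g "inverse c \<cdot>\<^sub>v Z" x] closed NS Z x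
      by (simp add: nilpotent_singular_def)
    then show False using x by simp
  qed
  have dx: "d x = 0\<^sub>v (n + 2)"
  proof (rule canon_form_eqI[of _ "n + 2"])
    fix Z assume Z: "Z \<in> ?V"
    have "?B (d x) (Z - ?B x Z \<cdot>\<^sub>v y) = 0"
      by (rule dx_ker) (use x y Z in \<open>simp_all add: canon_form_bilinear\<close>)
    moreover have "?B (d x) y = 0" using d_skew[OF x(1) y(1)] dy x by simp
    ultimately show "?B (d x) Z = ?B (0\<^sub>v (n + 2)) Z"
      using x y Z d by (simp add: canon_form_bilinear)
  qed (use d x in auto)
  obtain \<phi>0 where \<phi>0: "dext_isometry n \<phi>0" using dext_isometry_exists by blast
  have zero_act: "0\<^sub>m (n + 2) (n + 2) *\<^sub>v v = 0\<^sub>v (n + 2)" if "v \<in> ?V" for v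
    using that by (intro eq_vecI) auto
  have zero_alg: "0\<^sub>m (n + 2) (n + 2) \<in> orth_algebra (n + 2)"
    by (simp add: orth_algebra_def zero_act)
  let ?e = "\<phi>0 (1, 0, 0\<^sub>v n)" and ?f = "\<phi>0 (0, 1, 0\<^sub>v n)"
  have ef: "?e \<in> ?V" "?f \<in> ?V" "?B ?e ?e = 0" "?B ?f ?f = 0" "?B ?e ?f = 1"
    by (simp_all add: dext_closed[OF \<phi>0] dext_canon_form[OF \<phi>0])
  obtain T where T: "T \<in> orth_group (n + 2)" "T *\<^sub>v ?e = x" "T *\<^sub>v ?f = y"
    using transport_hyperbolic_pair_in_kernel[OF zero_alg ef(1) zero_act[OF ef(1)] ef(2) zero_act[OF ef(2)]
        x(1) zero_act[OF x(1)] y(1) zero_act[OF y(1)] ef(3-5) x(3) y(3,2)] by metis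
  note Tc = orth_groupD(1)[OF T(1)]
  obtain T' where T': "T' \<in> orth_group (n + 2)" "\<And>v. v \<in> ?V \<Longrightarrow> T' *\<^sub>v (T *\<^sub>v v) = v"
    "\<And>v. v \<in> ?V \<Longrightarrow> T *\<^sub>v (T' *\<^sub>v v) = v"
    using orth_group_inverse[OF T(1)] by metis
  note T'c = orth_groupD(1)[OF T'(1)]
  define \<phi> where "\<phi> u = T *\<^sub>v \<phi>0 u" for u
  have \<phi>: "dext_isometry n \<phi>"
  proof -
    have "bij_betw ((*\<^sub>v) T) ?V ?V"
      by (rule bij_betwI[where g = "(*\<^sub>v) T'"]) (use Tc T'c T' in auto)
    then have "bij_betw ((*\<^sub>v) T \<circ> \<phi>0) (dext_carrier n) ?V"
      using \<phi>0 unfolding dext_isometry_def by (blast intro: bij_betw_trans)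
    moreover have "\<phi>0 u \<in> ?V" if "u \<in> dext_carrier n" for u
      using that \<phi>0 unfolding dext_isometry_def by (auto dest: bij_betwE)
    ultimately show ?thesis
      using \<phi>0 orth_groupD(3)[OF T(1)]
      unfolding dext_isometry_def \<phi>_def
      by (auto simp: comp_def mult_add_distrib_mat_vec[OF Tc] mult_mat_vec[OF Tc])
  qed
  have \<phi>x: "\<phi> (1, 0, 0\<^sub>v n) = x" and \<phi>y: "\<phi> (0, 1, 0\<^sub>v n) = y" using T by (simp_all add: \<phi>_def)
  note dc = dext_closed[OF \<phi>]
  have "\<exists>Y. Y \<in> carrier_vec n \<and> d (\<phi> (0, 0, X)) = \<phi> (0, 0, Y)" if X: "X \<in> carrier_vec n" for X
  proof -
    obtain l \<mu> Y where Y: "Y \<in> carrier_vec n" "d (\<phi> (0, 0, X)) = \<phi> (l, \<mu>, Y)"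
      using dext_surj[OF \<phi> d[OF dc[OF X]]] .
    have "?B (d (\<phi> (0, 0, X))) (\<phi> (1, 0, 0\<^sub>v n)) = 0" "?B (d (\<phi> (0, 0, X))) (\<phi> (0, 1, 0\<^sub>v n)) = 0"
      using d_skew[OF dc[OF X] x(1)] d_skew[OF dc[OF X] y(1)] dc[OF X] by (simp_all add: \<phi>x \<phi>y dx dy)
    then have "\<mu> = 0" "l = 0" using Y(1) by (simp_all add: Y(2) dext_canon_form[OF \<phi>])
    then show ?thesis using Y by blast
  qed
  then obtain f where f: "\<And>X. X \<in> carrier_vec n \<Longrightarrow> f X \<in> carrier_vec n"
    "\<And>X. X \<in> carrier_vec n \<Longrightarrow> d (\<phi> (0, 0, X)) = \<phi> (0, 0, f X)" by metis
  obtain C where C: "C \<in> carrier_mat n n" "\<And>X. X \<in> carrier_vec n \<Longrightarrow> C *\<^sub>v X = f X"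
  proof (rule linear_map_mat[of n f n])
    show "f (X + Y) = f X + f Y" if "X \<in> carrier_vec n" "Y \<in> carrier_vec n" for X Y
    proof -
      have "\<phi> (0, 0, X + Y) = \<phi> (0, 0, X) + \<phi> (0, 0, Y)" using that by (simp add: dext_plus[OF \<phi>])
      then have "d (\<phi> (0, 0, X + Y)) = d (\<phi> (0, 0, X)) + d (\<phi> (0, 0, Y))"
        using that dc by (simp add: d_add)
      then show ?thesis using that f(1) by (simp add: f(2) dext_plus[OF \<phi>] dext_eq_iff[OF \<phi>])
    qed
    show "f (c \<cdot>\<^sub>v X) = c \<cdot>\<^sub>v f X" if "X \<in> carrier_vec n" for c X
    proof -
      have "\<phi> (0, 0, c \<cdot>\<^sub>v X) = c \<cdot>\<^sub>v \<phi> (0, 0, X)" using that by (simp add: dext_smult[OF \<phi>])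
      then have "d (\<phi> (0, 0, c \<cdot>\<^sub>v X)) = c \<cdot>\<^sub>v d (\<phi> (0, 0, X))" using that dc by (simp add: d_smult)
      then show ?thesis using that f(1) by (simp add: f(2) dext_smult[OF \<phi>] dext_eq_iff[OF \<phi>])
    qed
  qed (use f in auto)
  have Cv: "C *\<^sub>v X \<in> carrier_vec n" if "X \<in> carrier_vec n" for X using C(1) that by simp
  have d\<phi>: "d (\<phi> (l, \<mu>, X)) = \<phi> (0, 0, C *\<^sub>v X)" if X: "X \<in> carrier_vec n" for l \<mu> X
  proof -
    have "\<phi> (l, \<mu>, X) = l \<cdot>\<^sub>v x + (\<mu> \<cdot>\<^sub>v y + \<phi> (0, 0, X))"
    proof -
      have "l \<cdot>\<^sub>v 0\<^sub>v n + (\<mu> \<cdot>\<^sub>v 0\<^sub>v n + X) = X" using X by (intro eq_vecI) auto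
      then show ?thesis unfolding \<phi>x[symmetric] \<phi>y[symmetric]
        using X by (simp add: dext_smult[OF \<phi>] dext_plus[OF \<phi>])
    qed
    then have "d (\<phi> (l, \<mu>, X)) = l \<cdot>\<^sub>v d x + (\<mu> \<cdot>\<^sub>v d y + d (\<phi> (0, 0, X)))"
      using x(1) y(1) dc[OF X] by (simp add: d_add d_smult)
    also have "\<dots> = d (\<phi> (0, 0, X))"
    proof -
      have "l \<cdot>\<^sub>v 0\<^sub>v (n + 2) + (\<mu> \<cdot>\<^sub>v 0\<^sub>v (n + 2) + u) = u" if "u \<in> ?V" for u
        using that by (intro eq_vecI) auto
      then show ?thesis using d[OF dc[OF X]] by (simp add: dx dy)
    qed
    finally show ?thesis using X by (simp add: f(2) C(2))
  qed
  have skew: "C \<in> orth_algebra n"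
  proof -
    have "canon_form n (C *\<^sub>v X) Y = - canon_form n X (C *\<^sub>v Y)"
      if X: "X \<in> carrier_vec n" and Y: "Y \<in> carrier_vec n" for X Y
      using d_skew[OF dc[OF X] dc[OF Y], of 0 0 0 0] X Y Cv by (simp add: d\<phi> dext_canon_form[OF \<phi>])
    then show ?thesis unfolding orth_algebra_def using C(1) by blast
  qed
  have g\<phi>: "g u v = double_extension n \<phi> C u v" if u: "u \<in> ?V" and v: "v \<in> ?V" for u v
  proof -
    obtain l \<mu> X where X: "X \<in> carrier_vec n" "u = \<phi> (l, \<mu>, X)" using dext_surj[OF \<phi> u] .
    obtain l' \<mu>' Y where Y: "Y \<in> carrier_vec n" "v = \<phi> (l', \<mu>', Y)" using dext_surj[OF \<phi> v] .
    have coord: "?B x (\<phi> (k, r, Z)) = r" if "Z \<in> carrier_vec n" for k r Z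
      using that unfolding \<phi>x[symmetric] by (simp add: dext_canon_form[OF \<phi>])
    have xs: "c \<cdot>\<^sub>v x = \<phi> (c, 0, 0\<^sub>v n)" for c
    proof -
      have "c \<cdot>\<^sub>v 0\<^sub>v n = (0\<^sub>v n :: complex vec)" by (intro eq_vecI) auto
      then show ?thesis unfolding \<phi>x[symmetric] by (simp add: dext_smult[OF \<phi>])
    qed
    have "w + 0\<^sub>v n = w" if "w \<in> carrier_vec n" for w :: "complex vec" using that by simp
    then show ?thesis
      using formula[OF u v] X Y Cv[OF X(1)] Cv[OF Y(1)]
      by (simp add: d\<phi> coord xs dext_smult[OF \<phi>] dext_minus[OF \<phi>] dext_plus[OF \<phi>] dext_canon_form[OF \<phi>]
          double_extension_apply[OF \<phi>])
  qed
  have geq: "g = double_extension n \<phi> C"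
  proof
    have gext: "g \<in> ?V \<rightarrow>\<^sub>E (?V \<rightarrow>\<^sub>E ?V)"
      using NS unfolding nilpotent_singular_def quadratic_structures_def lie_structures_def by blast
    fix u show "g u = double_extension n \<phi> C u"
    proof (cases "u \<in> ?V")
      case True
      then have "g u \<in> ?V \<rightarrow>\<^sub>E ?V" using gext by blast
      show ?thesis
      proof
        fix v show "g u v = double_extension n \<phi> C u v"
        proof (cases "v \<in> ?V")
          case False
          then show ?thesis
            using PiE_arb[OF \<open>g u \<in> ?V \<rightarrow>\<^sub>E ?V\<close>] True by (simp add: double_extension_def)
        qed (use True g\<phi> in blast)
      qed
    next
      case False
      then show ?thesis using PiE_arb[OF gext] by (simp add: double_extension_def)
    qed
  qed
  have nz: "C \<noteq> 0\<^sub>m n n"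
  proof
    assume C0: "C = 0\<^sub>m n n"
    have C0v: "0\<^sub>m n n *\<^sub>v X = 0\<^sub>v n" if "X \<in> carrier_vec n" for X :: "complex vec"
      using that by (intro eq_vecI) auto
    have "g u v = 0\<^sub>v (n + 2)" if u: "u \<in> ?V" and v: "v \<in> ?V" for u v
    proof -
      obtain l \<mu> X where X: "X \<in> carrier_vec n" "u = \<phi> (l, \<mu>, X)" using dext_surj[OF \<phi> u] .
      obtain l' \<mu>' Y where Y: "Y \<in> carrier_vec n" "v = \<phi> (l', \<mu>', Y)" using dext_surj[OF \<phi> v] .
      have "\<mu> \<cdot>\<^sub>v 0\<^sub>v n - \<mu>' \<cdot>\<^sub>v 0\<^sub>v n = 0\<^sub>v n" by (intro eq_vecI) auto
      then show ?thesis
        unfolding geq using X Y by (simp add: double_extension_apply[OF \<phi>] C0 C0v dext_zero[OF \<phi>])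
    qed
    then have "abelian (n + 2) g" by (simp add: abelian_def)
    then show False using NS by (simp add: nilpotent_singular_def singular_def)
  qed
  have "\<exists>k. C ^\<^sub>m k = 0\<^sub>m n n"
  proof -
    obtain k where k: "\<And>X. X \<in> ?V \<Longrightarrow> (d ^^ k) X = 0\<^sub>v (n + 2)"
      using br_iterate_vanishes[OF NS] y(1) unfolding d_def by blast
    have iter: "(d ^^ i) (\<phi> (0, 0, X)) = \<phi> (0, 0, ((*\<^sub>v) C ^^ i) X) \<and> ((*\<^sub>v) C ^^ i) X \<in> carrier_vec n"
      if "X \<in> carrier_vec n" for i X
      by (induction i) (use that Cv d\<phi> in auto)
    have "C ^\<^sub>m k = 0\<^sub>m n n"
    proof (rule mat_eq_if_same_action[of _ n n])
      fix X :: "complex vec" assume X: "X \<in> carrier_vec n"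
      have "\<phi> (0, 0, ((*\<^sub>v) C ^^ k) X) = \<phi> (0, 0, 0\<^sub>v n)"
        using iter[OF X, of k] k[OF dc[OF X]] by (simp add: dext_zero[OF \<phi>])
      then have "((*\<^sub>v) C ^^ k) X = 0\<^sub>v n" using iter[OF X, of k] by (simp add: dext_eq_iff[OF \<phi>])
      moreover have "0\<^sub>m n n *\<^sub>v X = 0\<^sub>v n" using X by (intro eq_vecI) auto
      ultimately show "C ^\<^sub>m k *\<^sub>v X = 0\<^sub>m n n *\<^sub>v X" by (simp add: pow_mat_act[OF C(1) X])
    qed (use C in auto)
    then show ?thesis ..
  qed
  then have "C \<in> nonzero_nilpotents n" using skew nz by (simp add: nonzero_nilpotents_def)
  then show thesis using that \<phi> geq by blast
qed

section \<open>The classification\<close>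

lemma double_extension_iso_iff:
  assumes \<phi>: "dext_isometry n \<phi>" and \<phi>': "dext_isometry n \<phi>'"
    and C: "C \<in> nonzero_nilpotents n" and C': "C' \<in> nonzero_nilpotents n"
  shows "i_isomorphic (n + 2) (double_extension n \<phi> C) (double_extension n \<phi>' C')
      \<longleftrightarrow> adjoint_orbit n C = adjoint_orbit n C'"
    and "isomorphic (n + 2) (double_extension n \<phi> C) (double_extension n \<phi>' C')
      \<longleftrightarrow> adjoint_orbit n C = adjoint_orbit n C'"
proof -
  have "i_isomorphic k g g' \<Longrightarrow> isomorphic k g g'" for k g g'
    unfolding i_isomorphic_def isomorphic_def using orth_groupD(2) by blast
  moreover have "C \<in> orth_algebra n" "C' \<in> orth_algebra n" using C C' by (auto simp: nonzero_nilpotents_def)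
  ultimately show "i_isomorphic (n + 2) (double_extension n \<phi> C) (double_extension n \<phi>' C')
      \<longleftrightarrow> adjoint_orbit n C = adjoint_orbit n C'"
    "isomorphic (n + 2) (double_extension n \<phi> C) (double_extension n \<phi>' C')
      \<longleftrightarrow> adjoint_orbit n C = adjoint_orbit n C'"
    using isomorphic_double_extensions_same_orbit[OF \<phi> \<phi>' C C'] same_orbit_imp_i_isomorphic[OF \<phi> \<phi>'] by blast+
qed

theorem theorem4:
  fixes n :: nat
  assumes "n \<ge> 1"
  shows
    "((\<forall>g\<in>nilpotent_singular (n + 2). \<forall>g'\<in>nilpotent_singular (n + 2).
         i_isomorphic (n + 2) g g' \<longleftrightarrow> isomorphic (n + 2) g g') \<and>
      i_iso_classes (n + 2) = iso_classes (n + 2)) \<and>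
     (\<exists>\<Phi>. bij_betw \<Phi> (nilpotent_orbits n) (i_iso_classes (n + 2)) \<and>
        (\<forall>\<phi> C. dext_isometry n \<phi> \<longrightarrow> C \<in> nonzero_nilpotents n \<longrightarrow>
           double_extension n \<phi> C \<in> nilpotent_singular (n + 2) \<and>
           \<Phi> (adjoint_orbit n C) = i_iso_class (n + 2) (double_extension n \<phi> C))) \<and>
     finite (iso_classes (n + 2))"
proof -
  have iso_iff: "i_isomorphic (n + 2) g g' \<longleftrightarrow> isomorphic (n + 2) g g'"
    if g: "g \<in> nilpotent_singular (n + 2)" and g': "g' \<in> nilpotent_singular (n + 2)" for g g'
  proof -
    obtain \<phi> C where "dext_isometry n \<phi>" "C \<in> nonzero_nilpotents n" "g = double_extension n \<phi> C"
      using nilpotent_singular_is_double_extension[OF g] .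
    moreover obtain \<phi>' C' where "dext_isometry n \<phi>'" "C' \<in> nonzero_nilpotents n" "g' = double_extension n \<phi>' C'"
      using nilpotent_singular_is_double_extension[OF g'] .
    ultimately show ?thesis by (simp add: double_extension_iso_iff)
  qed
  then have "i_iso_class (n + 2) g = iso_class (n + 2) g" if "g \<in> nilpotent_singular (n + 2)" for g
    using that unfolding i_iso_class_def iso_class_def by blast
  then have classes: "i_iso_classes (n + 2) = iso_classes (n + 2)"
    unfolding i_iso_classes_def iso_classes_def by (intro image_cong) auto
  obtain \<phi>0 where \<phi>0: "dext_isometry n \<phi>0" using dext_isometry_exists by blast
  define \<Phi> where "\<Phi> X = i_iso_class (n + 2)
      (double_extension n \<phi>0 (inv_into (nonzero_nilpotents n) (adjoint_orbit n) X))" for X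
  have class_eq: "i_iso_class (n + 2) (double_extension n \<phi> C)
      = {double_extension n \<phi>' C' | \<phi>' C'. dext_isometry n \<phi>' \<and> C' \<in> nonzero_nilpotents n \<and>
          adjoint_orbit n C = adjoint_orbit n C'}" (is "_ = ?S")
    if \<phi>: "dext_isometry n \<phi>" and C: "C \<in> nonzero_nilpotents n" for \<phi> C
  proof
    show "i_iso_class (n + 2) (double_extension n \<phi> C) \<subseteq> ?S"
    proof
      fix g assume "g \<in> i_iso_class (n + 2) (double_extension n \<phi> C)"
      then have g: "g \<in> nilpotent_singular (n + 2)" "i_isomorphic (n + 2) (double_extension n \<phi> C) g"
        by (simp_all add: i_iso_class_def)
      obtain \<phi>' C' where "dext_isometry n \<phi>'" "C' \<in> nonzero_nilpotents n" "g = double_extension n \<phi>' C'"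
        using nilpotent_singular_is_double_extension[OF g(1)] .
      then show "g \<in> ?S" using g(2) \<phi> C double_extension_iso_iff(1) by blast
    qed
    show "?S \<subseteq> i_iso_class (n + 2) (double_extension n \<phi> C)"
      using \<phi> C double_extension_iso_iff(1) double_extension_nilpotent_singular
      unfolding i_iso_class_def by blast
  qed
  have \<Phi>: "\<Phi> (adjoint_orbit n C) = i_iso_class (n + 2) (double_extension n \<phi> C)"
    if \<phi>: "dext_isometry n \<phi>" and C: "C \<in> nonzero_nilpotents n" for \<phi> C
  proof -
    let ?C0 = "inv_into (nonzero_nilpotents n) (adjoint_orbit n) (adjoint_orbit n C)"
    have "?C0 \<in> nonzero_nilpotents n" "adjoint_orbit n ?C0 = adjoint_orbit n C"
      using C by (simp_all add: inv_into_into f_inv_into_f)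
    then show ?thesis unfolding \<Phi>_def using class_eq[OF \<phi>0] class_eq[OF \<phi> C] by simp
  qed
  have bij: "bij_betw \<Phi> (nilpotent_orbits n) (i_iso_classes (n + 2))"
    unfolding bij_betw_def
  proof
    show "inj_on \<Phi> (nilpotent_orbits n)"
    proof (rule inj_onI)
      fix X Y assume "X \<in> nilpotent_orbits n" "Y \<in> nilpotent_orbits n" and eq: "\<Phi> X = \<Phi> Y"
      then obtain C D where C: "C \<in> nonzero_nilpotents n" "X = adjoint_orbit n C"
        and D: "D \<in> nonzero_nilpotents n" "Y = adjoint_orbit n D"
        unfolding nilpotent_orbits_def by blast
      have "double_extension n \<phi>0 D \<in> i_iso_class (n + 2) (double_extension n \<phi>0 D)"
        unfolding i_iso_class_def
        using double_extension_nilpotent_singular[OF \<phi>0 D(1)] double_extension_iso_iff(1)[OF \<phi>0 \<phi>0 D(1) D(1)] by simp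
      also have "\<dots> = i_iso_class (n + 2) (double_extension n \<phi>0 C)"
        using eq \<Phi>[OF \<phi>0 C(1)] \<Phi>[OF \<phi>0 D(1)] C D by simp
      finally show "X = Y"
        using double_extension_iso_iff(1)[OF \<phi>0 \<phi>0 C(1) D(1)] C D by (simp add: i_iso_class_def)
    qed
    show "\<Phi> ` nilpotent_orbits n = i_iso_classes (n + 2)"
    proof
      show "\<Phi> ` nilpotent_orbits n \<subseteq> i_iso_classes (n + 2)"
        unfolding nilpotent_orbits_def i_iso_classes_def
        using \<Phi>[OF \<phi>0] double_extension_nilpotent_singular[OF \<phi>0] by blast
      show "i_iso_classes (n + 2) \<subseteq> \<Phi> ` nilpotent_orbits n"
      proof
        fix K assume "K \<in> i_iso_classes (n + 2)"
        then obtain g where g: "g \<in> nilpotent_singular (n + 2)" "K = i_iso_class (n + 2) g"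
          unfolding i_iso_classes_def by blast
        obtain \<phi> C where "dext_isometry n \<phi>" "C \<in> nonzero_nilpotents n" "g = double_extension n \<phi> C"
          using nilpotent_singular_is_double_extension[OF g(1)] .
        then have "K = \<Phi> (adjoint_orbit n C)" "adjoint_orbit n C \<in> nilpotent_orbits n"
          using g(2) \<Phi> by (simp_all add: nilpotent_orbits_def)
        then show "K \<in> \<Phi> ` nilpotent_orbits n" by blast
      qed
    qed
  qed
  have "finite (i_iso_classes (n + 2))" using bij_betw_finite[OF bij] finite_nilpotent_orbits by blast
  then show ?thesis
    using iso_iff classes bij \<Phi> double_extension_nilpotent_singular by (intro conjI exI[of _ \<Phi>]) auto
qed

end
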